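(* Let $f:\mathbb R^n\to\mathbb R$ be Lipschitz with constant $c$ with respect to the Euclidean norm, and let $F=(F_1,\dots,F_n)$ be a vector of independent random functionals, $F_i=F_i(\omega_i)$. Let $$\beta_i=\sup_{y\in Y,\,y\ne0,\ \omega\in\Omega^X}\frac{|D_yF_i(\omega)|}{|y|_Y},\qquad i=1,\dots,n,$$ and assume that $$h(t)=8\max_{1\le i\le n}\beta_i\int_Y|y|_Y\big(e^{t\beta_i|y|_Y}-1\big)\nu_i(dy)+\frac{2n}{(E[|F-E[F]|_2])^2}\max_{1\le i\le n}\beta_i^3\int_Y|y|_Y^3\big(e^{t\beta_i|y|_Y}-1\big)\nu_i(dy)$$ is finite for $t\in[0,t_0)$. Then $$P\left(f(F_1,\dots,F_n)\ge E[f(F_1,\dots,F_n)]+c\sqrt{2\sum_{i=1}^n\mathrm{Var}\,F_i}+cx\right)\le\exp\left(-\int_0^xh^{-1}(s)\,ds\right),\qquad 0<x<h(t_0^-).$$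
   Context: $Y$ is a normed linear space with norm $|\cdot|_Y$, $\nu_1,\dots,\nu_n$ are diffuse Radon measures on $Y$, $X=\{1,\dots,n\}\times Y$ with $d\nu(i,y)=d\nu_i(y)$. $\Omega^X\simeq\Omega^Y\times\cdots\times\Omega^Y$, $\omega=(\omega_1,\dots,\omega_n)$, is the configuration space (locally finite sets of distinct points), and $P$ is the Poisson measure with intensity $\nu$, so that $\omega_1,\dots,\omega_n$ are independent Poisson configurations on $Y$ with intensities $\nu_1,\dots,\nu_n$. Each $F_i$ depends only on $\omega_i$, and $D_yF_i(\omega)=F_i(\omega_i\cup\{y\})-F_i(\omega_i)$. $|\cdot|_2$ is the Euclidean norm on $\mathbb R^n$. Suprema over $\Omega^X$ may be taken as essential suprema. $h^{-1}(x)=\inf\{t>0:h(t)\ge x\}$ and $h(t_0^-)$ is the left limit of $h$ at $t_0$. *)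

theory Defs
  imports "HOL-Probability.Probability"
begin

section \<open>Radon measures\<close>

definition radon_measure :: "'a::topological_space measure \<Rightarrow> bool" where
  "radon_measure \<mu> \<longleftrightarrow>
     sets \<mu> = sets borel \<and>
     (\<forall>x. \<exists>U. open U \<and> x \<in> U \<and> emeasure \<mu> U < \<infinity>) \<and>
     (\<forall>A\<in>sets borel. emeasure \<mu> A = (SUP K\<in>{K. compact K \<and> K \<subseteq> A}. emeasure \<mu> K))"

definition diffuse :: "'a measure \<Rightarrow> bool" where
  "diffuse \<mu> \<longleftrightarrow> (\<forall>x. emeasure \<mu> {x} = 0)"

section \<open>Configurations and Poisson measures\<close>

text \<open>A configuration is a set, so its points are automatically distinct.\<close>

definition configurations :: "'a topology \<Rightarrow> 'a set set" where
  "configurations T =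
     {\<omega>. \<omega> \<subseteq> topspace T \<and>
          (\<forall>x\<in>topspace T. \<exists>U. openin T U \<and> x \<in> U \<and> finite (\<omega> \<inter> U))}"

text \<open>The number of points of \<open>\<omega>\<close> in \<open>A\<close>, with value \<open>\<infinity>\<close> if there are infinitely many.\<close>

definition num_points :: "'a set \<Rightarrow> 'a set \<Rightarrow> ennreal" where
  "num_points \<omega> A = emeasure (count_space UNIV) (\<omega> \<inter> A)"

text \<open>The sigma-algebra on the configuration space generated by the counting maps
  \<open>\<omega> \<mapsto> num_points \<omega> A\<close>, where \<open>A\<close> ranges over the measurable sets of \<open>M\<close>.  Since these maps take
  values in the natural numbers and \<open>\<infinity>\<close>, the level sets at natural numbers suffice.
  (Only the sigma-algebra of the measure \<open>M\<close> matters.)\<close>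

definition config_algebra :: "'a topology \<Rightarrow> 'a measure \<Rightarrow> 'a set measure" where
  "config_algebra T M =
     sigma (configurations T)
       {{\<omega> \<in> configurations T. num_points \<omega> A = of_nat k} | A k. A \<in> sets M}"

text \<open>\<open>P\<close> is the Poisson measure with intensity \<open>\<nu>\<close> on the configurations of \<open>T\<close>.  The usual
  requirement that \<open>A\<close> contains infinitely many points almost surely when \<open>\<nu> A = \<infinity>\<close> follows for
  the measures considered here: a set of infinite measure contains sets of arbitrarily large
  finite measure, by inner regularity.\<close>

definition poisson_measure :: "'a topology \<Rightarrow> 'a measure \<Rightarrow> 'a set measure \<Rightarrow> bool" where
  "poisson_measure T \<nu> P \<longleftrightarrow>
     prob_space P \<and>
     sets P = sets (config_algebra T \<nu>) \<and>
     (\<forall>A\<in>sets \<nu>. emeasure \<nu> A < \<infinity> \<longrightarrow>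
        (\<forall>k::nat. measure P {\<omega> \<in> space P. num_points \<omega> A = of_nat k} =
            exp (- measure \<nu> A) * measure \<nu> A ^ k / fact k)) \<and>
     (\<forall>(A :: nat \<Rightarrow> 'a set) m.
        (\<forall>j<m. A j \<in> sets \<nu> \<and> emeasure \<nu> (A j) < \<infinity>) \<and> disjoint_family_on A {..<m} \<longrightarrow>
        prob_space.indep_vars P (\<lambda>_. borel) (\<lambda>j \<omega>. num_points \<omega> (A j)) {..<m})"

section \<open>The space \<open>X\<close>, a disjoint union of finitely many copies of \<open>Y\<close>\<close>

definition X_topology :: "('n \<times> 'y::topological_space) topology" where
  "X_topology = prod_topology (discrete_topology UNIV) euclidean"

definition X_measure :: "('n::finite \<Rightarrow> 'y::topological_space measure) \<Rightarrow> ('n \<times> 'y) measure" where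
  "X_measure \<nu> =
     measure_of UNIV (sets (count_space UNIV \<Otimes>\<^sub>M borel))
       (\<lambda>A. \<Sum>i\<in>UNIV. emeasure (\<nu> i) (Pair i -` A))"

lemma sets_X_measure [simp]: "sets (X_measure \<nu>) = sets (count_space UNIV \<Otimes>\<^sub>M borel)"
  unfolding X_measure_def
  using sets.sets_measure_of_eq[of "count_space UNIV \<Otimes>\<^sub>M borel"]
  by (simp add: space_pair_measure)

lemma emeasure_X_measure:
  fixes \<nu> :: "'n::finite \<Rightarrow> 'y::topological_space measure"
  assumes \<nu>: "\<And>i. sets (\<nu> i) = sets borel" and A: "A \<in> sets (count_space UNIV \<Otimes>\<^sub>M borel)"
  shows "emeasure (X_measure \<nu>) A = (\<Sum>i\<in>UNIV. emeasure (\<nu> i) (Pair i -` A))"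
proof (rule emeasure_measure_of[OF X_measure_def])
  let ?S = "sets (count_space (UNIV :: 'n set) \<Otimes>\<^sub>M (borel :: 'y measure))"
  show "?S \<subseteq> Pow UNIV" by simp
  show "A \<in> sets (X_measure \<nu>)" using A by simp
  show "positive (sets (X_measure \<nu>)) (\<lambda>A. \<Sum>i\<in>UNIV. emeasure (\<nu> i) (Pair i -` A))"
    by (simp add: positive_def)
  show "countably_additive (sets (X_measure \<nu>)) (\<lambda>A. \<Sum>i\<in>UNIV. emeasure (\<nu> i) (Pair i -` A))"
  proof (rule countably_additiveI)
    fix B :: "nat \<Rightarrow> ('n \<times> 'y) set"
    assume B: "range B \<subseteq> sets (X_measure \<nu>)" and d: "disjoint_family B"
    have m: "Pair i -` B j \<in> sets (\<nu> i)" for i j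
      using B \<nu> by (auto intro!: sets_Pair1)
    have "(\<Sum>j. emeasure (\<nu> i) (Pair i -` B j)) = emeasure (\<nu> i) (\<Union>j. Pair i -` B j)" for i
    proof (rule suminf_emeasure)
      show "range (\<lambda>j. Pair i -` B j) \<subseteq> sets (\<nu> i)" using m by blast
      show "disjoint_family (\<lambda>j. Pair i -` B j)"
        using d unfolding disjoint_family_on_def by blast
    qed
    then show "(\<Sum>j. \<Sum>i\<in>UNIV. emeasure (\<nu> i) (Pair i -` B j)) =
        (\<Sum>i\<in>UNIV. emeasure (\<nu> i) (Pair i -` (\<Union>j. B j)))"
      by (simp add: suminf_sum vimage_UN)
  qed
qed

text \<open>The component \<open>\<omega>\<^sub>i\<close> of a configuration \<open>\<omega>\<close> on \<open>X\<close>.\<close>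

definition component :: "'n \<Rightarrow> ('n \<times> 'y) set \<Rightarrow> 'y set" where
  "component i \<omega> = {y. (i, y) \<in> \<omega>}"

section \<open>Functionals\<close>

text \<open>Functionals \<open>F\<^sub>i\<close> of the component \<open>\<omega>\<^sub>i\<close> only are functions on the configurations of \<open>Y\<close>.\<close>

definition diff_op :: "'y \<Rightarrow> ('y set \<Rightarrow> real) \<Rightarrow> 'y set \<Rightarrow> real" where
  "diff_op y F \<omega> = F (\<omega> \<union> {y}) - F \<omega>"

definition functional_vector ::
  "('n::finite \<Rightarrow> 'y set \<Rightarrow> real) \<Rightarrow> ('n \<times> 'y) set \<Rightarrow> real ^ 'n" where
  "functional_vector F \<omega> = (\<chi> i. F i (component i \<omega>))"

definition beta_sup :: "('n::finite \<Rightarrow> 'y::real_normed_vector set \<Rightarrow> real) \<Rightarrow> 'n \<Rightarrow> ennreal" where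
  "beta_sup F i =
     (SUP y\<in>UNIV - {0}. SUP \<omega>\<in>configurations X_topology.
        ennreal (\<bar>diff_op y (F i) (component i \<omega>)\<bar> / norm y))"

definition beta_esssup ::
  "('n::finite \<times> 'y::real_normed_vector) set measure \<Rightarrow> ('n \<Rightarrow> 'y set \<Rightarrow> real) \<Rightarrow> 'n \<Rightarrow> ennreal" where
  "beta_esssup P F i =
     (SUP y\<in>UNIV - {0}.
        esssup P (\<lambda>\<omega>. ennreal (\<bar>diff_op y (F i) (component i \<omega>)\<bar> / norm y)))"

section \<open>The function \<open>h\<close>\<close>

text \<open>The function \<open>e\<^sup>z - 1\<close> on \<open>[0, \<infinity>]\<close>.\<close>

definition ennreal_expm1 :: "ennreal \<Rightarrow> ennreal" where
  "ennreal_expm1 z = (if z = \<infinity> then \<infinity> else ennreal (exp (enn2real z) - 1))"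

text \<open>\<open>h\<close> takes values in \<open>[0, \<infinity>]\<close>, where division by zero is \<open>\<infinity>\<close> and \<open>0 * \<infinity> = 0\<close>; it is only
  meaningful for \<open>t \<ge> 0\<close>.  The parameter \<open>m\<close> stands for \<open>E[|F - E[F]|\<^sub>2]\<close>.\<close>

definition h_fun ::
  "('n::finite \<Rightarrow> 'y::real_normed_vector measure) \<Rightarrow> ('n \<Rightarrow> ennreal) \<Rightarrow> real \<Rightarrow> real \<Rightarrow> ennreal" where
  "h_fun \<nu> \<beta> m t =
     8 * (MAX i. \<beta> i * (\<integral>\<^sup>+ y. ennreal (norm y) *
            ennreal_expm1 (ennreal t * \<beta> i * ennreal (norm y)) \<partial>\<nu> i)) +
     2 * of_nat CARD('n) / ennreal m ^ 2 *
         (MAX i. \<beta> i ^ 3 * (\<integral>\<^sup>+ y. ennreal (norm y) ^ 3 *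
            ennreal_expm1 (ennreal t * \<beta> i * ennreal (norm y)) \<partial>\<nu> i))"

definition gen_inverse :: "(real \<Rightarrow> ennreal) \<Rightarrow> real \<Rightarrow> real" where
  "gen_inverse h x = Inf {t. 0 < t \<and> ennreal x \<le> h t}"

text \<open>The left limit at \<open>t\<^sub>0 \<in> (0, \<infinity>]\<close>; for \<open>t\<^sub>0 = \<infinity>\<close> it is the limit at infinity.\<close>

definition left_limit :: "(real \<Rightarrow> ennreal) \<Rightarrow> ereal \<Rightarrow> ennreal" where
  "left_limit h t\<^sub>0 = Lim (at_left t\<^sub>0) (\<lambda>t. h (real_of_ereal t))"

end

theory Submission
  imports Defs
begin

text \<open>Let \<open>V\<close> be the sum of the variances and \<open>g(z) = sqrt (|z - E F|\<^sup>2 + V)\<close>. With an independent copy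
  \<open>F'\<close> of \<open>F\<close>, the Lipschitz property gives \<open>f(F) - E f(F) \<le> c E'|F - F'| \<le> c g(F)\<close>, while
  \<open>E g(F) \<le> sqrt (2 V)\<close>. So it suffices to bound the deviations of \<open>g(F)\<close> above its mean. A change of
  the coordinate \<open>z\<^sub>i\<close> by \<open>d\<close> changes \<open>g\<close> by at most \<open>|d|\<close> times the square root of
  \<open>2 (z\<^sub>i - E F\<^sub>i)\<^sup>2 / g\<^sup>2 + d\<^sup>2 / (2 V)\<close>; summed over \<open>i\<close>, this is where the two maxima in \<open>h\<close> come
  from. The modified logarithmic Sobolev inequality and Herbst's argument then give
  \<open>log E exp (t (g(F) - E g(F))) \<le> \<integral>\<^sub>0\<^sup>t h\<close>, and Markov's inequality at \<open>t = h\<^sup>-\<^sup>1(x)\<close> concludes.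

  The Poisson functional is replaced by its conditional expectation given the numbers of points in
  finitely many disjoint cells, whose increments are averages of \<open>D F\<close> by the Mecke formula. These
  counts are limits of sums of independent Bernoulli variables, for which the entropy inequality
  reduces to a two-point computation.

  The hypothesis on \<open>x\<close> forces \<open>E|F - E F| > 0\<close>, hence \<open>F\<close> is integrable. Square integrability
  follows by applying the exponential moment inequality first with \<open>(E|F - E F|)\<^sup>2\<close> in place of \<open>V\<close>.\<close>

section \<open>An entropy inequality for Bernoulli sums\<close>

text \<open>Adding \<open>V\<close> under the root cures two defects of the plain norm at the
  centre: there a jump is not controlled by \<open>(z_i - E F_i) / |z - E F|\<close>, and its
  quadratic remainder has no denominator bounded away from zero. The weights
  \<open>(z_i - E F_i)^2 / g^2\<close> sum to at most 1, so the first term of \<open>h\<close> costs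
  a single maximum over \<open>i\<close>; the remainder carries no weights and costs the factor
  \<open>n\<close>. For both, a point must move one coordinate only, and so every cell is kept
  inside one copy of \<open>Y\<close>.

  Functions of counts that merely approximate \<open>F\<close> need not have controlled increments.
  Conditional expectations do, in an averaged sense that matches the integrals in \<open>h\<close>:
  replacing the jump size by its mean over a cell can only lower them, by convexity of
  \<open>z^p (exp (t z) - 1)\<close> for \<open>p = 1, 3\<close>.

  The entropy is only ever taken for finitely many bits. What passes to the limit, from bits to
  Poisson counts and from counts to \<open>F\<close>, is the integrated inequality between
  \<open>E exp (t g)\<close> and \<open>E g\<close>.\<close>

definition bump :: "'j \<Rightarrow> ('j \<Rightarrow> nat) \<Rightarrow> 'j \<Rightarrow> nat" where
  "bump j k = k(j := Suc (k j))"

lemma bump_commute: "bump i (bump j k) = bump j (bump i k)"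
  by (auto simp: bump_def fun_eq_iff)

text \<open>\<open>bern xs \<phi> k\<close> is the expectation of \<open>\<phi>\<close> at \<open>k\<close> plus a sum of independent bits, one for each
  entry \<open>(j, p)\<close> of \<open>xs\<close>, which raises the coordinate \<open>j\<close> by one with probability \<open>p\<close>.\<close>

primrec bern :: "('j \<times> real) list \<Rightarrow> (('j \<Rightarrow> nat) \<Rightarrow> real) \<Rightarrow> ('j \<Rightarrow> nat) \<Rightarrow> real" where
  "bern [] \<phi> k = \<phi> k"
| "bern (a # xs) \<phi> k =
     (1 - snd a) * bern xs \<phi> k + snd a * bern xs \<phi> (bump (fst a) k)"

definition weights :: "('j \<times> real) list \<Rightarrow> bool" where
  "weights xs \<longleftrightarrow> (\<forall>a\<in>set xs. 0 \<le> snd a \<and> snd a \<le> 1)"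

lemma weights_Nil [simp]: "weights []"
  by (simp add: weights_def)

lemma weights_Cons [simp]: "weights (a # xs) \<longleftrightarrow> 0 \<le> snd a \<and> snd a \<le> 1 \<and> weights xs"
  by (auto simp: weights_def)

text \<open>The integrand \<open>D f * D (ln f)\<close> of the modified logarithmic Sobolev
  inequality. This form of the energy is jointly convex, which the tensorization needs, and for
  \<open>f = exp (t g)\<close> it becomes \<open>t exp (t g) u (exp (t u) - 1)\<close>, where
  \<open>u\<close> is the increment of \<open>g\<close>.\<close>

definition psi :: "real \<Rightarrow> real \<Rightarrow> real" where
  "psi a b = (a - b) * (ln a - ln b)"

lemma psi_nonneg: "0 < a \<Longrightarrow> 0 < b \<Longrightarrow> 0 \<le> psi a b"
  unfolding psi_def by (cases "a \<le> b") (auto simp: mult_nonpos_nonpos)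

lemma bern_append: "bern (xs @ ys) \<phi> k = bern xs (bern ys \<phi>) k"
  by (induction xs arbitrary: k) auto

lemma bern_const [simp]: "bern xs (\<lambda>_. c) k = c"
  by (induction xs arbitrary: k) (auto simp: algebra_simps)

lemma bern_add: "bern xs (\<lambda>k. \<phi> k + \<psi> k) k = bern xs \<phi> k + bern xs \<psi> k"
  by (induction xs arbitrary: k) (auto simp: algebra_simps)

lemma bern_cmult: "bern xs (\<lambda>k. c * \<phi> k) k = c * bern xs \<phi> k"
  by (induction xs arbitrary: k) (auto simp: algebra_simps)

lemma bern_sum_list:
  "bern xs (\<lambda>k. \<Sum>a\<leftarrow>as. \<phi> a k) k = (\<Sum>a\<leftarrow>as. bern xs (\<phi> a) k)"
  by (induction as) (auto simp: bern_add)

lemma bern_mono: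
  assumes "weights xs" "\<And>k. \<phi> k \<le> \<psi> k"
  shows "bern xs \<phi> k \<le> bern xs \<psi> k"
  using assms(1)
proof (induction xs arbitrary: k)
  case (Cons a xs)
  then show ?case by (auto intro!: add_mono mult_left_mono)
qed (auto simp: assms)

lemma bern_nonneg: "weights xs \<Longrightarrow> (\<And>k. 0 \<le> \<phi> k) \<Longrightarrow> 0 \<le> bern xs \<phi> k"
  using bern_mono[of xs "\<lambda>_. 0" \<phi> k] by simp

lemma convex_comb_pos:
  fixes a b p :: real
  assumes "0 < a" "0 < b" "0 \<le> p" "p \<le> 1"
  shows "0 < (1 - p) * a + p * b"
proof (cases "p = 0")
  case False
  then have "0 < p * b" "0 \<le> (1 - p) * a" using assms by auto
  then show ?thesis by linarith
qed (use assms in auto)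

lemma bern_pos:
  assumes "weights xs" "\<And>k. 0 < \<phi> k"
  shows "0 < bern xs \<phi> k"
  using assms(1)
proof (induction xs arbitrary: k)
  case (Cons a xs)
  then show ?case by (auto intro!: convex_comb_pos)
qed (auto simp: assms)

lemma bern_shift: "bern xs (\<lambda>k. \<phi> (bump j k)) k = bern xs \<phi> (bump j k)"
  by (induction xs arbitrary: k) (auto simp: bump_commute)

text \<open>Joint convexity of \<open>a ln (a / b)\<close>. The bound
  \<open>ln z \<le> z - 1\<close> is used at \<open>z = d A / (c B)\<close> for each of the two
  pairs \<open>(c, d)\<close>; in the average the linear terms add up to
  \<open>A - B * A / B = 0\<close>.\<close>

lemma log_sum_two:
  fixes a a' b b' :: real
  assumes "0 < a" "0 < a'" "0 < b" "0 < b'" "0 \<le> p" "p \<le> 1"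
  defines "A \<equiv> (1 - p) * a + p * a'" and "B \<equiv> (1 - p) * b + p * b'"
  shows "A * (ln A - ln B) \<le> (1 - p) * (a * (ln a - ln b)) + p * (a' * (ln a' - ln b'))"
proof -
  have AB: "0 < A" "0 < B" unfolding A_def B_def using assms by (auto intro!: convex_comb_pos)
  have *: "c - d * A / B \<le> c * (ln c - ln d) - c * (ln A - ln B)" if "0 < c" "0 < d" for c d
  proof -
    have "ln (d * A / (c * B)) \<le> d * A / (c * B) - 1"
      using that AB by (intro ln_le_minus_one) simp
    then have "c * ln (d * A / (c * B)) \<le> c * (d * A / (c * B) - 1)"
      using that by (intro mult_left_mono) auto
    moreover have "c * (d * A / (c * B) - 1) = d * A / B - c"
      using that AB by (simp add: field_simps)
    moreover have "ln (d * A / (c * B)) = ln d + ln A - ln c - ln B"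
      using that AB by (simp add: ln_mult ln_div)
    ultimately have "c * (ln d + ln A - ln c - ln B) \<le> d * A / B - c" by simp
    moreover have "c * (ln c - ln d) - c * (ln A - ln B) = - (c * (ln d + ln A - ln c - ln B))"
      by (simp add: algebra_simps)
    ultimately show ?thesis by linarith
  qed
  have "(1 - p) * (a - b * A / B) + p * (a' - b' * A / B) \<le>
      (1 - p) * (a * (ln a - ln b) - a * (ln A - ln B)) + p * (a' * (ln a' - ln b') - a' * (ln A - ln B))"
    using assms by (intro add_mono mult_left_mono *) auto
  moreover have "(1 - p) * (a - b * A / B) + p * (a' - b' * A / B) = A - B * A / B"
    using AB by (simp add: A_def B_def field_simps)
  moreover have "A - B * A / B = 0" using AB by simp
  moreover have "(1 - p) * (a * (ln a - ln b) - a * (ln A - ln B)) + p * (a' * (ln a' - ln b') - a' * (ln A - ln B))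
      = (1 - p) * (a * (ln a - ln b)) + p * (a' * (ln a' - ln b')) - A * (ln A - ln B)"
    by (simp add: A_def algebra_simps)
  ultimately show ?thesis by linarith
qed

text \<open>\<open>psi\<close> is the sum of the relative entropy terms in both directions, so the
  log sum inequality is applied twice, with the roles of \<open>a\<close> and \<open>b\<close>
  exchanged.\<close>

lemma psi_convex:
  fixes a a' b b' :: real
  assumes "0 < a" "0 < a'" "0 < b" "0 < b'" "0 \<le> p" "p \<le> 1"
  shows "psi ((1 - p) * a + p * a') ((1 - p) * b + p * b') \<le> (1 - p) * psi a b + p * psi a' b'"
proof -
  have eq: "psi x y = x * (ln x - ln y) + y * (ln y - ln x)" for x y
    by (simp add: psi_def algebra_simps)
  show ?thesis
    using log_sum_two[OF assms] log_sum_two[OF assms(3,4,1,2,5,6)]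
    unfolding eq by (simp add: algebra_simps)
qed

text \<open>Jensen's inequality, one bit at a time.\<close>

lemma bern_psi_le:
  assumes "weights xs" "\<And>k. 0 < f k" "\<And>k. 0 < g k"
  shows "psi (bern xs f k) (bern xs g k) \<le> bern xs (\<lambda>k. psi (f k) (g k)) k"
  using assms(1)
proof (induction xs arbitrary: k)
  case (Cons a xs)
  have "psi (bern (a # xs) f k) (bern (a # xs) g k) \<le>
      (1 - snd a) * psi (bern xs f k) (bern xs g k) + snd a *
      psi (bern xs f (bump (fst a) k)) (bern xs g (bump (fst a) k))"
    unfolding bern.simps using Cons.prems assms
    by (intro psi_convex bern_pos) auto
  also have "\<dots> \<le> bern (a # xs) (\<lambda>k. psi (f k) (g k)) k"
    unfolding bern.simps using Cons by (intro add_mono mult_left_mono) auto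
  finally show ?case .
qed auto

text \<open>By concavity of \<open>ln\<close>, replacing the logarithm of the mean by the mean of
  the logarithms can only increase the left side. What remains is the covariance of \<open>f\<close>
  and \<open>ln f\<close> under the two-point law, and this is exactly the right side.\<close>

lemma entropy_two_point:
  fixes a b p :: real
  assumes "0 < a" "0 < b" "0 \<le> p" "p \<le> 1"
  shows "(1 - p) * (a * ln a) + p * (b * ln b) -
      ((1 - p) * a + p * b) * ln ((1 - p) * a + p * b) \<le> p * (1 - p) * psi b a"
proof -
  have pos: "0 < (1 - p) * a + p * b" by (intro convex_comb_pos assms)
  have ln_le: "ln c \<le> ln d + (c - d) / d" if "0 < c" "0 < d" for c d :: real
  proof -
    have "ln (c / d) \<le> c / d - 1" using that by (intro ln_le_minus_one) simp
    then show ?thesis using that by (simp add: ln_div diff_divide_distrib)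
  qed
  let ?m = "(1 - p) * a + p * b"
  have "(1 - p) * ln a + p * ln b \<le> (1 - p) * (ln ?m + (a - ?m) / ?m) + p * (ln ?m + (b - ?m) / ?m)"
    using assms pos by (intro add_mono mult_left_mono ln_le) auto
  also have "\<dots> = ln ?m + ((1 - p) * (a - ?m) + p * (b - ?m)) / ?m"
    unfolding add_divide_distrib by (simp add: distrib_left left_diff_distrib)
  also have "(1 - p) * (a - ?m) + p * (b - ?m) = 0" by (simp add: algebra_simps)
  finally have jensen: "(1 - p) * ln a + p * ln b \<le> ln ?m" by simp
  have "?m * ((1 - p) * ln a + p * ln b) \<le> ?m * ln ?m"
    using pos by (intro mult_left_mono jensen) auto
  moreover have "(1 - p) * (a * ln a) + p * (b * ln b) - ?m * ((1 - p) * ln a + p * ln b) =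
      p * (1 - p) * psi b a"
    by (simp add: psi_def algebra_simps)
  ultimately show ?thesis by linarith
qed

text \<open>Tensorization: the entropy of the outer two-point average is controlled by joint convexity
  of \<open>psi\<close>; the factor \<open>1 - p\<close> is absorbed by the outer average.\<close>

lemma bern_entropy:
  assumes "weights xs" "\<And>k. 0 < f k"
  shows "bern xs (\<lambda>k. f k * ln (f k)) k - bern xs f k * ln (bern xs f k) \<le>
     (\<Sum>a\<leftarrow>xs. snd a * bern xs (\<lambda>k. psi (f (bump (fst a) k)) (f k)) k)"
  using assms(1)
proof (induction xs arbitrary: k)
  case (Cons a xs)
  define p where "p = snd a"
  define j where "j = fst a"
  define k' where "k' = bump j k"
  define D where "D i k = psi (f (bump i k)) (f k)" for i k
  have p: "0 \<le> p" "p \<le> 1" and w: "weights xs" using Cons.prems by (auto simp: p_def)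
  have D0: "0 \<le> D i k" for i k unfolding D_def by (intro psi_nonneg assms)
  let ?u = "bern xs f k" and ?u' = "bern xs f k'"
  have u: "0 < ?u" "0 < ?u'" using bern_pos[OF w assms(2)] by auto
  have 1: "bern xs (\<lambda>k. f k * ln (f k)) l - bern xs f l * ln (bern xs f l)
      \<le> (\<Sum>a\<leftarrow>xs. snd a * bern xs (D (fst a)) l)" for l
    unfolding D_def by (rule Cons.IH[OF w])
  have 2: "(1 - p) * (?u * ln ?u) + p * (?u' * ln ?u') -
      ((1 - p) * ?u + p * ?u') * ln ((1 - p) * ?u + p * ?u') \<le> p * (1 - p) * psi ?u' ?u"
    by (intro entropy_two_point u p)
  have "?u' = bern xs (\<lambda>k. f (bump j k)) k"
    unfolding k'_def by (rule bern_shift[symmetric])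
  then have "psi ?u' ?u \<le> bern xs (D j) k"
    unfolding D_def using w assms(2) by (auto intro!: bern_psi_le)
  then have "p * (1 - p) * psi ?u' ?u \<le> p * ((1 - p) * bern xs (D j) k)"
    using p by (simp add: mult_left_mono mult.assoc)
  also have "\<dots> \<le> p * bern (a # xs) (D j) k"
    using p bern_nonneg[OF w D0] by (auto intro!: mult_left_mono simp: p_def)
  finally have 3: "p * (1 - p) * psi ?u' ?u \<le> p * bern (a # xs) (D j) k" .
  have 4: "(1 - p) * bern xs (\<lambda>k. f k * ln (f k)) k + p * bern xs (\<lambda>k. f k * ln (f k)) k'
      - ((1 - p) * (?u * ln ?u) + p * (?u' * ln ?u')) \<le>
      (1 - p) * (\<Sum>a\<leftarrow>xs. snd a * bern xs (D (fst a)) k) +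
      p * (\<Sum>a\<leftarrow>xs. snd a * bern xs (D (fst a)) k')"
    using mult_left_mono[OF 1[of k], of "1 - p"] mult_left_mono[OF 1[of k'], of p] p
    by (simp add: algebra_simps)
  have 5: "(1 - p) * (\<Sum>a\<leftarrow>xs. snd a * bern xs (D (fst a)) k) +
      p * (\<Sum>a\<leftarrow>xs. snd a * bern xs (D (fst a)) k') =
      (\<Sum>b\<leftarrow>xs. snd b * bern (a # xs) (D (fst b)) k)"
    by (simp add: p_def k'_def j_def sum_list_const_mult[symmetric] sum_list_addf[symmetric] algebra_simps)
  have "bern (a # xs) (\<lambda>k. f k * ln (f k)) k - bern (a # xs) f k * ln (bern (a # xs) f k) =
     ((1 - p) * bern xs (\<lambda>k. f k * ln (f k)) k + p * bern xs (\<lambda>k. f k * ln (f k)) k') -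
     ((1 - p) * ?u + p * ?u') * ln ((1 - p) * ?u + p * ?u')"
    by (simp add: p_def k'_def j_def)
  also have "\<dots> \<le> p * bern (a # xs) (D j) k + (\<Sum>b\<leftarrow>xs. snd b * bern (a # xs) (D (fst b)) k)"
    using 2 3 4 5 by linarith
  finally show ?case by (simp add: p_def j_def D_def[abs_def])
qed auto

lemma bern_DERIV:
  assumes "\<And>k. ((\<lambda>t. \<phi> t k) has_real_derivative \<phi>' k) (at t)"
  shows "((\<lambda>t. bern xs (\<phi> t) k) has_real_derivative bern xs \<phi>' k) (at t)"
proof (induction xs arbitrary: k)
  case (Cons a xs)
  show ?case unfolding bern.simps by (auto intro!: derivative_eq_intros Cons)
qed (auto simp: assms)

text \<open>Herbst's argument: the entropy inequality bounds the derivative of \<open>ln Z(t) / t\<close>.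
  As \<open>\<eta>(s) / s\<close> increases, its integral is compared with that of \<open>\<eta>\<close> by Chebyshev's
  sum inequality.\<close>

lemma bern_herbst:
  fixes g :: "('j \<Rightarrow> nat) \<Rightarrow> real" and \<eta> :: "real \<Rightarrow> real"
  assumes w: "weights xs" and T: "0 < T"
    and \<eta>_mono: "mono_on {0..T} \<eta>" and \<eta>_nonneg: "\<And>s. 0 \<le> s \<Longrightarrow> s \<le> T \<Longrightarrow> 0 \<le> \<eta> s"
    and \<eta>_convex: "\<And>s t. 0 < s \<Longrightarrow> s \<le> t \<Longrightarrow> t \<le> T \<Longrightarrow> \<eta> s / s \<le> \<eta> t / t"
    and energy: "\<And>t k. 0 < t \<Longrightarrow> t \<le> T \<Longrightarrow>
      (\<Sum>a\<leftarrow>xs. snd a * psi (exp (t * g (bump (fst a) k))) (exp (t * g k)))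
        \<le> t * exp (t * g k) * (\<eta> t / 4)"
  shows "bern xs (\<lambda>k. exp (T * g k)) k \<le> exp (T * bern xs g k + integral {0..T} \<eta>)"
proof -
  define Z where "Z t = bern xs (\<lambda>k. exp (t * g k)) k" for t
  define Z' where "Z' t = bern xs (\<lambda>k. g k * exp (t * g k)) k" for t
  have Zpos: "0 < Z t" for t unfolding Z_def by (intro bern_pos w) auto
  have DZ: "(Z has_real_derivative Z' t) (at t)" for t
    unfolding Z_def Z'_def by (rule bern_DERIV) (auto intro!: derivative_eq_intros)
  define K where "K t = ln (Z t) / t" for t
  define K' where "K' t = (Z' t / Z t * t - ln (Z t)) / (t * t)" for t
  have DK: "(K has_real_derivative K' t) (at t)" if "0 < t" for t
    unfolding K_def K'_def using that Zpos[of t]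
    by (auto intro!: derivative_eq_intros DZ simp: field_simps)
  \<comment> \<open>\<open>t * t * Z t * K' t\<close> is the entropy of \<open>exp (t g)\<close>, so
    the entropy inequality applies, followed by the pointwise bound \<open>energy\<close>.\<close>
  have K'_le: "K' t \<le> \<eta> t / t / 4" if t: "0 < t" "t \<le> T" for t
  proof -
    have "bern xs (\<lambda>k. exp (t * g k) * ln (exp (t * g k))) k - Z t * ln (Z t)
       \<le> (\<Sum>a\<leftarrow>xs. snd a * bern xs (\<lambda>k. psi (exp (t * g (bump (fst a) k))) (exp (t * g k))) k)"
      unfolding Z_def by (intro bern_entropy w) auto
    also have "\<dots> = bern xs (\<lambda>k. \<Sum>a\<leftarrow>xs. snd a * psi (exp (t * g (bump (fst a) k))) (exp (t * g k))) k"
      by (simp add: bern_sum_list bern_cmult)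
    also have "\<dots> \<le> bern xs (\<lambda>k. (t * (\<eta> t / 4)) * exp (t * g k)) k"
      using energy[OF t] by (intro bern_mono w) (auto simp: mult_ac)
    also have "\<dots> = t * (\<eta> t / 4) * Z t" unfolding bern_cmult Z_def ..
    also have "bern xs (\<lambda>k. exp (t * g k) * ln (exp (t * g k))) k = t * Z' t"
      unfolding Z'_def by (simp add: bern_cmult[symmetric] mult_ac)
    finally have "t * Z' t - Z t * ln (Z t) \<le> t * (\<eta> t / 4) * Z t" .
    then have "(t * Z' t - Z t * ln (Z t)) / Z t \<le> t * (\<eta> t / 4) * Z t / Z t"
      using Zpos[of t] by (intro divide_right_mono) auto
    then have "Z' t / Z t * t - ln (Z t) \<le> t * (\<eta> t / 4)"
      using Zpos[of t] by (simp add: diff_divide_distrib mult_ac)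
    then have "K' t \<le> t * (\<eta> t / 4) / (t * t)"
      unfolding K'_def using t by (intro divide_right_mono) auto
    then show ?thesis using t by simp
  qed
  define I where "I = integral {0..T} \<eta>"
  have \<eta>_int: "\<eta> integrable_on {0..T}" by (rule integrable_on_mono_on[OF \<eta>_mono])
  \<comment> \<open>The value of \<open>\<eta> s / s\<close> at the pivot \<open>T / 4\<close>.
    Monotonicity gives \<open>(s - T / 4) (\<eta> s / s - c) \<ge> 0\<close>, which expands to
    \<open>T \<eta> s / (4 s) \<le> \<eta> s - c (s - T / 4)\<close>: the pivot is dictated by the
    factor 1/4 in \<open>energy\<close>. The last term has a nonnegative integral, as the pivot lies
    to the left of the midpoint of the interval.\<close>
  define c where "c = \<eta> (T / 4) / (T / 4)"
  have c0: "0 \<le> c" unfolding c_def using T by (auto intro!: divide_nonneg_nonneg \<eta>_nonneg)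
  have KT: "T * K T \<le> T * K \<epsilon> + I" if e: "0 < \<epsilon>" "\<epsilon> < T" for \<epsilon>
  proof -
    have sub: "\<eta> integrable_on {\<epsilon>..T}"
      using \<eta>_int e by (intro integrable_subinterval_real[OF \<eta>_int]) auto
    have "(K' has_integral K T - K \<epsilon>) {\<epsilon>..T}"
      using e by (intro fundamental_theorem_of_calculus)
        (auto intro!: has_field_derivative_at_within DK simp: has_real_derivative_iff_has_vector_derivative[symmetric])
    then have 1: "((\<lambda>t. T * K' t) has_integral T * (K T - K \<epsilon>)) {\<epsilon>..T}"
      by (rule has_integral_mult_right)
    have 0: "((\<lambda>s. s - T / 4) has_integral ((T - T/4)^2/2 - (\<epsilon> - T/4)^2/2)) {\<epsilon>..T}"
      using e by (intro fundamental_theorem_of_calculus[where f="\<lambda>s. (s - T / 4)^2 / 2"])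
       (auto intro!: derivative_eq_intros simp: has_real_derivative_iff_has_vector_derivative[symmetric])
    note 2 = has_integral_diff[OF integrable_integral[OF sub] has_integral_mult_right[OF 0, of c]]
    have "T * (K T - K \<epsilon>) \<le> integral {\<epsilon>..T} \<eta> - c * ((T - T/4)^2/2 - (\<epsilon> - T/4)^2/2)"
    proof (rule has_integral_le[OF 1 2])
      fix s assume "s \<in> {\<epsilon>..T}"
      then have s: "0 < s" "s \<le> T" using e by auto
      have "0 \<le> (s - T / 4) * (\<eta> s / s - c)"
      proof (cases "s \<le> T / 4")
        case True
        then show ?thesis unfolding c_def using s T \<eta>_convex[of s "T / 4"]
          by (intro mult_nonpos_nonpos) auto
      next
        case False
        then show ?thesis unfolding c_def using s T \<eta>_convex[of "T / 4" s]
          by (intro mult_nonneg_nonneg) auto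
      qed
      then have "T * (\<eta> s / s / 4) \<le> \<eta> s - c * (s - T / 4)"
        using s by (simp add: field_simps)
      moreover have "T * K' s \<le> T * (\<eta> s / s / 4)"
        using T by (intro mult_left_mono K'_le s) auto
      ultimately show "T * K' s \<le> \<eta> s - c * (s - T / 4)" by linarith
    qed
    moreover have "0 \<le> c * ((T - T/4)^2/2 - (\<epsilon> - T/4)^2/2)"
    proof (rule mult_nonneg_nonneg[OF c0])
      have "(T - T/4)^2/2 - (\<epsilon> - T/4)^2/2 = (T - \<epsilon>) * (T / 2 + \<epsilon>) / 2"
        by (simp add: power2_eq_square field_simps)
      also have "\<dots> \<ge> 0" using e by auto
      finally show "0 \<le> (T - T/4)^2/2 - (\<epsilon> - T/4)^2/2" .
    qed
    moreover have "integral {\<epsilon>..T} \<eta> \<le> I"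
      unfolding I_def using e by (intro integral_subset_le sub \<eta>_int) (auto intro: \<eta>_nonneg)
    ultimately show ?thesis by (simp add: algebra_simps)
  qed
  \<comment> \<open>At 0 itself \<open>K\<close> has the default value of a division by zero. Its
    limit is the derivative of \<open>ln Z\<close> at 0, because \<open>Z 0 = 1\<close>, and this
    derivative is the mean of \<open>g\<close>.\<close>
  have "(K \<longlongrightarrow> bern xs g k) (at_right 0)"
  proof -
    have Z0: "Z 0 = 1" "Z' 0 = bern xs g k" unfolding Z_def Z'_def by auto
    have "((\<lambda>t. ln (Z t)) has_real_derivative Z' 0 / Z 0) (at 0)"
      using Zpos[of 0] by (auto intro!: derivative_eq_intros DZ)
    then have "(K \<longlongrightarrow> bern xs g k) (at 0)"
      unfolding has_field_derivative_iff K_def by (simp add: Z0)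
    then show ?thesis by (rule tendsto_within_subset) auto
  qed
  then have "((\<lambda>\<epsilon>. T * K \<epsilon> + I) \<longlongrightarrow> T * bern xs g k + I) (at_right 0)"
    by (intro tendsto_intros)
  moreover have "\<forall>\<^sub>F \<epsilon> in at_right 0. T * K T \<le> T * K \<epsilon> + I"
    using T by (auto simp: eventually_at_right_field intro!: exI[of _ T] KT)
  ultimately have "T * K T \<le> T * bern xs g k + I"
    by (intro tendsto_lowerbound) auto
  then have "ln (Z T) \<le> T * bern xs g k + I" using T by (simp add: K_def)
  then show ?thesis using Zpos[of T] unfolding Z_def I_def
    by (metis exp_le_cancel_iff exp_ln)
qed

section \<open>The Poisson limit\<close>

text \<open>\<open>poisson_pmf\<close> is only specified for positive rates, but cells of measure zero occur.\<close>

definition pois :: "real \<Rightarrow> nat pmf" where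
  "pois r = (if r = 0 then return_pmf 0 else poisson_pmf r)"

lemma pmf_pois: "0 \<le> r \<Longrightarrow> pmf (pois r) i = r ^ i / fact i * exp (- r)"
  by (auto simp: pois_def pmf_return indicator_def)

lemma integrable_pmf_bounded:
  fixes f :: "'a \<Rightarrow> real"
  assumes "\<And>x. \<bar>f x\<bar> \<le> C"
  shows "integrable (measure_pmf p) f"
  by (rule measure_pmf.integrable_const_bound[where B=C]) (use assms in auto)

text \<open>Adding the bound \<open>C\<close> makes the integrand nonnegative, so the iterated
  nonnegative integral applies; the constant is removed afterwards on both sides.\<close>

lemma expectation_pair_pmf:
  fixes h :: "'a \<times> 'b \<Rightarrow> real"
  assumes bd: "\<And>x. \<bar>h x\<bar> \<le> C"
  shows "measure_pmf.expectation (pair_pmf p q) h =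
    measure_pmf.expectation p (\<lambda>a. measure_pmf.expectation q (\<lambda>b. h (a, b)))"
proof -
  have C: "0 \<le> h x + C" "\<bar>h x + C\<bar> \<le> 2 * C" for x using bd[of x] by auto
  let ?I = "\<lambda>a. measure_pmf.expectation q (\<lambda>b. h (a, b) + C)"
  have i0: "integrable (measure_pmf q) (\<lambda>b. h (a, b))" "integrable (measure_pmf q) (\<lambda>b. h (a, b) + C)" for a
    by (rule integrable_pmf_bounded, use bd C in blast)+
  have I0: "0 \<le> ?I a" for a by (rule Bochner_Integration.integral_nonneg) (simp add: C)
  have I1: "?I a \<le> 2 * C" for a
    by (rule measure_pmf.integral_le_const[OF i0(2)]) (use C in \<open>auto simp: abs_le_iff\<close>)
  have i1: "integrable (measure_pmf p) ?I"
    by (rule integrable_pmf_bounded[where C="2*C"]) (use I0 I1 in \<open>simp add: abs_le_iff\<close>)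
  have "ennreal (measure_pmf.expectation (pair_pmf p q) (\<lambda>x. h x + C)) =
     (\<integral>\<^sup>+x. ennreal (h x + C) \<partial>pair_pmf p q)"
    by (rule nn_integral_eq_integral[symmetric]) (auto intro: integrable_pmf_bounded C)
  also have "\<dots> = (\<integral>\<^sup>+a. \<integral>\<^sup>+b. ennreal (h (a, b) + C) \<partial>q \<partial>p)"
    by (rule nn_integral_pair_pmf')
  also have "\<dots> = (\<integral>\<^sup>+a. ennreal (?I a) \<partial>p)"
    by (intro nn_integral_cong nn_integral_eq_integral) (auto intro: i0 C)
  also have "\<dots> = ennreal (measure_pmf.expectation p ?I)"
    by (rule nn_integral_eq_integral) (use I0 i1 in auto)
  finally have eq: "measure_pmf.expectation (pair_pmf p q) (\<lambda>x. h x + C) = measure_pmf.expectation p ?I"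
    by (subst (asm) ennreal_inj) (auto intro!: Bochner_Integration.integral_nonneg simp: C I0)
  have "measure_pmf.expectation (pair_pmf p q) (\<lambda>x. h x + C) = measure_pmf.expectation (pair_pmf p q) h + C"
    by (subst Bochner_Integration.integral_add) (auto intro: integrable_pmf_bounded bd)
  moreover have "?I = (\<lambda>a. measure_pmf.expectation q (\<lambda>b. h (a, b)) + C)"
    by (rule ext, subst Bochner_Integration.integral_add) (auto intro: i0)
  moreover have "measure_pmf.expectation p (\<lambda>a. measure_pmf.expectation q (\<lambda>b. h (a, b)) + C) =
     measure_pmf.expectation p (\<lambda>a. measure_pmf.expectation q (\<lambda>b. h (a, b))) + C"
  proof (subst Bochner_Integration.integral_add)
    have "integrable (measure_pmf p) (\<lambda>a. ?I a - C)" using i1 by (intro Bochner_Integration.integrable_diff) auto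
    moreover have "(\<lambda>a. ?I a - C) = (\<lambda>a. measure_pmf.expectation q (\<lambda>b. h (a, b)))"
      by (rule ext, subst Bochner_Integration.integral_add) (auto intro: i0)
    ultimately show "integrable (measure_pmf p) (\<lambda>a. measure_pmf.expectation q (\<lambda>b. h (a, b)))" by simp
  qed auto
  ultimately show ?thesis using eq by simp
qed

lemma expectation_nat_pmf:
  fixes f :: "nat \<Rightarrow> real"
  assumes "\<And>x. \<bar>f x\<bar> \<le> C"
  shows "measure_pmf.expectation p f = (\<Sum>i. pmf p i * f i)"
proof -
  have "integrable (measure_pmf p) f" by (rule integrable_pmf_bounded[OF assms])
  then have int: "integrable (count_space UNIV) (\<lambda>i. pmf p i *\<^sub>R f i)"
    unfolding measure_pmf_eq_density[of p]
    by (subst (asm) integrable_density) auto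
  have "measure_pmf.expectation p f = (\<integral>i. pmf p i *\<^sub>R f i \<partial>count_space UNIV)"
    by (subst measure_pmf_eq_density, subst integral_density) auto
  also have "\<dots> = (\<Sum>i. pmf p i *\<^sub>R f i)" by (rule integral_count_space_nat[OF int])
  finally show ?thesis by simp
qed

text \<open>Equal bits are exchangeable, so only the number of raised ones matters; the induction is
  Pascal's rule, with the sum reindexed by one.\<close>

lemma bern_replicate:
  "bern (replicate n (j, p)) \<phi> k =
     (\<Sum>i\<le>n. real (n choose i) * p ^ i * (1 - p) ^ (n - i) * \<phi> ((bump j ^^ i) k))"
proof (induction n arbitrary: k)
  case (Suc n)
  let ?a = "\<lambda>i. \<phi> ((bump j ^^ i) k)"
  let ?c = "\<lambda>n i. real (n choose i) * p ^ i * (1 - p) ^ (n - i)"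
  have swap: "(bump j ^^ i) (bump j k) = (bump j ^^ Suc i) k" for i
    using funpow_swap1[of "bump j" i k] by simp
  have "(\<Sum>i\<le>Suc n. ?c (Suc n) i * ?a i) = ?c (Suc n) 0 * ?a 0 + (\<Sum>i\<le>n. ?c (Suc n) (Suc i) * ?a (Suc i))"
    by (rule sum.atMost_Suc_shift)
  also have "(\<Sum>i\<le>n. ?c (Suc n) (Suc i) * ?a (Suc i)) =
     (\<Sum>i\<le>n. p * (?c n i * ?a (Suc i))) +
     (\<Sum>i\<le>n. real (n choose Suc i) * p ^ Suc i * (1 - p) ^ (Suc n - Suc i) * ?a (Suc i))"
    unfolding sum.distrib[symmetric] by (intro sum.cong refl) (simp add: algebra_simps)
  also have "?c (Suc n) 0 * ?a 0 + ((\<Sum>i\<le>n. p * (?c n i * ?a (Suc i))) +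
     (\<Sum>i\<le>n. real (n choose Suc i) * p ^ Suc i * (1 - p) ^ (Suc n - Suc i) * ?a (Suc i))) =
     (\<Sum>i\<le>n. p * (?c n i * ?a (Suc i))) +
     (\<Sum>i\<le>Suc n. real (n choose i) * p ^ i * (1 - p) ^ (Suc n - i) * ?a i)"
    by (subst sum.atMost_Suc_shift) simp
  also have "(\<Sum>i\<le>Suc n. real (n choose i) * p ^ i * (1 - p) ^ (Suc n - i) * ?a i) =
     (\<Sum>i\<le>n. (1 - p) * (?c n i * ?a i))"
    by (simp add: Suc_diff_le mult_ac)
  finally show ?case
    by (simp add: Suc swap sum_distrib_left algebra_simps)
qed auto

text \<open>The law of rare events at a single atom. Joined to \<open>(1 / n) ^ i\<close>, the
  binomial coefficient is a product of \<open>i\<close> factors \<open>1 - q / n\<close> divided by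
  \<open>fact i\<close>; the power \<open>n - i\<close> is split as a quotient once
  \<open>r < n\<close> makes the base nonzero.\<close>

lemma binomial_tendsto_pois:
  assumes "0 \<le> r"
  shows "(\<lambda>n. real (n choose i) * (r / n) ^ i * (1 - r / n) ^ (n - i)) \<longlonglongrightarrow> pmf (pois r) i"
proof -
  have 1: "(\<lambda>n. real (n choose i) * (1 / n) ^ i) \<longlonglongrightarrow> 1 / fact i"
  proof (rule Lim_transform_eventually)
    have "(\<lambda>n. (\<Prod>q=0..<i. 1 - real q / real n)) \<longlonglongrightarrow> (\<Prod>q=0..<i. 1 - 0)"
      by (intro tendsto_intros tendsto_divide_0[OF tendsto_const] filterlim_real_at_infinity_sequentially)
    then show "(\<lambda>n. (\<Prod>q=0..<i. 1 - real q / real n) / fact i) \<longlonglongrightarrow> 1 / fact i"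
      using tendsto_divide[OF _ tendsto_const[of "fact i"]] by fastforce
    show "\<forall>\<^sub>F n in sequentially. (\<Prod>q=0..<i. 1 - real q / real n) / fact i = real (n choose i) * (1 / n) ^ i"
      using eventually_gt_at_top[of 0]
    proof eventually_elim
      case (elim n)
      have "(\<Prod>q=0..<i. 1 - real q / real n) = (\<Prod>q=0..<i. (real n - real q) * (1 / n))"
        using elim by (intro prod.cong) (auto simp: field_simps)
      also have "\<dots> = (\<Prod>q=0..<i. real n - real q) * (1 / n) ^ i" by (simp only: prod.distrib) simp
      finally show ?case by (simp add: binomial_gbinomial gbinomial_prod_rev)
    qed
  qed
  have 2: "(\<lambda>n. (1 - r / n) ^ (n - i)) \<longlonglongrightarrow> exp (- r)"
  proof (rule Lim_transform_eventually)
    have "(\<lambda>n. (1 + (- r) / real n) ^ n / (1 - r / real n) ^ i) \<longlonglongrightarrow> exp (- r) / (1 - 0) ^ i"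
      by (intro tendsto_intros tendsto_exp_limit_sequentially tendsto_divide_0[OF tendsto_const]
          filterlim_real_at_infinity_sequentially) auto
    then show "(\<lambda>n. (1 + (- r) / real n) ^ n / (1 - r / real n) ^ i) \<longlonglongrightarrow> exp (- r)" by simp
    show "\<forall>\<^sub>F n in sequentially. (1 + (- r) / real n) ^ n / (1 - r / real n) ^ i = (1 - r / n) ^ (n - i)"
      using eventually_ge_at_top[of i] eventually_gt_at_top[of "nat \<lceil>r\<rceil>"]
    proof eventually_elim
      case (elim n)
      then have "r < real n" by linarith
      then have "1 - r / real n \<noteq> 0" using assms by (simp add: field_simps)
      then show ?case using elim by (simp add: power_diff)
    qed
  qed
  have "(\<lambda>n. (real (n choose i) * (1 / n) ^ i) * r ^ i * (1 - r / n) ^ (n - i)) \<longlonglongrightarrow> (1 / fact i) * r ^ i * exp (- r)"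
    by (intro tendsto_intros 1 2)
  then show ?thesis using assms by (simp add: pmf_pois power_divide)
qed

text \<open>The integrand depends on \<open>n\<close> because it will be the average over the
  remaining cells, which are discretized at the same time. Dominated convergence for series
  (Tannery) applies with the majorant \<open>r ^ i / fact i * C\<close>, as
  \<open>n choose i\<close> is at most \<open>n ^ i / fact i\<close>.\<close>

lemma bern_replicate_tendsto:
  assumes r: "0 \<le> r" and lim: "\<And>k. (\<lambda>n. \<phi> n k) \<longlonglongrightarrow> \<phi>' k" and ev: "\<forall>\<^sub>F n in sequentially. \<forall>k. \<bar>\<phi> n k\<bar> \<le> C"
  shows "(\<lambda>n. bern (replicate n (j, r / n)) (\<phi> n) k) \<longlonglongrightarrow>
     measure_pmf.expectation (pois r) (\<lambda>i. \<phi>' ((bump j ^^ i) k))"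
proof -
  define a where "a i n = real (n choose i) * (r / n) ^ i * (1 - r / n) ^ (n - i) * \<phi> n ((bump j ^^ i) k)" for i n
  have bd': "\<bar>\<phi>' k\<bar> \<le> C" for k
    by (rule tendsto_upperbound[OF tendsto_rabs[OF lim]]) (use ev in \<open>auto elim: eventually_mono\<close>)
  obtain N where bd: "\<bar>\<phi> n k\<bar> \<le> C" if "N \<le> n" for n k
    using ev by (auto simp: eventually_sequentially)
  have C: "0 \<le> C" using bd[of N k] by linarith
  have eq: "bern (replicate n (j, r / n)) (\<phi> n) k = (\<Sum>i. a i n)" for n
    unfolding bern_replicate by (subst suminf_finite[of "{..n}"]) (auto simp: a_def not_le)
  have "\<forall>\<^sub>F (i, n) in at_top \<times>\<^sub>F sequentially. norm (a i n) \<le> r ^ i / fact i * C"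
    unfolding eventually_prod_filter
  proof (intro exI conjI allI impI)
    show "eventually (\<lambda>_. True) at_top" by simp
    show "eventually (\<lambda>n. n > max N (nat \<lceil>r\<rceil>)) sequentially" by (rule eventually_gt_at_top)
    fix i n :: nat assume "n > max N (nat \<lceil>r\<rceil>)"
    then have n: "r < real n" "0 < n" "N \<le> n" by linarith+
    have "real (n choose i) * (r / n) ^ i \<le> r ^ i / fact i"
    proof -
      have "real ((n choose i) * fact i) \<le> real (n ^ i)"
        by (rule of_nat_mono[OF binomial_fact_pow])
      then have "(real (n choose i) * fact i) * r ^ i \<le> real n ^ i * r ^ i"
        using r by (intro mult_right_mono) auto
      then show ?thesis using n by (simp add: power_divide field_simps)
    qed
    moreover have "(1 - r / n) ^ (n - i) \<le> 1" "0 \<le> (1 - r / n) ^ (n - i)"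
      using n r by (auto intro!: power_le_one zero_le_power)
    ultimately have "real (n choose i) * (r / n) ^ i * (1 - r / n) ^ (n - i) \<le> r ^ i / fact i * 1"
      using r by (intro mult_mono) auto
    then have "(real (n choose i) * (r / n) ^ i * (1 - r / n) ^ (n - i)) * \<bar>\<phi> n ((bump j ^^ i) k)\<bar> \<le> r ^ i / fact i * C"
      using r bd n by (intro mult_mono) auto
    then show "case (i, n) of (i, n) \<Rightarrow> norm (a i n) \<le> r ^ i / fact i * C"
      using \<open>0 \<le> (1 - r / n) ^ (n - i)\<close> r by (simp add: a_def abs_mult)
  qed
  moreover have "summable (\<lambda>i. r ^ i / fact i * C)"
    using summable_exp[of r] by (intro summable_mult2) (simp add: field_simps)
  moreover have "(\<lambda>n. a i n) \<longlonglongrightarrow> pmf (pois r) i * \<phi>' ((bump j ^^ i) k)" for i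
    unfolding a_def by (intro tendsto_mult binomial_tendsto_pois r lim)
  ultimately have "(\<lambda>n. \<Sum>i. a i n) \<longlonglongrightarrow> (\<Sum>i. pmf (pois r) i * \<phi>' ((bump j ^^ i) k))"
    using tannerys_theorem[of a "\<lambda>i. pmf (pois r) i * \<phi>' ((bump j ^^ i) k)" sequentially "\<lambda>i. r ^ i / fact i * C"]
    by auto
  then show ?thesis unfolding eq by (subst expectation_nat_pmf[OF bd'])
qed

lemma bern_concat_tendsto:
  assumes "distinct js" and "\<And>j. j \<in> set js \<Longrightarrow> 0 \<le> r j" and "\<And>k. \<bar>\<phi> k\<bar> \<le> C"
  shows "(\<lambda>n. bern (concat (map (\<lambda>j. replicate n (j, r j / n)) js)) \<phi> k) \<longlonglongrightarrow>
     measure_pmf.expectation (Pi_pmf (set js) 0 (\<lambda>j. pois (r j))) (\<lambda>f. \<phi> (\<lambda>j. k j + f j))"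
  using assms(1,2)
proof (induction js arbitrary: k)
  case (Cons j js)
  let ?E = "\<lambda>k. measure_pmf.expectation (Pi_pmf (set js) 0 (\<lambda>j. pois (r j))) (\<lambda>f. \<phi> (\<lambda>j. k j + f j))"
  let ?b = "\<lambda>n. bern (concat (map (\<lambda>j. replicate n (j, r j / n)) js)) \<phi>"
  let ?w = "\<lambda>n. concat (map (\<lambda>j. replicate n (j, r j / real n)) js)"
  have "\<forall>\<^sub>F n in sequentially. \<forall>j\<in>set js. r j \<le> real n \<and> 0 < n"
    by (intro eventually_ball_finite ballI eventually_conj eventually_gt_at_top)
      (auto intro: filterlim_at_top[THEN iffD1, rule_format, OF filterlim_real_sequentially])
  \<comment> \<open>For large \<open>n\<close> all the numbers \<open>r j / n\<close> are
    probabilities, and averaging with probabilities preserves the bound \<open>C\<close>.\<close>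
  then have ev: "\<forall>\<^sub>F n in sequentially. \<forall>k. \<bar>?b n k\<bar> \<le> C"
  proof eventually_elim
    case (elim n)
    then have w: "weights (?w n)"
      using Cons.prems(2) by (auto simp: weights_def divide_le_eq_1)
    show ?case
    proof
      fix k
      show "\<bar>?b n k\<bar> \<le> C"
        using bern_mono[OF w, of \<phi> "\<lambda>_. C" k] bern_mono[OF w, of "\<lambda>_. - C" \<phi> k] assms(3)
        by (auto simp: abs_le_iff minus_le_iff)
    qed
  qed
  have "(\<lambda>n. bern (replicate n (j, r j / n)) (?b n) k) \<longlonglongrightarrow>
     measure_pmf.expectation (pois (r j)) (\<lambda>i. ?E ((bump j ^^ i) k))"
    using Cons.prems by (intro bern_replicate_tendsto[OF _ _ ev] Cons.IH) auto
  moreover have "measure_pmf.expectation (pois (r j)) (\<lambda>i. ?E ((bump j ^^ i) k)) =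
     measure_pmf.expectation (Pi_pmf (set (j # js)) 0 (\<lambda>j. pois (r j))) (\<lambda>f. \<phi> (\<lambda>j. k j + f j))"
  proof -
    have j: "j \<notin> set js" using Cons.prems by simp
    have bump_pow: "(bump j ^^ i) k = k(j := k j + i)" for i
      by (induction i) (auto simp: bump_def fun_eq_iff)
    have "measure_pmf.expectation (Pi_pmf (set (j # js)) 0 (\<lambda>j. pois (r j))) (\<lambda>f. \<phi> (\<lambda>j. k j + f j)) =
      measure_pmf.expectation (pair_pmf (pois (r j)) (Pi_pmf (set js) 0 (\<lambda>j. pois (r j))))
        (\<lambda>z. \<phi> (\<lambda>l. k l + ((snd z)(j := fst z)) l))"
      by (simp add: Pi_pmf_insert j case_prod_beta)
    also have "\<dots> = measure_pmf.expectation (pois (r j)) (\<lambda>i.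
        measure_pmf.expectation (Pi_pmf (set js) 0 (\<lambda>j. pois (r j))) (\<lambda>f. \<phi> (\<lambda>l. k l + (f(j := i)) l)))"
      by (subst expectation_pair_pmf[where C=C]) (auto simp: assms(3))
    also have "\<dots> = measure_pmf.expectation (pois (r j)) (\<lambda>i. ?E ((bump j ^^ i) k))"
    proof (rule Bochner_Integration.integral_cong[OF refl], rule integral_cong_AE)
      fix i
      \<comment> \<open>Off its index set \<open>Pi_pmf\<close> takes the default value 0, so
        setting \<open>f j\<close> to \<open>i\<close> and then adding \<open>k\<close> agrees with
        raising \<open>k j\<close> by \<open>i\<close> first.\<close>
      have "f j = 0" if "f \<in> set_pmf (Pi_pmf (set js) 0 (\<lambda>j. pois (r j)))" for f
        using that set_Pi_pmf_subset[of "set js" 0 "\<lambda>j. pois (r j)"] j by auto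
      then show "AE f in measure_pmf (Pi_pmf (set js) 0 (\<lambda>j. pois (r j))).
          \<phi> (\<lambda>l. k l + (f(j := i)) l) = \<phi> (\<lambda>l. ((bump j ^^ i) k) l + f l)"
        unfolding bump_pow by (auto simp: AE_measure_pmf_iff intro!: arg_cong[where f=\<phi>])
    qed auto
    finally show ?thesis by simp
  qed
  ultimately show ?case by (simp add: bern_append[abs_def])
qed auto

section \<open>Poisson configurations\<close>

lemma num_points_eq_iff: "num_points \<omega> A = of_nat k \<longleftrightarrow> finite (\<omega> \<inter> A) \<and> card (\<omega> \<inter> A) = k"
  unfolding num_points_def
  by (cases "finite (\<omega> \<inter> A)") (auto simp: emeasure_count_space_finite emeasure_count_space_infinite ennreal_of_nat_eq_real_of_nat)

text \<open>An infinite intersection is counted as 0, the value of \<open>card\<close> there. In a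
  set of finite measure this happens with probability zero only, which is why relations between
  counts hold almost surely. The entries from \<open>m\<close> on are 0 to match the default value
  of \<open>Pi_pmf\<close>.\<close>

definition counts :: "(nat \<Rightarrow> 'x set) \<Rightarrow> nat \<Rightarrow> 'x set \<Rightarrow> nat \<Rightarrow> nat" where
  "counts A m \<omega> j = (if j < m then card (\<omega> \<inter> A j) else 0)"

lemma counts_eq_iff:
  "counts A m \<omega> = k \<longleftrightarrow> (\<forall>j<m. card (\<omega> \<inter> A j) = k j) \<and> (\<forall>j\<ge>m. k j = 0)"
  unfolding counts_def fun_eq_iff by (metis not_less)

lemma countable_counts_range: "countable {k :: nat \<Rightarrow> nat. \<forall>j\<ge>m. k j = 0}"
proof -
  have "countable (Pi\<^sub>E {..<m} (\<lambda>_. UNIV :: nat set))" by (rule countable_PiE) auto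
  then have "countable ((\<lambda>k j. if j < m then k j else 0) ` Pi\<^sub>E {..<m} (\<lambda>_. UNIV :: nat set))" by simp
  then show ?thesis
  proof (rule countable_subset[rotated], intro subsetI)
    fix k :: "nat \<Rightarrow> nat" assume "k \<in> {k. \<forall>j\<ge>m. k j = 0}"
    then have "k = (\<lambda>j. if j < m then restrict k {..<m} j else 0)" by (auto simp: fun_eq_iff not_less)
    then show "k \<in> (\<lambda>k j. if j < m then k j else 0) ` Pi\<^sub>E {..<m} (\<lambda>_. UNIV)"
      by (rule image_eqI[of _ _ "restrict k {..<m}"]) simp
  qed
qed

text \<open>An abstraction of \<open>X\<close>: the label \<open>c\<close> stands for the projection
  to the finite index set, and \<open>inner\<close> is the part of inner regularity that forces
  infinitely many points into sets of infinite measure.\<close>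

locale poisson_space =
  fixes T :: "'x topology" and M :: "'x measure" and P :: "'x set measure" and c :: "'x \<Rightarrow> 'i::finite"
  assumes poisson: "poisson_measure T M P"
    and space_M: "space M = UNIV" and topspace_T: "topspace T = UNIV"
    and sets_singleton: "\<And>x. {x} \<in> sets M" and emeasure_singleton: "\<And>x. emeasure M {x} = 0"
    and inner: "\<And>A n. A \<in> sets M \<Longrightarrow> emeasure M A = \<infinity> \<Longrightarrow>
      \<exists>B\<in>sets M. B \<subseteq> A \<and> of_nat n \<le> emeasure M B \<and> emeasure M B < \<infinity>"
    and sets_label: "\<And>i. c -` {i} \<in> sets M"
begin

sublocale prob_space P
  using poisson by (simp add: poisson_measure_def)

lemma gens_subset:
  "{{\<omega> \<in> configurations T. num_points \<omega> A = of_nat k} | A k. A \<in> sets M} \<subseteq> Pow (configurations T)"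
  by auto

lemma sets_P: "sets P = sigma_sets (configurations T)
    {{\<omega> \<in> configurations T. num_points \<omega> A = of_nat k} | A k. A \<in> sets M}"
  using poisson sets_measure_of[OF gens_subset]
  by (simp add: poisson_measure_def config_algebra_def)

lemma space_P: "space P = configurations T"
proof -
  have "sets P = sets (config_algebra T M)" using poisson by (simp add: poisson_measure_def)
  then have "space P = space (config_algebra T M)" by (rule sets_eq_imp_space_eq)
  then show ?thesis unfolding config_algebra_def space_measure_of[OF gens_subset] .
qed

lemma sets_num_points:
  assumes "A \<in> sets M"
  shows "{\<omega> \<in> space P. num_points \<omega> A = of_nat k} \<in> sets P"
  unfolding sets_P space_P using assms by (intro sigma_sets.Basic) blast

lemma sets_count:
  assumes "A \<in> sets M"
  shows "{\<omega> \<in> space P. finite (\<omega> \<inter> A) \<and> card (\<omega> \<inter> A) = k} \<in> sets P"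
  using sets_num_points[OF assms, of k] by (simp add: num_points_eq_iff)

lemma measurable_card:
  assumes A: "A \<in> sets M"
  shows "(\<lambda>\<omega>. card (\<omega> \<inter> A)) \<in> measurable P (count_space UNIV)"
proof (subst measurable_count_space_eq2_countable, intro conjI ballI)
  fix k :: nat
  have f: "{\<omega> \<in> space P. finite (\<omega> \<inter> A)} \<in> sets P"
  proof -
    have "{\<omega> \<in> space P. finite (\<omega> \<inter> A)} = (\<Union>k. {\<omega> \<in> space P. finite (\<omega> \<inter> A) \<and> card (\<omega> \<inter> A) = k})"
      by auto
    also have "\<dots> \<in> sets P" using sets_count[OF A] by blast
    finally show ?thesis .
  qed
  show "(\<lambda>\<omega>. card (\<omega> \<inter> A)) -` {k} \<inter> space P \<in> sets P"
  proof (cases "k = 0")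
    \<comment> \<open>The value 0 of \<open>card\<close> also arises from infinite
      intersections.\<close>
    case True
    have "(\<lambda>\<omega>. card (\<omega> \<inter> A)) -` {k} \<inter> space P =
       {\<omega> \<in> space P. finite (\<omega> \<inter> A) \<and> card (\<omega> \<inter> A) = k} \<union> (space P - {\<omega> \<in> space P. finite (\<omega> \<inter> A)})"
      using True by auto
    then show ?thesis using sets_count[OF A] f by auto
  next
    case False
    then have "(\<lambda>\<omega>. card (\<omega> \<inter> A)) -` {k} \<inter> space P = {\<omega> \<in> space P. finite (\<omega> \<inter> A) \<and> card (\<omega> \<inter> A) = k}"
      by (auto simp: card_eq_0_iff intro: ccontr)
    then show ?thesis using sets_count[OF A] by auto
  qed
qed auto

lemma measurable_counts:
  assumes "\<And>j. j < m \<Longrightarrow> A j \<in> sets M"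
  shows "counts A m \<in> measurable P (count_space UNIV)"
proof (rule measurableI)
  fix S :: "(nat \<Rightarrow> nat) set"
  let ?K = "{k :: nat \<Rightarrow> nat. \<forall>j\<ge>m. k j = 0}"
  have eq: "counts A m -` S \<inter> space P = (\<Union>k\<in>S \<inter> ?K. {\<omega> \<in> space P. \<forall>j\<in>{..<m}. card (\<omega> \<inter> A j) = k j})"
  proof (intro set_eqI iffI)
    fix \<omega> assume "\<omega> \<in> counts A m -` S \<inter> space P"
    then show "\<omega> \<in> (\<Union>k\<in>S \<inter> ?K. {\<omega> \<in> space P. \<forall>j\<in>{..<m}. card (\<omega> \<inter> A j) = k j})"
      by (intro UN_I[of "counts A m \<omega>"]) (auto simp: counts_def)
  next
    fix \<omega> assume "\<omega> \<in> (\<Union>k\<in>S \<inter> ?K. {\<omega> \<in> space P. \<forall>j\<in>{..<m}. card (\<omega> \<inter> A j) = k j})"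
    then obtain k where "k \<in> S" "counts A m \<omega> = k" "\<omega> \<in> space P" by (auto simp: counts_eq_iff)
    then show "\<omega> \<in> counts A m -` S \<inter> space P" by simp
  qed
  have "{\<omega> \<in> space P. \<forall>j\<in>{..<m}. card (\<omega> \<inter> A j) = k j} \<in> sets P" for k :: "nat \<Rightarrow> nat"
  proof (intro sets.sets_Collect_finite_All)
    fix j assume "j \<in> {..<m}"
    then have "(\<lambda>\<omega>. card (\<omega> \<inter> A j)) -` {k j} \<inter> space P \<in> sets P"
      by (intro measurable_sets[OF measurable_card]) (auto intro: assms)
    moreover have "(\<lambda>\<omega>. card (\<omega> \<inter> A j)) -` {k j} \<inter> space P = {\<omega> \<in> space P. card (\<omega> \<inter> A j) = k j}" by auto
    ultimately show "{\<omega> \<in> space P. card (\<omega> \<inter> A j) = k j} \<in> sets P" by simp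
  qed auto
  then have un: "(\<Union>k\<in>S \<inter> ?K. {\<omega> \<in> space P. \<forall>j\<in>{..<m}. card (\<omega> \<inter> A j) = k j}) \<in> sets P"
    by (intro sets.countable_UN'' countable_subset[OF Int_lower2[of S ?K] countable_counts_range])
  show "counts A m -` S \<inter> space P \<in> sets P"
    unfolding eq by (rule un)
qed simp

lemma prob_count:
  assumes "A \<in> sets M" "emeasure M A < \<infinity>"
  shows "prob {\<omega> \<in> space P. finite (\<omega> \<inter> A) \<and> card (\<omega> \<inter> A) = k} = pmf (pois (measure M A)) k"
proof -
  have "prob {\<omega> \<in> space P. num_points \<omega> A = of_nat k} = exp (- measure M A) * measure M A ^ k / fact k"
    using poisson assms unfolding poisson_measure_def by blast
  then show ?thesis by (simp add: num_points_eq_iff pmf_pois)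
qed

text \<open>The Poisson probabilities of the finite values already add up to 1.\<close>

lemma AE_finite:
  assumes "A \<in> sets M" "emeasure M A < \<infinity>"
  shows "AE \<omega> in P. finite (\<omega> \<inter> A)"
proof -
  let ?E = "\<lambda>k. {\<omega> \<in> space P. finite (\<omega> \<inter> A) \<and> card (\<omega> \<inter> A) = k}"
  have "emeasure P (\<Union>k. ?E k) = (\<Sum>k. emeasure P (?E k))"
    using sets_count[OF assms(1)]
    by (intro suminf_emeasure[symmetric]) (auto simp: disjoint_family_on_def)
  also have "\<dots> = (\<Sum>k. ennreal (pmf (pois (measure M A)) k))"
    by (simp add: emeasure_eq_measure prob_count[OF assms])
  also have "\<dots> = (\<integral>\<^sup>+k. ennreal (pmf (pois (measure M A)) k) \<partial>count_space UNIV)"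
    by (rule nn_integral_count_space_nat[symmetric])
  also have "\<dots> = 1" by (rule nn_integral_pmf_eq_1)
  finally have "prob (\<Union>k. ?E k) = 1" by (simp add: emeasure_eq_measure)
  then have "AE \<omega> in P. \<omega> \<in> (\<Union>k. ?E k)" by (rule AE_prob_1)
  then show ?thesis by eventually_elim auto
qed

text \<open>The Poisson property prescribes counts on sets of finite measure only. If
  \<open>A\<close> contains \<open>k\<close> points, then each \<open>B n\<close> inside
  \<open>A\<close> contains at most \<open>k\<close>, and the Poisson probability of this tends to 0
  as the measure of \<open>B n\<close> grows.\<close>

lemma AE_infinite:
  assumes A: "A \<in> sets M" "emeasure M A = \<infinity>"
  shows "AE \<omega> in P. infinite (\<omega> \<inter> A)"
proof -
  have zero: "prob {\<omega> \<in> space P. finite (\<omega> \<inter> A) \<and> card (\<omega> \<inter> A) = k} = 0" (is "?p = 0") for k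
  proof -
    obtain B where B: "\<And>n. B n \<in> sets M" "\<And>n. B n \<subseteq> A" "\<And>n. of_nat n \<le> emeasure M (B n)" "\<And>n. emeasure M (B n) < \<infinity>"
      using inner[OF A] by metis
    define l where "l n = measure M (B n)" for n
    have l: "real n \<le> l n" for n
      using B(3)[of n] B(4)[of n]
      by (subst (asm) emeasure_eq_ennreal_measure) (auto simp: l_def ennreal_of_nat_eq_real_of_nat)
    then have lim: "filterlim l at_top sequentially"
      by (intro filterlim_at_top_mono[OF filterlim_real_sequentially]) auto
    have "?p \<le> (\<Sum>i\<le>k. pmf (pois (l n)) i)" for n
    proof -
      have "?p \<le> prob (\<Union>i\<in>{..k}. {\<omega> \<in> space P. finite (\<omega> \<inter> B n) \<and> card (\<omega> \<inter> B n) = i})"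
      proof (rule finite_measure_mono)
        have "finite (\<omega> \<inter> B n) \<and> card (\<omega> \<inter> B n) \<le> card (\<omega> \<inter> A)" if "finite (\<omega> \<inter> A)" for \<omega>
          using that B(2)[of n] by (metis Int_mono card_mono finite_subset order_refl)
        then show "{\<omega> \<in> space P. finite (\<omega> \<inter> A) \<and> card (\<omega> \<inter> A) = k} \<subseteq>
           (\<Union>i\<in>{..k}. {\<omega> \<in> space P. finite (\<omega> \<inter> B n) \<and> card (\<omega> \<inter> B n) = i})"
          by fastforce
      qed (use sets_count[OF B(1)] in auto)
      also have "\<dots> \<le> (\<Sum>i\<le>k. prob {\<omega> \<in> space P. finite (\<omega> \<inter> B n) \<and> card (\<omega> \<inter> B n) = i})"
        by (rule finite_measure_subadditive_finite) (use sets_count[OF B(1)] in auto)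
      finally show ?thesis by (simp only: prob_count[OF B(1) B(4)] l_def)
    qed
    moreover have "(\<lambda>n. \<Sum>i\<le>k. pmf (pois (l n)) i) \<longlonglongrightarrow> 0"
    proof (intro tendsto_null_sum)
      fix i
      have "(\<lambda>n. l n ^ i / exp (l n)) \<longlonglongrightarrow> 0"
        by (rule filterlim_compose[OF tendsto_power_div_exp_0 lim])
      then have "(\<lambda>n. l n ^ i / exp (l n) / fact i) \<longlonglongrightarrow> 0"
        using tendsto_divide[OF _ tendsto_const[of "fact i :: real"]] by fastforce
      then show "(\<lambda>n. pmf (pois (l n)) i) \<longlonglongrightarrow> 0"
        by (simp add: pmf_pois l_def exp_minus field_simps)
    qed
    ultimately have "?p \<le> 0" by (intro LIMSEQ_le_const[where a="?p"]) auto
    then show ?thesis by (simp add: measure_le_0_iff)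
  qed
  have "AE \<omega> in P. \<not> (finite (\<omega> \<inter> A) \<and> card (\<omega> \<inter> A) = k)" for k
    using zero[of k] sets_count[OF A(1), of k]
    by (intro AE_I[of _ _ "{\<omega> \<in> space P. finite (\<omega> \<inter> A) \<and> card (\<omega> \<inter> A) = k}"])
      (auto simp: emeasure_eq_measure)
  then have "AE \<omega> in P. \<forall>k. \<not> (finite (\<omega> \<inter> A) \<and> card (\<omega> \<inter> A) = k)"
    by (intro AE_all_countable[THEN iffD2] allI)
  then show ?thesis by eventually_elim auto
qed

text \<open>A singleton has measure zero, hence almost surely no points. So adding \<open>x\<close>
  raises the count of its cell by exactly one, almost surely.\<close>

lemma AE_notin: "AE \<omega> in P. x \<notin> \<omega>"
proof -
  have "prob {\<omega> \<in> space P. finite (\<omega> \<inter> {x}) \<and> card (\<omega> \<inter> {x}) = 0} = 1"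
    by (subst prob_count) (auto simp: sets_singleton emeasure_singleton pmf_pois measure_def)
  then have "AE \<omega> in P. \<omega> \<in> {\<omega> \<in> space P. finite (\<omega> \<inter> {x}) \<and> card (\<omega> \<inter> {x}) = 0}" by (rule AE_prob_1)
  then show ?thesis by eventually_elim auto
qed

lemma add_point_config: "\<omega> \<in> configurations T \<Longrightarrow> insert x \<omega> \<in> configurations T"
  unfolding configurations_def by (force simp: topspace_T Int_insert_left)

lemma measurable_insert: "insert x \<in> measurable P P"
proof -
  have "insert x \<in> measurable P (sigma (configurations T)
     {{\<omega> \<in> configurations T. num_points \<omega> A = of_nat k} | A k. A \<in> sets M})"
  proof (rule measurable_measure_of[OF gens_subset])
    show "insert x \<in> space P \<rightarrow> configurations T" by (auto simp: space_P add_point_config)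
    fix E assume "E \<in> {{\<omega> \<in> configurations T. num_points \<omega> A = of_nat k} | A k. A \<in> sets M}"
    then obtain A k where E: "E = {\<omega> \<in> configurations T. num_points \<omega> A = of_nat k}" and A: "A \<in> sets M"
      by blast
    \<comment> \<open>The configuration may already contain \<open>x\<close>; the preimage is
      therefore expressed by the points of \<open>A\<close> other than \<open>x\<close>.\<close>
    have Ax: "A - {x} \<in> sets M" using A sets_singleton by blast
    show "insert x -` E \<inter> space P \<in> sets P"
    proof (cases "x \<in> A")
      case False
      then have "insert x -` E \<inter> space P = {\<omega> \<in> space P. finite (\<omega> \<inter> A) \<and> card (\<omega> \<inter> A) = k}"
        by (auto simp: E space_P add_point_config num_points_eq_iff)
      then show ?thesis using sets_count[OF A] by simp
    next
      case True
      then have i: "insert x \<omega> \<inter> A = insert x (\<omega> \<inter> (A - {x}))" for \<omega> by auto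
      show ?thesis
      proof (cases k)
        case 0
        then have "insert x -` E \<inter> space P = {}"
          by (auto simp: E space_P num_points_eq_iff i card_gt_0_iff simp del: of_nat_0)
        then show ?thesis by simp
      next
        case (Suc k')
        then have "insert x -` E \<inter> space P = {\<omega> \<in> space P. finite (\<omega> \<inter> (A - {x})) \<and> card (\<omega> \<inter> (A - {x})) = k'}"
          by (auto simp: E space_P add_point_config num_points_eq_iff i simp del: of_nat_Suc)
        then show ?thesis using sets_count[OF Ax] by simp
      qed
    qed
  qed
  moreover have "sets P = sets (sigma (configurations T)
     {{\<omega> \<in> configurations T. num_points \<omega> A = of_nat k} | A k. A \<in> sets M})"
    using sets_P sets_measure_of[OF gens_subset] by simp
  ultimately show ?thesis by (simp cong: measurable_cong_sets)
qed

lemma prob_counts: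
  fixes A :: "nat \<Rightarrow> 'x set"
  assumes A: "\<And>j. j < m \<Longrightarrow> A j \<in> sets M \<and> emeasure M (A j) < \<infinity>" and d: "disjoint_family_on A {..<m}"
  shows "prob {\<omega> \<in> space P. \<forall>j<m. finite (\<omega> \<inter> A j) \<and> card (\<omega> \<inter> A j) = k j} =
    (\<Prod>j<m. pmf (pois (measure M (A j))) (k j))"
proof (cases "m = 0")
  case True
  then show ?thesis by (simp add: prob_space)
next
  case False
  have "indep_vars (\<lambda>_. borel) (\<lambda>j \<omega>. num_points \<omega> (A j)) {..<m}"
    using poisson A d unfolding poisson_measure_def by blast
  then have "prob (\<Inter>j\<in>{..<m}. (\<lambda>\<omega>. num_points \<omega> (A j)) -` {of_nat (k j)} \<inter> space P) =
     (\<Prod>j\<in>{..<m}. prob ((\<lambda>\<omega>. num_points \<omega> (A j)) -` {of_nat (k j)} \<inter> space P))"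
    using False by (intro indep_varsD) auto
  moreover have "(\<Inter>j\<in>{..<m}. (\<lambda>\<omega>. num_points \<omega> (A j)) -` {of_nat (k j)} \<inter> space P) =
     {\<omega> \<in> space P. \<forall>j<m. finite (\<omega> \<inter> A j) \<and> card (\<omega> \<inter> A j) = k j}"
    using False by (auto simp: num_points_eq_iff)
  moreover have "prob ((\<lambda>\<omega>. num_points \<omega> (A j)) -` {of_nat (k j)} \<inter> space P) = pmf (pois (measure M (A j))) (k j)"
    if "j < m" for j
  proof -
    have "(\<lambda>\<omega>. num_points \<omega> (A j)) -` {of_nat (k j)} \<inter> space P = {\<omega> \<in> space P. finite (\<omega> \<inter> A j) \<and> card (\<omega> \<inter> A j) = k j}"
      by (auto simp: num_points_eq_iff)
    then show ?thesis using prob_count A that by simp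
  qed
  ultimately show ?thesis by simp
qed

lemma distr_counts:
  assumes A: "\<And>j. j < m \<Longrightarrow> A j \<in> sets M \<and> emeasure M (A j) < \<infinity>" and d: "disjoint_family_on A {..<m}"
  shows "distr P (count_space UNIV) (counts A m) = measure_pmf (Pi_pmf {..<m} 0 (\<lambda>j. pois (measure M (A j))))"
proof (rule measure_eqI_countable_AE)
  let ?K = "{k :: nat \<Rightarrow> nat. \<forall>j\<ge>m. k j = 0}"
  have meas[measurable]: "counts A m \<in> measurable P (count_space UNIV)"
    using A by (intro measurable_counts) auto
  show "AE k in distr P (count_space UNIV) (counts A m). k \<in> ?K"
    by (subst AE_distr_iff) (auto simp: counts_def)
  show "AE k in measure_pmf (Pi_pmf {..<m} 0 (\<lambda>j. pois (measure M (A j)))). k \<in> ?K"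
    using set_Pi_pmf_subset[of "{..<m}" 0 "\<lambda>j. pois (measure M (A j))"] by (auto simp: AE_measure_pmf_iff)
  show "countable ?K" by (rule countable_counts_range)
  fix k assume k: "k \<in> ?K"
  have "AE \<omega> in P. \<forall>j\<in>{..<m}. finite (\<omega> \<inter> A j)"
    using A by (intro AE_finite_allI AE_finite) auto
  then have "AE \<omega> in P. \<omega> \<in> counts A m -` {k} \<inter> space P \<longleftrightarrow>
      \<omega> \<in> {\<omega> \<in> space P. \<forall>j\<in>{..<m}. finite (\<omega> \<inter> A j) \<and> card (\<omega> \<inter> A j) = k j}"
    by (rule AE_mp) (use k in \<open>auto simp: counts_eq_iff\<close>)
  then have "emeasure P (counts A m -` {k} \<inter> space P) =
      emeasure P {\<omega> \<in> space P. \<forall>j\<in>{..<m}. finite (\<omega> \<inter> A j) \<and> card (\<omega> \<inter> A j) = k j}"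
  proof (rule emeasure_eq_AE)
    show "{\<omega> \<in> space P. \<forall>j\<in>{..<m}. finite (\<omega> \<inter> A j) \<and> card (\<omega> \<inter> A j) = k j} \<in> events"
      using A by (intro sets.sets_Collect_finite_All sets_count) auto
    show "counts A m -` {k} \<inter> space P \<in> events" by (rule measurable_sets[OF meas]) simp
  qed
  also have "{\<omega> \<in> space P. \<forall>j\<in>{..<m}. finite (\<omega> \<inter> A j) \<and> card (\<omega> \<inter> A j) = k j} =
      {\<omega> \<in> space P. \<forall>j<m. finite (\<omega> \<inter> A j) \<and> card (\<omega> \<inter> A j) = k j}" by auto
  also have "emeasure P \<dots> = ennreal (\<Prod>j<m. pmf (pois (measure M (A j))) (k j))"
    by (simp add: emeasure_eq_measure prob_counts[OF assms])
  finally show "emeasure (distr P (count_space UNIV) (counts A m)) {k} =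
      emeasure (measure_pmf (Pi_pmf {..<m} 0 (\<lambda>j. pois (measure M (A j))))) {k}"
    using k by (simp add: emeasure_distr[OF meas] emeasure_pmf_single pmf_Pi not_less)
qed auto

end

section \<open>The Mecke formula\<close>

lemma bump_same: "bump j k j = Suc (k j)" and bump_other: "i \<noteq> j \<Longrightarrow> bump j k i = k i"
  by (auto simp: bump_def)

text \<open>Size-biasing a Poisson count adds one point.\<close>

lemma pmf_Pi_pois_bump:
  fixes m :: nat
  assumes "j < m" "\<And>i. i < m \<Longrightarrow> 0 \<le> r i"
  shows "real (Suc (k j)) * pmf (Pi_pmf {..<m} 0 (\<lambda>j. pois (r j))) (bump j k) =
    r j * pmf (Pi_pmf {..<m} 0 (\<lambda>j. pois (r j))) k"
proof -
  have eq: "(\<forall>i. i \<notin> {..<m} \<longrightarrow> bump j k i = 0) \<longleftrightarrow> (\<forall>i. i \<notin> {..<m} \<longrightarrow> k i = 0)"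
    using assms(1) by (auto simp: bump_def)
  have s: "{..<m} = insert j ({..<m} - {j})" using assms(1) by auto
  have p: "(\<Prod>i<m. pmf (pois (r i)) (l i)) = pmf (pois (r j)) (l j) * (\<Prod>i\<in>{..<m} - {j}. pmf (pois (r i)) (l i))" for l
    using assms(1) by (intro prod.remove) auto
  have q: "(\<Prod>i\<in>{..<m} - {j}. pmf (pois (r i)) (bump j k i)) = (\<Prod>i\<in>{..<m} - {j}. pmf (pois (r i)) (k i))"
    by (intro prod.cong) (auto simp: bump_other)
  have "real (Suc (k j)) * pmf (pois (r j)) (Suc (k j)) = r j * pmf (pois (r j)) (k j)"
    using assms by (simp add: pmf_pois field_simps del: of_nat_Suc)
  note r = this
  show ?thesis
  proof (cases "\<forall>i. i \<notin> {..<m} \<longrightarrow> k i = 0")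
    case True
    show ?thesis
      unfolding pmf_Pi[OF finite_lessThan] eq p q bump_same if_P[OF True] mult.assoc[symmetric] r ..
  next
    case False
    show ?thesis
      unfolding pmf_Pi[OF finite_lessThan] eq if_not_P[OF False] by simp
  qed
qed

text \<open>The Mecke formula for a vector of independent Poisson counts. The factor
  \<open>k j\<close> removes the vectors with \<open>k j = 0\<close>, and the others are the image
  of the injective map \<open>bump j\<close>, along which the sum is transported.\<close>

lemma nn_integral_Pi_pois_bump:
  fixes S :: "(nat \<Rightarrow> nat) set"
  assumes j: "j < m" and r: "\<And>i. i < m \<Longrightarrow> 0 \<le> r i"
  shows "(\<integral>\<^sup>+k. of_nat (k j) * indicator S k \<partial>Pi_pmf {..<m} 0 (\<lambda>j. pois (r j))) =
    ennreal (r j) * emeasure (Pi_pmf {..<m} 0 (\<lambda>j. pois (r j))) (bump j -` S)"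
proof -
  let ?Q = "Pi_pmf {..<m} 0 (\<lambda>j. pois (r j))"
  have bij: "bij_betw (bump j) UNIV {k. k j \<noteq> 0}"
  proof (rule bij_betwI[where g="\<lambda>k. k(j := k j - 1)"])
    fix k :: "nat \<Rightarrow> nat" assume "k \<in> {k. k j \<noteq> 0}"
    then show "bump j (k(j := k j - 1)) = k" by (auto simp: bump_def fun_eq_iff)
  qed (auto simp: bump_def fun_eq_iff)
  have "(\<integral>\<^sup>+k. of_nat (k j) * indicator S k \<partial>?Q) =
      (\<integral>\<^sup>+k. ennreal (pmf ?Q k) * (of_nat (k j) * indicator S k) \<partial>count_space UNIV)"
    by (rule nn_integral_measure_pmf)
  also have "\<dots> = (\<integral>\<^sup>+k. ennreal (pmf ?Q k) * (of_nat (k j) * indicator S k) * indicator {k. k j \<noteq> 0} k \<partial>count_space UNIV)"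
    by (intro nn_integral_cong) (auto split: split_indicator)
  also have "\<dots> = (\<integral>\<^sup>+k. ennreal (pmf ?Q k) * (of_nat (k j) * indicator S k) \<partial>count_space {k. k j \<noteq> 0})"
    by (simp add: nn_integral_count_space_indicator)
  also have "\<dots> = (\<integral>\<^sup>+k. ennreal (pmf ?Q (bump j k)) * (of_nat (bump j k j) * indicator S (bump j k)) \<partial>count_space UNIV)"
    by (rule nn_integral_bij_count_space[OF bij, symmetric])
  also have "\<dots> = (\<integral>\<^sup>+k. ennreal (r j) * (ennreal (pmf ?Q k) * indicator (bump j -` S) k) \<partial>count_space UNIV)"
  proof (intro nn_integral_cong)
    fix k
    have "ennreal (pmf ?Q (bump j k)) * of_nat (bump j k j) = ennreal (r j) * ennreal (pmf ?Q k)"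
      unfolding bump_same ennreal_of_nat_eq_real_of_nat
      using pmf_Pi_pois_bump[of j m r k] r j
      by (simp add: ennreal_mult[symmetric] mult.commute del: of_nat_Suc)
    then show "ennreal (pmf ?Q (bump j k)) * (of_nat (bump j k j) * indicator S (bump j k)) =
        ennreal (r j) * (ennreal (pmf ?Q k) * indicator (bump j -` S) k)"
      by (simp add: mult.assoc[symmetric] indicator_def)
  qed
  also have "\<dots> = ennreal (r j) * (\<integral>\<^sup>+k. ennreal (pmf ?Q k) * indicator (bump j -` S) k \<partial>count_space UNIV)"
    by (rule nn_integral_cmult) auto
  also have "(\<integral>\<^sup>+k. ennreal (pmf ?Q k) * indicator (bump j -` S) k \<partial>count_space UNIV) = emeasure ?Q (bump j -` S)"
    by (subst nn_integral_measure_pmf[symmetric]) simp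
  finally show ?thesis .
qed

section \<open>Disjoint cells, common refinements, and events determined by counts\<close>

context poisson_space
begin

text \<open>Confinement to a single label ensures that a point added in such a set changes only one
  of the functionals.\<close>

definition good :: "'x set \<Rightarrow> bool" where
  "good B \<longleftrightarrow> B \<in> sets M \<and> emeasure M B < \<infinity> \<and> (\<exists>i. B \<subseteq> c -` {i})"

definition cells :: "(nat \<Rightarrow> 'x set) \<Rightarrow> nat \<Rightarrow> bool" where
  "cells A m \<longleftrightarrow> (\<forall>j<m. good (A j)) \<and> disjoint_family_on A {..<m}"

lemma good_subset: "good B \<Longrightarrow> C \<in> sets M \<Longrightarrow> C \<subseteq> B \<Longrightarrow> good C"
  unfolding good_def using emeasure_mono[of C B M] by (meson order.strict_trans1 order_trans)

lemma goodD: "good B \<Longrightarrow> B \<in> sets M" "good B \<Longrightarrow> emeasure M B < \<infinity>"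
  by (auto simp: good_def)

lemma good_Int: "good C \<Longrightarrow> B \<in> sets M \<Longrightarrow> good (C \<inter> B)"
  by (rule good_subset[OF _ sets.Int[OF goodD(1)]]) auto

lemma good_Diff: "good C \<Longrightarrow> B \<in> sets M \<Longrightarrow> good (C - B)"
  by (rule good_subset[OF _ sets.Diff[OF goodD(1)]]) auto

lemma cells_finite: "cells A m \<Longrightarrow> j < m \<Longrightarrow> A j \<in> sets M \<and> emeasure M (A j) < \<infinity>"
  by (auto simp: cells_def good_def)

lemma cells_disjoint:
  assumes "cells A m" "i < m" "j < m" "x \<in> A i" "x \<in> A j"
  shows "i = j"
proof (rule ccontr)
  assume "i \<noteq> j"
  then have "A i \<inter> A j = {}"
    using assms(1-3) by (auto simp only: cells_def disjoint_family_on_def lessThan_iff)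
  then show False using assms(4,5) by auto
qed

text \<open>A new set \<open>B\<close> splits every old piece \<open>C\<close> into
  \<open>C \<inter> B\<close> and \<open>C - B\<close> and contributes the part of \<open>B\<close>
  outside all old pieces. Splitting never leaves a label and never increases the measure.\<close>

lemma refine_sets:
  assumes "finite \<B>" "\<And>B. B \<in> \<B> \<Longrightarrow> good B"
  shows "\<exists>\<C>. finite \<C> \<and> disjoint \<C> \<and> (\<forall>C\<in>\<C>. good C) \<and> (\<forall>B\<in>\<B>. \<exists>\<D>\<subseteq>\<C>. B = \<Union>\<D>)"
  using assms
proof (induction \<B> rule: finite_induct)
  case empty
  show ?case by (rule exI[of _ "{}"]) auto
next
  case (insert B \<B>)
  then obtain \<C> where C: "finite \<C>" "disjoint \<C>" "\<And>C. C \<in> \<C> \<Longrightarrow> good C"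
    "\<And>B. B \<in> \<B> \<Longrightarrow> \<exists>\<D>\<subseteq>\<C>. B = \<Union>\<D>" by (metis insertCI)
  have B: "good B" using insert by auto
  let ?I = "(\<lambda>C. C \<inter> B) ` \<C>" and ?D = "(\<lambda>C. C - B) ` \<C>"
  let ?C' = "?I \<union> ?D \<union> {B - \<Union>\<C>}"
  have dis: "C \<inter> C' = {}" if "C \<in> \<C>" "C' \<in> \<C>" "C \<noteq> C'" for C C'
    using C(2) that by (auto simp: disjoint_def)
  have f1: "finite ?C'" using C(1) by auto
  have f2: "disjoint ?C'"
  proof (rule disjointI)
    fix a b assume "a \<in> ?C'" "b \<in> ?C'" "a \<noteq> b"
    then show "a \<inter> b = {}" using dis by (elim UnE imageE singletonE) blast+
  qed
  have f3: "good X" if X: "X \<in> ?C'" for X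
  proof -
    have m: "\<Union>\<C> \<in> sets M" using C(1,3) goodD(1) by (intro sets.finite_Union) blast+
    from X consider C where "C \<in> \<C>" "X = C \<inter> B" | C where "C \<in> \<C>" "X = C - B" | "X = B - \<Union>\<C>" by blast
    then show ?thesis
    proof cases
      case 1
      then show ?thesis using good_Int[OF C(3) goodD(1)[OF B]] by simp
    next
      case 2
      then show ?thesis using good_Diff[OF C(3) goodD(1)[OF B]] by simp
    next
      case 3
      then show ?thesis using good_Diff[OF B m] by simp
    qed
  qed
  have f4: "\<exists>\<D>\<subseteq>?C'. X = \<Union>\<D>" if X: "X \<in> insert B \<B>" for X
  proof (cases "X = B")
    case True
    then show ?thesis by (intro exI[of _ "?I \<union> {B - \<Union>\<C>}"]) auto
  next
    case False
    then obtain \<D> where D: "\<D> \<subseteq> \<C>" "X = \<Union>\<D>" using C(4) X by blast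
    have "X = \<Union>((\<lambda>C. C \<inter> B) ` \<D> \<union> (\<lambda>C. C - B) ` \<D>)" using D by auto
    then show ?thesis using D(1) by (intro exI[of _ "(\<lambda>C. C \<inter> B) ` \<D> \<union> (\<lambda>C. C - B) ` \<D>"]) auto
  qed
  show ?case
    by (rule exI[of _ ?C'], intro conjI ballI) (fact f1, fact f2, erule f3, erule f4)
qed

lemma refine_cells:
  assumes "finite \<B>" "\<And>B. B \<in> \<B> \<Longrightarrow> good B"
  obtains A m where "cells A m" "\<And>B. B \<in> \<B> \<Longrightarrow> \<exists>J\<subseteq>{..<m}. B = (\<Union>j\<in>J. A j)"
proof -
  obtain \<C> where C': "finite \<C> \<and> disjoint \<C> \<and> (\<forall>C\<in>\<C>. good C) \<and>
      (\<forall>B\<in>\<B>. \<exists>\<D>\<subseteq>\<C>. B = \<Union>\<D>)" using refine_sets[OF assms] by (rule exE)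
  then have C: "finite \<C>" "disjoint \<C>" "\<And>C. C \<in> \<C> \<Longrightarrow> good C"
    "\<And>B. B \<in> \<B> \<Longrightarrow> \<exists>\<D>\<subseteq>\<C>. B = \<Union>\<D>" by simp_all
  obtain A where A: "bij_betw A {0..<card \<C>} \<C>" using ex_bij_betw_nat_finite[OF C(1)] by blast
  let ?m = "card \<C>"
  have img: "A ` {..<?m} = \<C>" and inj: "inj_on A {..<?m}"
    using A by (auto simp: bij_betw_def atLeast0LessThan)
  have "cells A ?m"
    unfolding cells_def
  proof
    show "\<forall>j<?m. good (A j)" using img C(3) by auto
    show "disjoint_family_on A {..<?m}"
      using img inj C(2) by (simp add: disjoint_image_disjoint_family_on)
  qed
  moreover have "\<exists>J\<subseteq>{..<?m}. B = (\<Union>j\<in>J. A j)" if B: "B \<in> \<B>" for B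
  proof -
    obtain \<D> where D: "\<D> \<subseteq> \<C>" "B = \<Union>\<D>" using C(4)[OF B] by blast
    then obtain J where "J \<subseteq> {..<?m}" "\<D> = A ` J" using img by (metis subset_image_iff)
    then show ?thesis using D by blast
  qed
  ultimately show ?thesis using that by blast
qed

lemma card_Union_cells:
  assumes "cells A m" "J \<subseteq> {..<m}" "\<And>j. j < m \<Longrightarrow> finite (\<omega> \<inter> A j)"
  shows "card (\<omega> \<inter> (\<Union>j\<in>J. A j)) = (\<Sum>j\<in>J. counts A m \<omega> j)"
proof -
  have J: "finite J" using assms(2) by (rule finite_subset) simp
  have "card (\<Union>j\<in>J. \<omega> \<inter> A j) = (\<Sum>j\<in>J. card (\<omega> \<inter> A j))"
    using assms(2,3) J cells_disjoint[OF assms(1)] by (intro card_UN_disjoint) (auto, blast)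
  also have "\<dots> = (\<Sum>j\<in>J. counts A m \<omega> j)"
    using assms(2) by (intro sum.cong) (auto simp: counts_def)
  finally show ?thesis unfolding Int_UN_distrib .
qed

lemma AE_finite_cells:
  assumes "cells A m"
  shows "AE \<omega> in P. \<forall>j<m. finite (\<omega> \<inter> A j)"
proof -
  have "AE \<omega> in P. \<forall>j\<in>{..<m}. finite (\<omega> \<inter> A j)"
    using cells_finite[OF assms] by (intro AE_finite_allI AE_finite) auto
  then show ?thesis by eventually_elim simp
qed

lemma measurable_counts_cells: "cells A m \<Longrightarrow> counts A m \<in> measurable P (count_space UNIV)"
  by (rule measurable_counts) (simp add: cells_finite)

lemma distr_counts_cells:
  "cells A m \<Longrightarrow> distr P (count_space UNIV) (counts A m) =
    measure_pmf (Pi_pmf {..<m} 0 (\<lambda>j. pois (measure M (A j))))"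
  by (rule distr_counts[OF cells_finite]) (auto simp only: cells_def)

lemma counts_insert_in:
  assumes "cells A m" "j < m" "x \<in> A j" "x \<notin> \<omega>" "\<forall>j<m. finite (\<omega> \<inter> A j)"
  shows "counts A m (insert x \<omega>) = bump j (counts A m \<omega>)"
proof
  fix i
  have d: "x \<notin> A i" if "i < m" "i \<noteq> j"
    using assms that cells_disjoint by blast
  show "counts A m (insert x \<omega>) i = bump j (counts A m \<omega>) i"
    using assms d by (cases "i = j") (auto simp: counts_def bump_same bump_other)
qed

lemma counts_insert_out:
  assumes "\<And>j. j < m \<Longrightarrow> x \<notin> A j"
  shows "counts A m (insert x \<omega>) = counts A m \<omega>"
  using assms by (auto simp: counts_def fun_eq_iff)

text \<open>The second condition controls the event after a point has been added; it is not implied by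
  the first one, as adding a point may map into a null set.\<close>

definition determined :: "'x set set \<Rightarrow> (nat \<Rightarrow> 'x set) \<Rightarrow> nat \<Rightarrow> (nat \<Rightarrow> nat) set \<Rightarrow> bool" where
  "determined E A m S \<longleftrightarrow>
     (AE \<omega> in P. \<omega> \<in> E \<longleftrightarrow> counts A m \<omega> \<in> S) \<and>
     (\<forall>x. AE \<omega> in P. insert x \<omega> \<in> E \<longleftrightarrow> counts A m (insert x \<omega>) \<in> S)"

definition coarsen :: "(nat \<Rightarrow> nat set) \<Rightarrow> nat \<Rightarrow> (nat \<Rightarrow> nat) \<Rightarrow> nat \<Rightarrow> nat" where
  "coarsen J m k j = (if j < m then \<Sum>l\<in>J j. k l else 0)"

lemma counts_coarsen:
  assumes "cells A' m'" "\<And>j. j < m \<Longrightarrow> J j \<subseteq> {..<m'} \<and> A j = (\<Union>l\<in>J j. A' l)"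
    and "\<forall>j<m'. finite (\<omega> \<inter> A' j)"
  shows "counts A m \<omega> = coarsen J m (counts A' m' \<omega>)"
proof
  fix j
  show "counts A m \<omega> j = coarsen J m (counts A' m' \<omega>) j"
    using assms by (auto simp: counts_def[of A] coarsen_def card_Union_cells)
qed

lemma determined_refine:
  assumes A': "cells A' m'" "\<And>j. j < m \<Longrightarrow> J j \<subseteq> {..<m'} \<and> A j = (\<Union>l\<in>J j. A' l)"
    and det: "determined E A m S"
  shows "determined E A' m' (coarsen J m -` S)"
  unfolding determined_def
proof (intro conjI allI)
  have 1: "AE \<omega> in P. \<omega> \<in> E \<longleftrightarrow> counts A m \<omega> \<in> S"
    and 2: "AE \<omega> in P. insert x \<omega> \<in> E \<longleftrightarrow> counts A m (insert x \<omega>) \<in> S" for x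
    using det by (auto simp: determined_def)
  note fin = AE_finite_cells[OF A'(1)]
  show "AE \<omega> in P. \<omega> \<in> E \<longleftrightarrow> counts A' m' \<omega> \<in> coarsen J m -` S"
    using 1 fin by eventually_elim (simp add: counts_coarsen[OF A'])
  show "AE \<omega> in P. insert x \<omega> \<in> E \<longleftrightarrow> counts A' m' (insert x \<omega>) \<in> coarsen J m -` S" for x
    using 2[of x] fin
  proof eventually_elim
    case (elim \<omega>)
    then have "\<forall>j<m'. finite (insert x \<omega> \<inter> A' j)" by (simp add: Int_insert_left)
    then show ?case using elim(1) counts_coarsen[OF A'(1), of m J A "insert x \<omega>"] A'(2) by simp
  qed
qed

text \<open>Refinement brings finitely many events to the same cells, in such a way that prescribed
  good sets become unions of cells too. The first is needed to intersect events, the second for the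
  Mecke formula, where a set \<open>B\<close> and an event \<open>E\<close> occur together.\<close>

lemma determined_joint:
  assumes "finite I" "\<And>i. i \<in> I \<Longrightarrow> cells (A i) (m i) \<and> determined (E i) (A i) (m i) (S i)"
    and "finite \<B>" "\<And>B. B \<in> \<B> \<Longrightarrow> good B"
  obtains A' m' S' where "cells A' m'" "\<And>i. i \<in> I \<Longrightarrow> determined (E i) A' m' (S' i)"
    "\<And>B. B \<in> \<B> \<Longrightarrow> \<exists>J\<subseteq>{..<m'}. B = (\<Union>j\<in>J. A' j)"
proof -
  have fin: "finite (\<B> \<union> (\<Union>i\<in>I. A i ` {..<m i}))" using assms by auto
  have gd: "good B" if "B \<in> \<B> \<union> (\<Union>i\<in>I. A i ` {..<m i})" for B
    using assms(2,4) that unfolding cells_def by blast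
  obtain A' m' where A': "cells A' m'"
    "\<And>B. B \<in> \<B> \<union> (\<Union>i\<in>I. A i ` {..<m i}) \<Longrightarrow> \<exists>J\<subseteq>{..<m'}. B = (\<Union>j\<in>J. A' j)"
    using refine_cells[OF fin gd] by blast
  have "\<exists>S'. determined (E i) A' m' S'" if i: "i \<in> I" for i
  proof -
    have "\<exists>J. J \<subseteq> {..<m'} \<and> A i j = (\<Union>l\<in>J. A' l)" if "j < m i" for j
      using A'(2)[of "A i j"] i that by blast
    then obtain J where "\<And>j. j < m i \<Longrightarrow> J j \<subseteq> {..<m'} \<and> A i j = (\<Union>l\<in>J j. A' l)" by metis
    then show ?thesis using determined_refine[OF A'(1), of "m i" J "A i"] assms(2)[OF i] by blast
  qed
  then obtain S' where "\<And>i. i \<in> I \<Longrightarrow> determined (E i) A' m' (S' i)" by metis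
  then show ?thesis using that A' by blast
qed

text \<open>The generating pi-system for the Dynkin arguments below. Cells have finite measure and a
  single label, so the generators of the sigma-algebra belong to it only up to null events.\<close>

definition count_events :: "'x set set set" where
  "count_events = {E \<in> sets P. \<exists>A m S. cells A m \<and> determined E A m S}"

lemma Int_stable_count_events: "Int_stable count_events"
proof (rule Int_stableI)
  fix E E' assume E: "E \<in> count_events" "E' \<in> count_events"
  define F where "F i = (if i then E else E')" for i
  have "\<exists>A m S. cells A m \<and> determined (F i) A m S" for i
    using E by (auto simp: count_events_def F_def)
  then obtain A m S where AmS: "\<And>i. cells (A i) (m i) \<and> determined (F i) (A i) (m i) (S i)" by metis
  obtain A' m' S' where A': "cells A' m'" "\<And>i. determined (F i) A' m' (S' i)"
    using determined_joint[of UNIV A m F S "{}"] AmS by auto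
  have "determined (E \<inter> E') A' m' (S' True \<inter> S' False)"
    unfolding determined_def
  proof (intro conjI allI)
    have 1: "AE \<omega> in P. \<omega> \<in> F i \<longleftrightarrow> counts A' m' \<omega> \<in> S' i"
      and 2: "AE \<omega> in P. insert x \<omega> \<in> F i \<longleftrightarrow> counts A' m' (insert x \<omega>) \<in> S' i" for i x
      using A'(2)[of i] by (auto simp: determined_def)
    show "AE \<omega> in P. \<omega> \<in> E \<inter> E' \<longleftrightarrow> counts A' m' \<omega> \<in> S' True \<inter> S' False"
      using 1[of True] 1[of False] by eventually_elim (auto simp: F_def)
    show "AE \<omega> in P. insert x \<omega> \<in> E \<inter> E' \<longleftrightarrow> counts A' m' (insert x \<omega>) \<in> S' True \<inter> S' False" for x
      using 2[of x True] 2[of x False] by eventually_elim (auto simp: F_def)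
  qed
  then show "E \<inter> E' \<in> count_events"
    using E A'(1) unfolding count_events_def by blast
qed

lemma cells_empty: "cells (\<lambda>_. {}) 0"
  by (simp add: cells_def disjoint_family_on_def)

text \<open>If \<open>B\<close> has infinite measure, it contains infinitely many points almost
  surely, with or without an added one, so the empty set of counts determines the event. Otherwise
  \<open>B\<close> is cut along the labels into finitely many good sets.\<close>

lemma num_points_count_event:
  assumes B: "B \<in> sets M"
  shows "{\<omega> \<in> configurations T. num_points \<omega> B = of_nat k} \<in> count_events" (is "?E \<in> _")
proof -
  have E: "?E \<in> sets P" using sets_num_points[OF B] by (simp add: space_P)
  have ins: "AE \<omega> in P. \<omega> \<in> configurations T" using AE_space[of P] unfolding space_P .
  have "\<exists>A m S. cells A m \<and> determined ?E A m S"
  proof (cases "emeasure M B = \<infinity>")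
    case True
    have inf: "AE \<omega> in P. infinite (\<omega> \<inter> B)" by (rule AE_infinite[OF B True])
    have "determined ?E (\<lambda>_. {}) 0 {}"
      unfolding determined_def
    proof (intro conjI allI)
      show "AE \<omega> in P. \<omega> \<in> ?E \<longleftrightarrow> counts (\<lambda>_. {}) 0 \<omega> \<in> {}"
        using inf by eventually_elim (simp add: num_points_eq_iff)
      show "AE \<omega> in P. insert x \<omega> \<in> ?E \<longleftrightarrow> counts (\<lambda>_. {}) 0 (insert x \<omega>) \<in> {}" for x
        using inf by eventually_elim (auto simp: num_points_eq_iff Int_insert_left)
    qed
    then show ?thesis using cells_empty by blast
  next
    case False
    then have fin: "emeasure M B < \<infinity>" by (simp add: top.not_eq_extremum)
    let ?B = "\<lambda>i. B \<inter> c -` {i}"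
    have good_B: "good (?B i)" for i
      unfolding good_def using B sets_label emeasure_mono[of "?B i" B M] fin
      by (auto intro: order.strict_trans1)
    obtain A m where A: "cells A m" "\<And>X. X \<in> range ?B \<Longrightarrow> \<exists>J\<subseteq>{..<m}. X = (\<Union>j\<in>J. A j)"
      by (rule refine_cells[of "range ?B"]) (use good_B in auto)
    have "\<exists>J. J \<subseteq> {..<m} \<and> ?B i = (\<Union>j\<in>J. A j)" for i by (rule A(2)[OF rangeI])
    then obtain J where J: "\<And>i. J i \<subseteq> {..<m}" "\<And>i. ?B i = (\<Union>j\<in>J i. A j)" by metis
    let ?J = "\<Union>i. J i"
    have J': "?J \<subseteq> {..<m}" using J(1) by blast
    have BJ: "B = (\<Union>j\<in>?J. A j)"
    proof -
      have "B = (\<Union>i. ?B i)" by auto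
      also have "\<dots> = (\<Union>j\<in>?J. A j)" unfolding J(2) by auto
      finally show ?thesis .
    qed
    let ?S = "{l. (\<Sum>j\<in>?J. l j) = k}"
    have iff: "\<omega> \<in> ?E \<longleftrightarrow> counts A m \<omega> \<in> ?S"
      if "\<omega> \<in> configurations T" "\<forall>j<m. finite (\<omega> \<inter> A j)" for \<omega>
    proof -
      have f: "finite (\<omega> \<inter> (\<Union>j\<in>?J. A j))"
        unfolding Int_UN_distrib using that(2) J' by (intro finite_UN_I finite_subset[OF J']) auto
      have "card (\<omega> \<inter> (\<Union>j\<in>?J. A j)) = (\<Sum>j\<in>?J. counts A m \<omega> j)"
        using card_Union_cells[OF A(1) J'] that(2) by blast
      with f show ?thesis unfolding BJ num_points_eq_iff using that(1) by simp
    qed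
    have "determined ?E A m ?S"
      unfolding determined_def
    proof (intro conjI allI)
      show "AE \<omega> in P. \<omega> \<in> ?E \<longleftrightarrow> counts A m \<omega> \<in> ?S"
        using ins AE_finite_cells[OF A(1)] by eventually_elim (rule iff)
      show "AE \<omega> in P. insert x \<omega> \<in> ?E \<longleftrightarrow> counts A m (insert x \<omega>) \<in> ?S" for x
        using ins AE_finite_cells[OF A(1)]
        by eventually_elim (rule iff, auto simp: add_point_config Int_insert_left)
    qed
    with A(1) show ?thesis by (intro exI conjI)
  qed
  with E show ?thesis unfolding count_events_def by simp
qed

lemma sets_P_count_events: "sets P = sigma_sets (configurations T) count_events"
proof
  show "sigma_sets (configurations T) count_events \<subseteq> sets P"
    unfolding space_P[symmetric] by (rule sets.sigma_sets_subset) (auto simp: count_events_def)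
  show "sets P \<subseteq> sigma_sets (configurations T) count_events"
    unfolding sets_P by (rule sigma_sets_mono') (use num_points_count_event in blast)
qed

lemma count_events_closed: "count_events \<subseteq> Pow (configurations T)"
  unfolding count_events_def space_P[symmetric] by (auto dest: sets.sets_into_space)

section \<open>The Mecke identity, from determined events to all nonnegative measurable
  functionals\<close>

lemma emeasure_counts_Pi:
  assumes "cells A m"
  shows "emeasure P (counts A m -` S \<inter> space P) = emeasure (Pi_pmf {..<m} 0 (\<lambda>j. pois (measure M (A j)))) S"
  unfolding distr_counts_cells[OF assms, symmetric]
  by (rule emeasure_distr[symmetric]) (auto intro: measurable_counts_cells assms)

lemma sets_vimage_insert: "E \<in> sets P \<Longrightarrow> insert x -` E \<inter> space P \<in> sets P"
  by (rule measurable_sets[OF measurable_insert])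

lemma mecke_determined:
  assumes E: "E \<in> sets P" and A: "cells A m" and det: "determined E A m S"
    and J: "J \<subseteq> {..<m}"
  shows "(\<lambda>x. emeasure P (insert x -` E \<inter> space P)) \<in> borel_measurable M"
    and "(\<integral>\<^sup>+x. emeasure P (insert x -` E \<inter> space P) * indicator (\<Union>j\<in>J. A j) x \<partial>M) =
      (\<integral>\<^sup>+\<omega>. of_nat (card (\<omega> \<inter> (\<Union>j\<in>J. A j))) * indicator E \<omega> \<partial>P)"
proof -
  note [measurable] = measurable_counts_cells[OF A]
  let ?Q = "Pi_pmf {..<m} 0 (\<lambda>j. pois (measure M (A j)))"
  let ?e = "\<lambda>x. emeasure P (insert x -` E \<inter> space P)"
  have det2: "AE \<omega> in P. insert x \<omega> \<in> E \<longleftrightarrow> counts A m (insert x \<omega>) \<in> S" for x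
    using det by (auto simp: determined_def)
  have sv: "counts A m -` S' \<inter> space P \<in> sets P" for S' by measurable
  have e_in: "?e x = emeasure ?Q (bump j -` S)" if "j < m" "x \<in> A j" for x j
  proof -
    have "?e x = emeasure P (counts A m -` (bump j -` S) \<inter> space P)"
    proof (rule emeasure_eq_AE)
      show "AE \<omega> in P. \<omega> \<in> insert x -` E \<inter> space P \<longleftrightarrow> \<omega> \<in> counts A m -` (bump j -` S) \<inter> space P"
        using det2[of x] AE_finite_cells[OF A] AE_notin[of x]
        by eventually_elim (use that in \<open>simp add: counts_insert_in[OF A]\<close>)
    qed (intro sets_vimage_insert E sv)+
    then show ?thesis by (simp only: emeasure_counts_Pi[OF A])
  qed
  have e_out: "?e x = emeasure ?Q S" if "\<And>j. j < m \<Longrightarrow> x \<notin> A j" for x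
  proof -
    have "?e x = emeasure P (counts A m -` S \<inter> space P)"
    proof (rule emeasure_eq_AE)
      show "AE \<omega> in P. \<omega> \<in> insert x -` E \<inter> space P \<longleftrightarrow> \<omega> \<in> counts A m -` S \<inter> space P"
        using det2[of x] by eventually_elim (simp add: counts_insert_out that)
    qed (intro sets_vimage_insert E sv)+
    then show ?thesis by (simp only: emeasure_counts_Pi[OF A])
  qed
  note dis = cells_disjoint[OF A]
  have ind_sum: "(\<Sum>j\<in>I. f j * indicator (A j) x) = (if \<exists>j\<in>I. x \<in> A j then f (THE j. j \<in> I \<and> x \<in> A j) else 0)"
    if I: "I \<subseteq> {..<m}" for x I and f :: "nat \<Rightarrow> ennreal"
  proof (cases "\<exists>j\<in>I. x \<in> A j")
    case True
    then obtain j where j: "j \<in> I" "x \<in> A j" by blast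
    have the: "(THE j. j \<in> I \<and> x \<in> A j) = j"
      using j I dis by (intro the_equality) blast+
    have "(\<Sum>i\<in>I. f i * indicator (A i) x) = (\<Sum>i\<in>I. if i = j then f j else 0)"
    proof (intro sum.cong refl)
      fix i assume "i \<in> I"
      then have "x \<notin> A i" if "i \<noteq> j" using that j I dis[of i j x] by blast
      then show "f i * indicator (A i) x = (if i = j then f j else 0)" using j by auto
    qed
    also have "\<dots> = f j" using j finite_subset[OF I] by simp
    finally show ?thesis using True the by simp
  qed (auto intro!: sum.neutral)
  \<comment> \<open>The probability is constant on each cell and outside all of them, hence a simple
    function of \<open>x\<close>; this gives measurability.\<close>
  have e_eq: "?e x = (\<Sum>j<m. emeasure ?Q (bump j -` S) * indicator (A j) x) +
      emeasure ?Q S * indicator (space M - (\<Union>j<m. A j)) x" for x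
  proof (cases "\<exists>j<m. x \<in> A j")
    case True
    then obtain j where j: "j < m" "x \<in> A j" by blast
    have the: "(THE j. j \<in> {..<m} \<and> x \<in> A j) = j"
      using j dis by (intro the_equality) auto
    show ?thesis using j the by (subst ind_sum) (auto simp: e_in split: split_indicator)
  next
    case False
    then show ?thesis by (subst ind_sum) (auto simp: e_out space_M)
  qed
  have Am[measurable]: "A j \<in> sets M" if "j < m" for j using cells_finite[OF A that] by simp
  have U[measurable]: "(\<Union>j<m. A j) \<in> sets M" using Am by auto
  show "?e \<in> borel_measurable M"
    unfolding e_eq using Am U
    by (intro borel_measurable_add borel_measurable_sum borel_measurable_times borel_measurable_const
        borel_measurable_indicator sets.compl_sets) auto
  have fJ: "finite J" using J by (rule finite_subset) simp
  have "(\<integral>\<^sup>+x. ?e x * indicator (\<Union>j\<in>J. A j) x \<partial>M) =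
      (\<integral>\<^sup>+x. (\<Sum>j\<in>J. emeasure ?Q (bump j -` S) * indicator (A j) x) \<partial>M)"
  proof (intro nn_integral_cong)
    fix x
    show "?e x * indicator (\<Union>j\<in>J. A j) x = (\<Sum>j\<in>J. emeasure ?Q (bump j -` S) * indicator (A j) x)"
    proof (cases "\<exists>j\<in>J. x \<in> A j")
      case True
      then obtain j where j: "j \<in> J" "x \<in> A j" by blast
      have "(THE j. j \<in> J \<and> x \<in> A j) = j"
        using j J dis by (intro the_equality) blast+
      then show ?thesis using j J e_in[of j x] by (subst ind_sum[OF J]) (auto split: split_indicator)
    qed (subst ind_sum[OF J], auto)
  qed
  also have "\<dots> = (\<Sum>j\<in>J. emeasure ?Q (bump j -` S) * emeasure M (A j))"
  proof (subst nn_integral_sum)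
    fix j assume "j \<in> J"
    then have m: "A j \<in> sets M" using Am J by blast
    then show "(\<lambda>x. emeasure ?Q (bump j -` S) * indicator (A j) x) \<in> borel_measurable M" by simp
  next
    show "(\<Sum>j\<in>J. \<integral>\<^sup>+x. emeasure ?Q (bump j -` S) * indicator (A j) x \<partial>M) =
        (\<Sum>j\<in>J. emeasure ?Q (bump j -` S) * emeasure M (A j))"
      using Am J by (intro sum.cong refl nn_integral_cmult_indicator) blast
  qed
  also have "\<dots> = (\<Sum>j\<in>J. \<integral>\<^sup>+k. of_nat (k j) * indicator S k \<partial>?Q)"
  proof (intro sum.cong refl)
    fix j assume "j \<in> J"
    then have j: "j < m" using J by auto
    have "emeasure M (A j) = ennreal (measure M (A j))"
      using cells_finite[OF A j] by (intro emeasure_eq_ennreal_measure) auto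
    then show "emeasure ?Q (bump j -` S) * emeasure M (A j) = (\<integral>\<^sup>+k. of_nat (k j) * indicator S k \<partial>?Q)"
      using nn_integral_Pi_pois_bump[OF j, of "\<lambda>j. measure M (A j)" S] by (simp add: mult.commute)
  qed
  also have "\<dots> = (\<integral>\<^sup>+k. (\<Sum>j\<in>J. of_nat (k j)) * indicator S k \<partial>?Q)"
    by (subst nn_integral_sum[symmetric]) (auto simp: sum_distrib_right)
  also have "\<dots> = (\<integral>\<^sup>+\<omega>. (\<Sum>j\<in>J. of_nat (counts A m \<omega> j)) * indicator S (counts A m \<omega>) \<partial>P)"
    unfolding distr_counts_cells[OF A, symmetric] by (rule nn_integral_distr) auto
  also have "\<dots> = (\<integral>\<^sup>+\<omega>. of_nat (card (\<omega> \<inter> (\<Union>j\<in>J. A j))) * indicator E \<omega> \<partial>P)"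
  proof (rule nn_integral_cong_AE)
    have "AE \<omega> in P. \<omega> \<in> E \<longleftrightarrow> counts A m \<omega> \<in> S" using det by (auto simp: determined_def)
    then show "AE \<omega> in P. (\<Sum>j\<in>J. of_nat (counts A m \<omega> j)) * indicator S (counts A m \<omega>) =
        (of_nat (card (\<omega> \<inter> (\<Union>j\<in>J. A j))) * indicator E \<omega> :: ennreal)"
      using AE_finite_cells[OF A]
    proof eventually_elim
      case (elim \<omega>)
      then show ?case using card_Union_cells[OF A J, of \<omega>] by (auto split: split_indicator)
    qed
  qed
  finally show "(\<integral>\<^sup>+x. ?e x * indicator (\<Union>j\<in>J. A j) x \<partial>M) =
      (\<integral>\<^sup>+\<omega>. of_nat (card (\<omega> \<inter> (\<Union>j\<in>J. A j))) * indicator E \<omega> \<partial>P)" .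
qed


text \<open>By the Mecke formula this is the Palm distribution of the Poisson measure at
  \<open>x\<close>.\<close>

definition add_point :: "'x \<Rightarrow> 'x set measure" where
  "add_point x = distr P P (insert x)"

lemma sets_add_point [simp]: "sets (add_point x) = sets P" "space (add_point x) = space P"
  by (auto simp: add_point_def)

lemma emeasure_add_point: "E \<in> sets P \<Longrightarrow> emeasure (add_point x) E = emeasure P (insert x -` E \<inter> space P)"
  unfolding add_point_def by (rule emeasure_distr[OF measurable_insert])

lemma nn_integral_add_point:
  "F \<in> borel_measurable P \<Longrightarrow> (\<integral>\<^sup>+\<omega>. F \<omega> \<partial>add_point x) = (\<integral>\<^sup>+\<omega>. F (insert x \<omega>) \<partial>P)"
  unfolding add_point_def by (rule nn_integral_distr[OF measurable_insert]) simp

lemma emeasure_add_point_space: "emeasure (add_point x) (space P) = 1"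
proof -
  have "insert x -` space P \<inter> space P = space P"
    using measurable_space[OF measurable_insert] by auto
  then show ?thesis by (simp add: emeasure_add_point emeasure_space_1)
qed

lemma mecke_count_event:
  assumes B: "good B" and E: "E \<in> count_events"
  shows "(\<lambda>x. emeasure (add_point x) E) \<in> borel_measurable M \<and>
    (\<integral>\<^sup>+x. emeasure (add_point x) E * indicator B x \<partial>M) =
    (\<integral>\<^sup>+\<omega>. of_nat (card (\<omega> \<inter> B)) * indicator E \<omega> \<partial>P)"
proof -
  have EP: "E \<in> sets P" using E by (simp add: count_events_def)
  obtain A m S where AmS: "cells A m \<and> determined E A m S"
    using E by (auto simp: count_events_def)
  obtain A' m' S' where A': "cells A' m'" "\<And>i. i \<in> {()} \<Longrightarrow> determined E A' m' (S' i)"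
    "\<And>C. C \<in> {B} \<Longrightarrow> \<exists>J\<subseteq>{..<m'}. C = (\<Union>j\<in>J. A' j)"
    using AmS B by (elim determined_joint[of "{()}" "\<lambda>_. A" "\<lambda>_. m" "\<lambda>_. E" "\<lambda>_. S" "{B}", rotated -1]) auto
  obtain J where J: "J \<subseteq> {..<m'}" "B = (\<Union>j\<in>J. A' j)" using A'(3)[of B] by auto
  show ?thesis
    using mecke_determined[OF EP A'(1) A'(2)[of "()"] J(1)] unfolding J(2)
    by (simp add: emeasure_add_point[OF EP])
qed

lemma space_count_event: "space P \<in> count_events"
proof -
  have "determined (space P) (\<lambda>_. {}) 0 UNIV"
    unfolding determined_def
  proof (intro conjI allI)
    show "AE \<omega> in P. \<omega> \<in> space P \<longleftrightarrow> counts (\<lambda>_. {}) 0 \<omega> \<in> UNIV"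
      using AE_space[of P] by eventually_elim simp
    show "AE \<omega> in P. insert x \<omega> \<in> space P \<longleftrightarrow> counts (\<lambda>_. {}) 0 (insert x \<omega>) \<in> UNIV" for x
      using AE_space[of P] by eventually_elim (simp add: space_P add_point_config)
  qed
  then show ?thesis unfolding count_events_def using cells_empty by blast
qed

lemma expected_count:
  assumes B: "good B"
  shows "(\<integral>\<^sup>+\<omega>. of_nat (card (\<omega> \<inter> B)) \<partial>P) = emeasure M B"
proof -
  have "(\<integral>\<^sup>+\<omega>. of_nat (card (\<omega> \<inter> B)) \<partial>P) = (\<integral>\<^sup>+\<omega>. of_nat (card (\<omega> \<inter> B)) * indicator (space P) \<omega> \<partial>P)"
    by (rule nn_integral_cong) simp
  also have "\<dots> = (\<integral>\<^sup>+x. emeasure (add_point x) (space P) * indicator B x \<partial>M)"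
    using mecke_count_event[OF B space_count_event] by simp
  also have "\<dots> = emeasure M B"
    using goodD(1)[OF B] by (simp add: emeasure_add_point_space)
  finally show ?thesis .
qed

lemma measurable_card_ennreal:
  "B \<in> sets M \<Longrightarrow> (\<lambda>\<omega>. of_nat (card (\<omega> \<inter> B)) :: ennreal) \<in> borel_measurable P"
  by (rule measurable_compose[OF measurable_card]) auto

text \<open>A Dynkin argument over the count events. For complements the identity is subtracted from
  \<open>expected_count\<close>, its case for the whole space; the subtraction is legitimate because
  \<open>B\<close> has finite measure.\<close>

lemma mecke_event:
  assumes B: "good B" and E: "E \<in> sets P"
  shows "(\<lambda>x. emeasure (add_point x) E) \<in> borel_measurable M \<and>
    (\<integral>\<^sup>+x. emeasure (add_point x) E * indicator B x \<partial>M) =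
    (\<integral>\<^sup>+\<omega>. of_nat (card (\<omega> \<inter> B)) * indicator E \<omega> \<partial>P)"
  using Int_stable_count_events count_events_closed E[unfolded sets_P_count_events]
proof (induction rule: sigma_sets_induct_disjoint)
  case (basic E)
  then show ?case by (rule mecke_count_event[OF B])
next
  case empty
  show ?case by simp
next
  case (compl E)
  note [measurable] = measurable_card_ennreal[OF goodD(1)[OF B]] goodD(1)[OF B]
  have E[measurable]: "E \<in> sets P" using compl(1) by (simp add: sets_P_count_events)
  have m[measurable]: "(\<lambda>x. emeasure (add_point x) E) \<in> borel_measurable M" using compl(2) by simp
  have eq: "emeasure (add_point x) (configurations T - E) = 1 - emeasure (add_point x) E" for x
    using emeasure_compl[of E "add_point x"] E emeasure_add_point_space[of x]
    by (simp add: space_P[symmetric] emeasure_add_point emeasure_eq_measure)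
  have le1: "emeasure (add_point x) E \<le> 1" for x
    by (simp add: emeasure_add_point[OF E] emeasure_eq_measure)
  let ?a = "\<integral>\<^sup>+x. emeasure (add_point x) E * indicator B x \<partial>M"
  have m': "(\<lambda>x. 1 - emeasure (add_point x) E) \<in> borel_measurable M" by measurable
  have "(\<integral>\<^sup>+x. (1 - emeasure (add_point x) E) * indicator B x \<partial>M) + ?a =
      (\<integral>\<^sup>+x. (1 - emeasure (add_point x) E) * indicator B x + emeasure (add_point x) E * indicator B x \<partial>M)"
    using m' by (intro nn_integral_add[symmetric]) auto
  also have "\<dots> = (\<integral>\<^sup>+x. indicator B x \<partial>M)"
    using le1 by (intro nn_integral_cong) (auto split: split_indicator simp: diff_add_cancel_ennreal)
  also have "\<dots> = emeasure M B" by simp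
  finally have 1: "(\<integral>\<^sup>+x. (1 - emeasure (add_point x) E) * indicator B x \<partial>M) + ?a = emeasure M B" .
  have "(\<integral>\<^sup>+\<omega>. of_nat (card (\<omega> \<inter> B)) * indicator (configurations T - E) \<omega> \<partial>P) +
      (\<integral>\<^sup>+\<omega>. of_nat (card (\<omega> \<inter> B)) * indicator E \<omega> \<partial>P) =
      (\<integral>\<^sup>+\<omega>. of_nat (card (\<omega> \<inter> B)) * indicator (configurations T - E) \<omega> + of_nat (card (\<omega> \<inter> B)) * indicator E \<omega> \<partial>P)"
    unfolding space_P[symmetric] by (intro nn_integral_add[symmetric]) measurable
  also have "\<dots> = (\<integral>\<^sup>+\<omega>. of_nat (card (\<omega> \<inter> B)) \<partial>P)"
    by (intro nn_integral_cong) (auto simp: space_P split: split_indicator)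
  also have "\<dots> = emeasure M B" by (rule expected_count[OF B])
  finally have 2: "(\<integral>\<^sup>+\<omega>. of_nat (card (\<omega> \<inter> B)) * indicator (configurations T - E) \<omega> \<partial>P) + ?a = emeasure M B"
    using compl(2) by simp
  have "?a \<le> emeasure M B" using 1 by (metis add.commute le_iff_add)
  then have fin: "?a \<noteq> \<top>" using goodD(2)[OF B] by (auto simp: top_unique)
  show ?case
    unfolding eq
  proof
    show "(\<integral>\<^sup>+x. (1 - emeasure (add_point x) E) * indicator B x \<partial>M) =
        (\<integral>\<^sup>+\<omega>. of_nat (card (\<omega> \<inter> B)) * indicator (configurations T - E) \<omega> \<partial>P)"
      using ennreal_add_diff_cancel_right[OF fin] 1 2 by metis
  qed (rule m')
next
  case (union E)
  have E: "E i \<in> sets P" for i using union(2) by (auto simp: sets_P_count_events)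
  have IH: "(\<lambda>x. emeasure (add_point x) (E i)) \<in> borel_measurable M"
    "(\<integral>\<^sup>+x. emeasure (add_point x) (E i) * indicator B x \<partial>M) =
      (\<integral>\<^sup>+\<omega>. of_nat (card (\<omega> \<inter> B)) * indicator (E i) \<omega> \<partial>P)" for i
    using union(3)[of i] by auto
  have eq: "emeasure (add_point x) (\<Union>i. E i) = (\<Sum>i. emeasure (add_point x) (E i))" for x
    using E union(1) by (intro suminf_emeasure[symmetric]) auto
  have ind: "indicator (\<Union>i. E i) \<omega> = (\<Sum>i. indicator (E i) \<omega> :: ennreal)" for \<omega>
    by (rule suminf_indicator[OF union(1), symmetric])
  have mB: "(indicator B :: 'x \<Rightarrow> ennreal) \<in> borel_measurable M"
    using goodD(1)[OF B] by simp
  have "(\<integral>\<^sup>+x. emeasure (add_point x) (\<Union>i. E i) * indicator B x \<partial>M) =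
      (\<integral>\<^sup>+x. (\<Sum>i. emeasure (add_point x) (E i) * indicator B x) \<partial>M)"
    unfolding eq by (simp add: ennreal_suminf_multc)
  also have "\<dots> = (\<Sum>i. \<integral>\<^sup>+x. emeasure (add_point x) (E i) * indicator B x \<partial>M)"
    by (rule nn_integral_suminf) (rule borel_measurable_times_ennreal[OF IH(1) mB])
  also have "\<dots> = (\<Sum>i. \<integral>\<^sup>+\<omega>. of_nat (card (\<omega> \<inter> B)) * indicator (E i) \<omega> \<partial>P)" by (simp add: IH)
  also have "\<dots> = (\<integral>\<^sup>+\<omega>. (\<Sum>i. of_nat (card (\<omega> \<inter> B)) * indicator (E i) \<omega>) \<partial>P)"
    using measurable_card_ennreal[OF goodD(1)[OF B]] E by (intro nn_integral_suminf[symmetric]) auto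
  also have "\<dots> = (\<integral>\<^sup>+\<omega>. of_nat (card (\<omega> \<inter> B)) * indicator (\<Union>i. E i) \<omega> \<partial>P)"
    unfolding ind by simp
  finally show ?case unfolding eq using IH(1) by (auto intro!: borel_measurable_suminf)
qed

lemma mecke:
  assumes B: "good B" and F: "F \<in> borel_measurable P"
  shows "(\<lambda>x. \<integral>\<^sup>+\<omega>. F \<omega> \<partial>add_point x) \<in> borel_measurable M \<and>
    (\<integral>\<^sup>+x. (\<integral>\<^sup>+\<omega>. F \<omega> \<partial>add_point x) * indicator B x \<partial>M) =
    (\<integral>\<^sup>+\<omega>. of_nat (card (\<omega> \<inter> B)) * F \<omega> \<partial>P)"
  using F
proof (induct rule: borel_measurable_induct)
  case (cong f g)
  have "(\<integral>\<^sup>+\<omega>. f \<omega> \<partial>add_point x) = (\<integral>\<^sup>+\<omega>. g \<omega> \<partial>add_point x)" for x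
    using cong by (intro nn_integral_cong) auto
  moreover have "(\<integral>\<^sup>+\<omega>. of_nat (card (\<omega> \<inter> B)) * f \<omega> \<partial>P) = (\<integral>\<^sup>+\<omega>. of_nat (card (\<omega> \<inter> B)) * g \<omega> \<partial>P)"
    using cong by (intro nn_integral_cong) auto
  ultimately show ?case using cong by simp
next
  case (set E)
  then have "(\<integral>\<^sup>+\<omega>. indicator E \<omega> \<partial>add_point x) = emeasure (add_point x) E" for x
    by simp
  then show ?case using mecke_event[OF B set] by simp
next
  case (mult u a)
  note [measurable] = measurable_card_ennreal[OF goodD(1)[OF B]] goodD(1)[OF B] mult(2)
  have [measurable]: "(\<lambda>x. \<integral>\<^sup>+\<omega>. u \<omega> \<partial>add_point x) \<in> borel_measurable M" using mult by simp
  have u: "u \<in> borel_measurable (add_point x)" for x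
    using mult(2) by (simp cong: measurable_cong_sets)
  have "(\<integral>\<^sup>+x. (\<integral>\<^sup>+\<omega>. a * u \<omega> \<partial>add_point x) * indicator B x \<partial>M) =
      a * (\<integral>\<^sup>+x. (\<integral>\<^sup>+\<omega>. u \<omega> \<partial>add_point x) * indicator B x \<partial>M)"
    by (subst nn_integral_cmult[symmetric]) (auto simp: nn_integral_cmult u mult.assoc)
  also have "\<dots> = (\<integral>\<^sup>+\<omega>. of_nat (card (\<omega> \<inter> B)) * (a * u \<omega>) \<partial>P)"
    using mult by (simp add: nn_integral_cmult[symmetric] mult_ac)
  finally show ?case by (simp add: nn_integral_cmult u)
next
  case (add u v)
  note [measurable] = measurable_card_ennreal[OF goodD(1)[OF B]] goodD(1)[OF B] add(1,4)
  have [measurable]: "(\<lambda>x. \<integral>\<^sup>+\<omega>. u \<omega> \<partial>add_point x) \<in> borel_measurable M"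
    "(\<lambda>x. \<integral>\<^sup>+\<omega>. v \<omega> \<partial>add_point x) \<in> borel_measurable M" using add by simp_all
  have uv: "u \<in> borel_measurable (add_point x)" "v \<in> borel_measurable (add_point x)" for x
    using add(1,4) by (simp_all cong: measurable_cong_sets)
  have eq: "(\<integral>\<^sup>+\<omega>. v \<omega> + u \<omega> \<partial>add_point x) = (\<integral>\<^sup>+\<omega>. v \<omega> \<partial>add_point x) + (\<integral>\<^sup>+\<omega>. u \<omega> \<partial>add_point x)" for x
    by (rule nn_integral_add) (rule uv)+
  have "(\<integral>\<^sup>+x. (\<integral>\<^sup>+\<omega>. v \<omega> + u \<omega> \<partial>add_point x) * indicator B x \<partial>M) =
      (\<integral>\<^sup>+x. (\<integral>\<^sup>+\<omega>. v \<omega> \<partial>add_point x) * indicator B x \<partial>M) + (\<integral>\<^sup>+x. (\<integral>\<^sup>+\<omega>. u \<omega> \<partial>add_point x) * indicator B x \<partial>M)"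
    unfolding eq distrib_right by (rule nn_integral_add) measurable
  also have "\<dots> = (\<integral>\<^sup>+\<omega>. of_nat (card (\<omega> \<inter> B)) * v \<omega> + of_nat (card (\<omega> \<inter> B)) * u \<omega> \<partial>P)"
    using add by (subst nn_integral_add) auto
  finally show ?case by (simp add: eq distrib_left)
next
  case (seq U)
  note card = measurable_card_ennreal[OF goodD(1)[OF B]]
  have U: "U i \<in> borel_measurable (add_point x)" for i x
    using seq(1)[of i] by (simp cong: measurable_cong_sets)
  have IH: "(\<lambda>x. \<integral>\<^sup>+\<omega>. U i \<omega> \<partial>add_point x) \<in> borel_measurable M"
    "(\<integral>\<^sup>+x. (\<integral>\<^sup>+\<omega>. U i \<omega> \<partial>add_point x) * indicator B x \<partial>M) =
     (\<integral>\<^sup>+\<omega>. of_nat (card (\<omega> \<inter> B)) * U i \<omega> \<partial>P)" for i using seq(3)[of i] by auto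
  have eq: "(\<integral>\<^sup>+\<omega>. (SUP i. U i) \<omega> \<partial>add_point x) = (SUP i. \<integral>\<^sup>+\<omega>. U i \<omega> \<partial>add_point x)" for x
    unfolding SUP_apply by (rule nn_integral_monotone_convergence_SUP[OF seq(4) U])
  have mono: "incseq (\<lambda>i. \<integral>\<^sup>+\<omega>. U i \<omega> \<partial>add_point x)" for x
    using seq(4) by (auto simp: incseq_def le_fun_def intro!: nn_integral_mono)
  have "(\<integral>\<^sup>+x. (\<integral>\<^sup>+\<omega>. (SUP i. U i) \<omega> \<partial>add_point x) * indicator B x \<partial>M) =
      (\<integral>\<^sup>+x. (SUP i. (\<integral>\<^sup>+\<omega>. U i \<omega> \<partial>add_point x) * indicator B x) \<partial>M)"
    unfolding eq by (simp add: SUP_mult_right_ennreal)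
  also have "\<dots> = (SUP i. \<integral>\<^sup>+x. (\<integral>\<^sup>+\<omega>. U i \<omega> \<partial>add_point x) * indicator B x \<partial>M)"
    using mono goodD(1)[OF B] IH(1)
    by (intro nn_integral_monotone_convergence_SUP)
      (auto simp: incseq_def le_fun_def intro!: mult_right_mono)
  also have "\<dots> = (SUP i. \<integral>\<^sup>+\<omega>. of_nat (card (\<omega> \<inter> B)) * U i \<omega> \<partial>P)" by (simp add: IH)
  also have "\<dots> = (\<integral>\<^sup>+\<omega>. (SUP i. of_nat (card (\<omega> \<inter> B)) * U i \<omega>) \<partial>P)"
    using seq(1,4) card
    by (intro nn_integral_monotone_convergence_SUP[symmetric])
      (auto simp: incseq_def le_fun_def intro!: mult_left_mono)
  also have "\<dots> = (\<integral>\<^sup>+\<omega>. of_nat (card (\<omega> \<inter> B)) * (SUP i. U i) \<omega> \<partial>P)"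
    by (simp add: SUP_mult_left_ennreal image_image)
  finally show ?case unfolding eq using IH(1) by auto
qed

section \<open>Conditional expectations given the counts, and their increments\<close>

text \<open>The value is 0 if the counts \<open>k\<close> have probability zero.\<close>

definition cond_exp_counts :: "(nat \<Rightarrow> 'x set) \<Rightarrow> nat \<Rightarrow> ('x set \<Rightarrow> real) \<Rightarrow> (nat \<Rightarrow> nat) \<Rightarrow> real" where
  "cond_exp_counts A m F k =
     (\<integral>\<omega>. F \<omega> * indicator (counts A m -` {k} \<inter> space P) \<omega> \<partial>P) / prob (counts A m -` {k} \<inter> space P)"

lemma sets_counts: "cells A m \<Longrightarrow> counts A m -` S \<inter> space P \<in> sets P"
  using measurable_sets[OF measurable_counts_cells, of A m S] by simp

lemma prob_counts_pmf:
  "cells A m \<Longrightarrow> prob (counts A m -` {k} \<inter> space P) = pmf (Pi_pmf {..<m} 0 (\<lambda>j. pois (measure M (A j)))) k"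
  using emeasure_counts_Pi[of A m "{k}"]
  by (simp add: emeasure_eq_measure emeasure_pmf_single)

lemma prob_counts_bump:
  assumes "cells A m" "j < m"
  shows "real (Suc (k j)) * prob (counts A m -` {bump j k} \<inter> space P) =
    measure M (A j) * prob (counts A m -` {k} \<inter> space P)"
  unfolding prob_counts_pmf[OF assms(1)] by (rule pmf_Pi_pois_bump[OF assms(2)]) simp

lemma bump_inject: "bump j k = bump j l \<longleftrightarrow> k = l"
proof
  assume "bump j k = bump j l"
  then have "bump j k i = bump j l i" for i by simp
  note eq = this
  show "k = l"
  proof
    fix i
    show "k i = l i" using eq[of i] by (cases "i = j") (simp_all add: bump_same bump_other)
  qed
qed auto

text \<open>The Mecke formula is applied to \<open>F\<close> restricted to the counts
  \<open>bump j k\<close>. There the number of points in \<open>A j\<close> is the constant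
  \<open>Suc (k j)\<close>, while adding \<open>x\<close> in \<open>A j\<close> reaches these counts
  exactly from the counts \<open>k\<close>. After normalization by \<open>pp'\<close>, the value at
  \<open>bump j k\<close> is the mean of \<open>F (insert x \<omega>)\<close> over \<open>x\<close>
  in \<open>A j\<close> and over the counts \<open>k\<close>, so it differs from the value at
  \<open>k\<close> by at most the mean of \<open>b\<close> over the cell. Multiplication by the
  measure of the cell covers cells of measure zero.\<close>

lemma cond_exp_counts_increment:
  assumes A: "cells A m" and j: "j < m" and F: "F \<in> borel_measurable P" and R: "\<And>\<omega>. \<bar>F \<omega>\<bar> \<le> R"
    and b: "b \<in> borel_measurable M" "\<And>x. 0 \<le> b x"
    and inc: "AE x in M. x \<in> A j \<longrightarrow> (AE \<omega> in P. \<bar>F (insert x \<omega>) - F \<omega>\<bar> \<le> b x)"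
    and B: "(\<integral>\<^sup>+x. ennreal (b x) * indicator (A j) x \<partial>M) \<le> ennreal B" "0 \<le> B"
  shows "measure M (A j) * \<bar>cond_exp_counts A m F (bump j k) - cond_exp_counts A m F k\<bar> \<le> B"
proof -
  define E where "E k = counts A m -` {k} \<inter> space P" for k
  have E[measurable]: "E k \<in> sets P" for k unfolding E_def by (rule sets_counts[OF A])
  define p where "p = prob (E k)"
  define p' where "p' = prob (E (bump j k))"
  define l where "l = measure M (A j)"
  have pp': "real (Suc (k j)) * p' = l * p"
    unfolding p_def p'_def l_def E_def by (rule prob_counts_bump[OF A j])
  show ?thesis
  proof (cases "p = 0 \<or> l = 0")
    \<comment> \<open>By size-biasing \<open>p'\<close> vanishes as well. If \<open>p = 0\<close>,
      both conditional expectations have denominator 0 and are 0 by default; if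
      \<open>l = 0\<close>, the factor in front vanishes.\<close>
    case True
    then have "p' = 0" using pp' by auto
    then show ?thesis using True B
      by (auto simp: cond_exp_counts_def p_def[symmetric] p'_def[symmetric] E_def[symmetric] l_def[symmetric])
  next
    case False
    then have p: "0 < p" and l: "0 < l" by (auto simp: p_def l_def less_le)
    have p': "0 < p'" using pp' p l by (metis mult_pos_pos of_nat_0_less_iff zero_less_Suc zero_less_mult_pos)
    \<comment> \<open>The shift by \<open>R\<close> makes the integrand nonnegative, as the Mecke
      formula requires. It adds the same constant to both conditional expectations and cancels in
      their difference.\<close>
    define G where "G \<omega> = F \<omega> + R" for \<omega>
    have G[measurable]: "G \<in> borel_measurable P" unfolding G_def using F by auto
    have G0: "0 \<le> G \<omega>" "G \<omega> \<le> 2 * R" for \<omega> using R[of \<omega>] by (auto simp: G_def)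
    have R0: "0 \<le> R" using R[of "{}"] by simp
    define I where "I k = (\<integral>\<omega>. G \<omega> * indicator (E k) \<omega> \<partial>P)" for k
    have int: "integrable P (\<lambda>\<omega>. G \<omega> * indicator (E k) \<omega>)" for k
      by (rule integrable_const_bound[where B="2 * R"]) (use G0 R0 in \<open>auto split: split_indicator\<close>)
    have I0: "0 \<le> I k" for k
      unfolding I_def by (rule Bochner_Integration.integral_nonneg) (simp add: G0)
    have nnI: "(\<integral>\<^sup>+\<omega>. ennreal (G \<omega>) * indicator (E k) \<omega> \<partial>P) = ennreal (I k)" for k
    proof -
      have "(\<integral>\<^sup>+\<omega>. ennreal (G \<omega>) * indicator (E k) \<omega> \<partial>P) = (\<integral>\<^sup>+\<omega>. ennreal (G \<omega> * indicator (E k) \<omega>) \<partial>P)"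
        by (rule nn_integral_cong) (auto split: split_indicator)
      also have "\<dots> = ennreal (I k)"
        unfolding I_def by (rule nn_integral_eq_integral[OF int]) (simp add: G0)
      finally show ?thesis .
    qed
    have IF: "I k = (\<integral>\<omega>. F \<omega> * indicator (E k) \<omega> \<partial>P) + R * prob (E k)" for k
    proof -
      have intF: "integrable P (\<lambda>\<omega>. F \<omega> * indicator (E k) \<omega>)"
        by (rule integrable_const_bound[where B="R"])
          (use R R0 F in \<open>auto split: split_indicator\<close>)
      have intE: "integrable P (indicator (E k) :: _ \<Rightarrow> real)"
        by (rule integrable_const_bound[where B=1]) (auto split: split_indicator)
      have "I k = (\<integral>\<omega>. F \<omega> * indicator (E k) \<omega> + R * indicator (E k) \<omega> \<partial>P)"
        unfolding I_def G_def by (simp add: distrib_right)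
      also have "\<dots> = (\<integral>\<omega>. F \<omega> * indicator (E k) \<omega> \<partial>P) + R * prob (E k)"
        using intF intE by (subst Bochner_Integration.integral_add) auto
      finally show ?thesis .
    qed
    define H where "H \<omega> = ennreal (G \<omega>) * indicator (E (bump j k)) \<omega>" for \<omega>
    have H[measurable]: "H \<in> borel_measurable P" unfolding H_def by measurable
    have good: "good (A j)" using A j by (simp add: cells_def)
    have [measurable]: "A j \<in> sets M" by (rule goodD(1)[OF good])
    have eM: "emeasure M (A j) = ennreal l"
      using goodD(2)[OF good] unfolding l_def by (intro emeasure_eq_ennreal_measure) auto
    let ?h = "\<lambda>x. \<integral>\<^sup>+\<omega>. H \<omega> \<partial>add_point x"
    have hm[measurable]: "?h \<in> borel_measurable M" using mecke[OF good H] by simp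
    have LHS: "(\<integral>\<^sup>+x. ?h x * indicator (A j) x \<partial>M) = ennreal (real (Suc (k j)) * I (bump j k))"
    proof -
      have "(\<integral>\<^sup>+x. ?h x * indicator (A j) x \<partial>M) = (\<integral>\<^sup>+\<omega>. of_nat (card (\<omega> \<inter> A j)) * H \<omega> \<partial>P)"
        using mecke[OF good H] by simp
      also have "\<dots> = (\<integral>\<^sup>+\<omega>. of_nat (Suc (k j)) * (ennreal (G \<omega>) * indicator (E (bump j k)) \<omega>) \<partial>P)"
      proof (rule nn_integral_cong)
        fix \<omega>
        have "card (\<omega> \<inter> A j) = Suc (k j)" if "\<omega> \<in> E (bump j k)"
          using that j by (auto simp: E_def counts_eq_iff bump_same)
        then show "of_nat (card (\<omega> \<inter> A j)) * H \<omega> = of_nat (Suc (k j)) * (ennreal (G \<omega>) * indicator (E (bump j k)) \<omega>)"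
          by (auto simp: H_def split: split_indicator)
      qed
      also have "\<dots> = of_nat (Suc (k j)) * ennreal (I (bump j k))"
        by (subst nn_integral_cmult) (auto simp: nnI)
      also have "\<dots> = ennreal (real (Suc (k j)) * I (bump j k))"
        using I0 by (simp only: ennreal_of_nat_eq_real_of_nat ennreal_mult[OF of_nat_0_le_iff I0])
      finally show ?thesis .
    qed
    have ins: "AE \<omega> in P. insert x \<omega> \<in> E (bump j k) \<longleftrightarrow> \<omega> \<in> E k" if x: "x \<in> A j" for x
      using AE_notin[of x] AE_finite_cells[OF A] AE_space[of P]
    proof eventually_elim
      case (elim \<omega>)
      then have "counts A m (insert x \<omega>) = bump j (counts A m \<omega>)" by (intro counts_insert_in[OF A j x])
      then show ?case using elim measurable_space[OF measurable_insert] by (auto simp: E_def bump_inject)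
    qed
    have nnp: "(\<integral>\<^sup>+\<omega>. ennreal a * indicator (E k) \<omega> \<partial>P) = ennreal a * ennreal p" for a
      by (subst nn_integral_cmult_indicator) (auto simp: p_def emeasure_eq_measure)
    have up: "?h x \<le> ennreal (I k) + ennreal (b x) * ennreal p"
      if x: "x \<in> A j" and inc: "AE \<omega> in P. \<bar>F (insert x \<omega>) - F \<omega>\<bar> \<le> b x" for x
    proof -
      have "?h x = (\<integral>\<^sup>+\<omega>. H (insert x \<omega>) \<partial>P)" by (rule nn_integral_add_point[OF H])
      also have "\<dots> \<le> (\<integral>\<^sup>+\<omega>. ennreal (G \<omega>) * indicator (E k) \<omega> + ennreal (b x) * indicator (E k) \<omega> \<partial>P)"
      proof (rule nn_integral_mono_AE)
        show "AE \<omega> in P. H (insert x \<omega>) \<le> ennreal (G \<omega>) * indicator (E k) \<omega> + ennreal (b x) * indicator (E k) \<omega>"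
          using ins[OF x] inc
        proof eventually_elim
          case (elim \<omega>)
          then show ?case
            by (auto simp: H_def G_def G0[unfolded G_def] b ennreal_plus[symmetric] simp del: ennreal_plus split: split_indicator intro!: ennreal_leI)
        qed
      qed
      also have "\<dots> = ennreal (I k) + ennreal (b x) * ennreal p"
        by (subst nn_integral_add) (auto simp: nnI nnp)
      finally show ?thesis .
    qed
    have lo: "ennreal (I k) \<le> ?h x + ennreal (b x) * ennreal p"
      if x: "x \<in> A j" and inc: "AE \<omega> in P. \<bar>F (insert x \<omega>) - F \<omega>\<bar> \<le> b x" for x
    proof -
      have [measurable]: "(\<lambda>\<omega>. H (insert x \<omega>)) \<in> borel_measurable P"
        by (rule measurable_compose[OF measurable_insert H])
      have "ennreal (I k) = (\<integral>\<^sup>+\<omega>. ennreal (G \<omega>) * indicator (E k) \<omega> \<partial>P)" by (rule nnI[symmetric])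
      also have "\<dots> \<le> (\<integral>\<^sup>+\<omega>. H (insert x \<omega>) + ennreal (b x) * indicator (E k) \<omega> \<partial>P)"
      proof (rule nn_integral_mono_AE)
        show "AE \<omega> in P. ennreal (G \<omega>) * indicator (E k) \<omega> \<le> H (insert x \<omega>) + ennreal (b x) * indicator (E k) \<omega>"
          using ins[OF x] inc
        proof eventually_elim
          case (elim \<omega>)
          then show ?case
            by (auto simp: H_def G_def G0[unfolded G_def] b ennreal_plus[symmetric] simp del: ennreal_plus split: split_indicator intro!: ennreal_leI)
        qed
      qed
      also have "\<dots> = ?h x + ennreal (b x) * ennreal p"
        by (subst nn_integral_add) (auto simp: nnp nn_integral_add_point[OF H])
      finally show ?thesis .
    qed
    have bm: "(\<lambda>x. ennreal (b x) * ennreal p * indicator (A j) x) \<in> borel_measurable M"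
      using b(1) by measurable
    have bp: "(\<integral>\<^sup>+x. ennreal (b x) * ennreal p * indicator (A j) x \<partial>M) \<le> ennreal (B * p)"
    proof -
      have "(\<integral>\<^sup>+x. ennreal (b x) * ennreal p * indicator (A j) x \<partial>M) =
          ennreal p * (\<integral>\<^sup>+x. ennreal (b x) * indicator (A j) x \<partial>M)"
        using b(1) by (subst nn_integral_cmult[symmetric]) (auto simp: mult_ac)
      also have "\<dots> \<le> ennreal p * ennreal B" by (intro mult_left_mono B) auto
      also have "\<dots> = ennreal (B * p)" using p B by (simp add: ennreal_mult[symmetric] mult.commute)
      finally show ?thesis .
    qed
    have Il: "(\<integral>\<^sup>+x. ennreal (I k) * indicator (A j) x \<partial>M) = ennreal (l * I k)"
      using l I0 by (subst nn_integral_cmult_indicator) (auto simp: eM ennreal_mult[symmetric] mult.commute)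
    have "ennreal (real (Suc (k j)) * I (bump j k)) \<le>
        (\<integral>\<^sup>+x. ennreal (I k) * indicator (A j) x + ennreal (b x) * ennreal p * indicator (A j) x \<partial>M)"
      unfolding LHS[symmetric]
    proof (rule nn_integral_mono_AE)
      show "AE x in M. ?h x * indicator (A j) x \<le>
          ennreal (I k) * indicator (A j) x + ennreal (b x) * ennreal p * indicator (A j) x"
        using inc by eventually_elim (use up in \<open>auto split: split_indicator\<close>)
    qed
    also have "\<dots> = ennreal (l * I k) + (\<integral>\<^sup>+x. ennreal (b x) * ennreal p * indicator (A j) x \<partial>M)"
      using bm by (subst nn_integral_add) (auto simp: Il)
    also have "\<dots> \<le> ennreal (l * I k) + ennreal (B * p)" by (intro add_left_mono bp)
    also have "\<dots> = ennreal (l * I k + B * p)" using l I0 B p by (intro ennreal_plus[symmetric]) auto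
    finally have 1: "real (Suc (k j)) * I (bump j k) \<le> l * I k + B * p"
      using l I0 B p by (subst (asm) ennreal_le_iff) auto
    have "ennreal (l * I k) \<le> (\<integral>\<^sup>+x. ?h x * indicator (A j) x + ennreal (b x) * ennreal p * indicator (A j) x \<partial>M)"
      unfolding Il[symmetric]
    proof (rule nn_integral_mono_AE)
      show "AE x in M. ennreal (I k) * indicator (A j) x \<le>
          ?h x * indicator (A j) x + ennreal (b x) * ennreal p * indicator (A j) x"
        using inc by eventually_elim (use lo in \<open>auto split: split_indicator\<close>)
    qed
    also have "\<dots> = ennreal (real (Suc (k j)) * I (bump j k)) + (\<integral>\<^sup>+x. ennreal (b x) * ennreal p * indicator (A j) x \<partial>M)"
      using bm by (subst nn_integral_add) (auto simp: LHS)
    also have "\<dots> \<le> ennreal (real (Suc (k j)) * I (bump j k)) + ennreal (B * p)" by (intro add_left_mono bp)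
    also have "\<dots> = ennreal (real (Suc (k j)) * I (bump j k) + B * p)"
      using I0 B p by (intro ennreal_plus[symmetric]) auto
    finally have 2: "l * I k \<le> real (Suc (k j)) * I (bump j k) + B * p"
      using l I0 B p by (subst (asm) ennreal_le_iff) auto
    have c1: "cond_exp_counts A m F k = I k / p - R"
      unfolding cond_exp_counts_def E_def[symmetric] IF p_def[symmetric] using p by (simp add: add_divide_distrib)
    have c2: "cond_exp_counts A m F (bump j k) = I (bump j k) / p' - R"
      unfolding cond_exp_counts_def E_def[symmetric] IF p'_def[symmetric] using p' by (simp add: add_divide_distrib)
    have "l * (I (bump j k) / p') = real (Suc (k j)) * I (bump j k) / p"
      using pp' p p' by (simp add: field_simps del: of_nat_Suc)
    then have "l * (cond_exp_counts A m F (bump j k) - cond_exp_counts A m F k) =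
        (real (Suc (k j)) * I (bump j k) - l * I k) / p"
      unfolding c1 c2 by (simp add: algebra_simps diff_divide_distrib)
    moreover have "\<bar>(real (Suc (k j)) * I (bump j k) - l * I k) / p\<bar> \<le> B"
      using 1 2 p by (simp add: abs_divide divide_le_eq abs_le_iff algebra_simps)
    ultimately have "\<bar>l * (cond_exp_counts A m F (bump j k) - cond_exp_counts A m F k)\<bar> \<le> B" by simp
    then show ?thesis unfolding l_def[symmetric] using l by (simp add: abs_mult)
  qed
qed

end

section \<open>Approximation by functions of finitely many counts\<close>

context poisson_space
begin

lemma cells_joint:
  assumes I: "finite I" and A: "\<And>i. i \<in> I \<Longrightarrow> cells (A i) (m i)"
  obtains A' m' \<theta> where "cells A' m'"
    "\<And>i. i \<in> I \<Longrightarrow> AE \<omega> in P. counts (A i) (m i) \<omega> = \<theta> i (counts A' m' \<omega>)"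
proof -
  let ?\<B> = "\<Union>i\<in>I. A i ` {..<m i}"
  have fin: "finite ?\<B>" using I by auto
  have gd: "good B" if "B \<in> ?\<B>" for B
    using A that unfolding cells_def by blast
  obtain A' m' where A': "cells A' m'"
    "\<And>B. B \<in> ?\<B> \<Longrightarrow> \<exists>J\<subseteq>{..<m'}. B = (\<Union>j\<in>J. A' j)"
    by (rule refine_cells[OF fin gd]) (assumption, rule that)
  have "\<exists>J. J \<subseteq> {..<m'} \<and> A i j = (\<Union>l\<in>J. A' l)" if "i \<in> I" "j < m i" for i j
    using A'(2)[of "A i j"] that by auto
  then obtain J where J: "\<And>i j. i \<in> I \<Longrightarrow> j < m i \<Longrightarrow> J i j \<subseteq> {..<m'} \<and> A i j = (\<Union>l\<in>J i j. A' l)"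
    by metis
  have "AE \<omega> in P. counts (A i) (m i) \<omega> = coarsen (J i) (m i) (counts A' m' \<omega>)" if i: "i \<in> I" for i
    using AE_finite_cells[OF A'(1)]
    by eventually_elim (rule counts_coarsen[OF A'(1) J[OF i]])
  then show ?thesis by (rule that[OF A'(1)])
qed

lemma measurable_fun_counts:
  fixes \<phi> :: "(nat \<Rightarrow> nat) \<Rightarrow> real"
  assumes "cells A m"
  shows "(\<lambda>\<omega>. \<phi> (counts A m \<omega>)) \<in> borel_measurable P"
  by (rule measurable_compose[OF measurable_counts_cells[OF assms]]) simp

lemma integrable_fun_counts:
  fixes \<phi> :: "(nat \<Rightarrow> nat) \<Rightarrow> real"
  assumes "cells A m" "\<And>k. \<bar>\<phi> k\<bar> \<le> C"
  shows "integrable P (\<lambda>\<omega>. \<phi> (counts A m \<omega>))"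
  by (rule integrable_const_bound[where B=C]) (use assms measurable_fun_counts in auto)

text \<open>Membership in the L1-closure of the bounded functions of finitely many counts; this
  closure turns out to be all of L1.\<close>

definition count_approx :: "('x set \<Rightarrow> real) \<Rightarrow> bool" where
  "count_approx f \<longleftrightarrow> integrable P f \<and>
     (\<forall>\<epsilon>>0. \<exists>A m \<phi> C. cells A m \<and> (\<forall>k. \<bar>\<phi> k\<bar> \<le> C) \<and>
        (\<integral>\<omega>. \<bar>f \<omega> - \<phi> (counts A m \<omega>)\<bar> \<partial>P) < \<epsilon>)"

lemma count_approxD:
  assumes "count_approx f" "0 < \<epsilon>"
  shows "\<exists>A m \<phi> C. cells A m \<and> (\<forall>k. \<bar>\<phi> k\<bar> \<le> C) \<and>
     (\<integral>\<omega>. \<bar>f \<omega> - \<phi> (counts A m \<omega>)\<bar> \<partial>P) < \<epsilon>"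
  using assms by (simp add: count_approx_def)

lemma count_approx_lim:
  assumes f: "integrable P f"
    and lim: "\<And>\<epsilon>. 0 < \<epsilon> \<Longrightarrow> \<exists>g. count_approx g \<and> (\<integral>\<omega>. \<bar>f \<omega> - g \<omega>\<bar> \<partial>P) < \<epsilon>"
  shows "count_approx f"
  unfolding count_approx_def
proof (intro conjI allI impI f)
  fix \<epsilon> :: real assume "0 < \<epsilon>"
  then have e: "0 < \<epsilon> / 2" by simp
  obtain g where g: "count_approx g" "(\<integral>\<omega>. \<bar>f \<omega> - g \<omega>\<bar> \<partial>P) < \<epsilon> / 2" using lim[OF e] by blast
  obtain A m \<phi> C where A: "cells A m" "\<And>k. \<bar>\<phi> k\<bar> \<le> C" "(\<integral>\<omega>. \<bar>g \<omega> - \<phi> (counts A m \<omega>)\<bar> \<partial>P) < \<epsilon> / 2"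
    using count_approxD[OF g(1) e] by (elim exE conjE) (rule that, auto)
  have ig: "integrable P g" using g(1) by (simp add: count_approx_def)
  note i\<phi> = integrable_fun_counts[of A m \<phi> C, OF A(1,2)]
  have "(\<integral>\<omega>. \<bar>f \<omega> - \<phi> (counts A m \<omega>)\<bar> \<partial>P) \<le>
      (\<integral>\<omega>. \<bar>f \<omega> - g \<omega>\<bar> + \<bar>g \<omega> - \<phi> (counts A m \<omega>)\<bar> \<partial>P)"
    using f ig i\<phi> by (intro integral_mono) auto
  also have "\<dots> = (\<integral>\<omega>. \<bar>f \<omega> - g \<omega>\<bar> \<partial>P) + (\<integral>\<omega>. \<bar>g \<omega> - \<phi> (counts A m \<omega>)\<bar> \<partial>P)"
    using f ig i\<phi> by (intro Bochner_Integration.integral_add) auto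
  also have "\<dots> < \<epsilon>" using g(2) A(3) by simp
  finally show "\<exists>A m \<phi> C. cells A m \<and> (\<forall>k. \<bar>\<phi> k\<bar> \<le> C) \<and>
      (\<integral>\<omega>. \<bar>f \<omega> - \<phi> (counts A m \<omega>)\<bar> \<partial>P) < \<epsilon>"
    using A(1,2) by (intro exI conjI allI)
qed

lemma count_approx_add:
  assumes f: "count_approx f" and g: "count_approx g"
  shows "count_approx (\<lambda>\<omega>. f \<omega> + g \<omega>)"
  unfolding count_approx_def
proof (intro conjI allI impI)
  have ifg: "integrable P f" "integrable P g" using f g by (auto simp: count_approx_def)
  then show "integrable P (\<lambda>\<omega>. f \<omega> + g \<omega>)" by simp
  fix \<epsilon> :: real assume "0 < \<epsilon>"
  then have e: "0 < \<epsilon> / 2" by simp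
  define F where "F i = (if i then f else g)" for i
  have "\<exists>A m \<phi> C. cells A m \<and> (\<forall>k. \<bar>\<phi> k\<bar> \<le> C) \<and> (\<integral>\<omega>. \<bar>F i \<omega> - \<phi> (counts A m \<omega>)\<bar> \<partial>P) < \<epsilon> / 2" for i
    by (rule count_approxD[OF _ e]) (use f g in \<open>simp add: F_def\<close>)
  then obtain A m \<phi> C where A: "\<And>i. cells (A i) (m i)" "\<And>i k. \<bar>\<phi> i k\<bar> \<le> C i"
    "\<And>i. (\<integral>\<omega>. \<bar>F i \<omega> - \<phi> i (counts (A i) (m i) \<omega>)\<bar> \<partial>P) < \<epsilon> / 2" by metis
  obtain A' m' \<theta> where A': "cells A' m'"
    "\<And>i. i \<in> UNIV \<Longrightarrow> AE \<omega> in P. counts (A i) (m i) \<omega> = \<theta> i (counts A' m' \<omega>)"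
    by (rule cells_joint[OF finite[of UNIV] A(1)]) (rule that)
  define \<psi> where "\<psi> k = \<phi> True (\<theta> True k) + \<phi> False (\<theta> False k)" for k
  have i\<phi>: "integrable P (\<lambda>\<omega>. \<phi> i (counts (A i) (m i) \<omega>))" for i
    by (rule integrable_fun_counts[OF A(1), of "\<phi> i" "C i"]) (rule A(2))
  have b: "\<bar>\<psi> k\<bar> \<le> C True + C False" for k
    unfolding \<psi>_def using A(2)[of True "\<theta> True k"] A(2)[of False "\<theta> False k"] by linarith
  have i\<psi>: "integrable P (\<lambda>\<omega>. \<psi> (counts A' m' \<omega>))"
    by (rule integrable_fun_counts[OF A'(1), of \<psi>, OF b])
  have "(\<integral>\<omega>. \<bar>f \<omega> + g \<omega> - \<psi> (counts A' m' \<omega>)\<bar> \<partial>P) \<le>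
      (\<integral>\<omega>. \<bar>F True \<omega> - \<phi> True (counts (A True) (m True) \<omega>)\<bar> +
         \<bar>F False \<omega> - \<phi> False (counts (A False) (m False) \<omega>)\<bar> \<partial>P)"
  proof (rule integral_mono_AE)
    show "AE \<omega> in P. \<bar>f \<omega> + g \<omega> - \<psi> (counts A' m' \<omega>)\<bar> \<le>
      \<bar>F True \<omega> - \<phi> True (counts (A True) (m True) \<omega>)\<bar> +
         \<bar>F False \<omega> - \<phi> False (counts (A False) (m False) \<omega>)\<bar>"
      using A'(2)[of True, OF UNIV_I] A'(2)[of False, OF UNIV_I]
    proof eventually_elim
      case (elim \<omega>)
      then show ?case by (simp add: \<psi>_def F_def)
    qed
    show "integrable P (\<lambda>\<omega>. \<bar>f \<omega> + g \<omega> - \<psi> (counts A' m' \<omega>)\<bar>)" using ifg i\<psi> by auto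
    show "integrable P (\<lambda>\<omega>. \<bar>F True \<omega> - \<phi> True (counts (A True) (m True) \<omega>)\<bar> +
         \<bar>F False \<omega> - \<phi> False (counts (A False) (m False) \<omega>)\<bar>)"
      using ifg i\<phi> by (auto simp: F_def)
  qed
  also have "\<dots> = (\<integral>\<omega>. \<bar>F True \<omega> - \<phi> True (counts (A True) (m True) \<omega>)\<bar> \<partial>P) +
      (\<integral>\<omega>. \<bar>F False \<omega> - \<phi> False (counts (A False) (m False) \<omega>)\<bar> \<partial>P)"
    using ifg i\<phi> by (intro Bochner_Integration.integral_add) (auto simp: F_def)
  also have "\<dots> < \<epsilon>" using A(3)[of True] A(3)[of False] by simp
  finally show "\<exists>A m \<phi> C. cells A m \<and> (\<forall>k. \<bar>\<phi> k\<bar> \<le> C) \<and>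
      (\<integral>\<omega>. \<bar>f \<omega> + g \<omega> - \<phi> (counts A m \<omega>)\<bar> \<partial>P) < \<epsilon>"
    using A'(1) b by (intro exI conjI allI)
qed

lemma count_approx_cmult:
  assumes f: "count_approx f"
  shows "count_approx (\<lambda>\<omega>. a * f \<omega>)"
  unfolding count_approx_def
proof (intro conjI allI impI)
  show "integrable P (\<lambda>\<omega>. a * f \<omega>)" using f by (simp add: count_approx_def)
  fix \<epsilon> :: real assume "0 < \<epsilon>"
  then have e: "0 < \<epsilon> / (\<bar>a\<bar> + 1)" by simp
  obtain A m \<phi> C where A: "cells A m" "\<And>k. \<bar>\<phi> k\<bar> \<le> C"
    "(\<integral>\<omega>. \<bar>f \<omega> - \<phi> (counts A m \<omega>)\<bar> \<partial>P) < \<epsilon> / (\<bar>a\<bar> + 1)"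
    using count_approxD[OF f e] by (elim exE conjE) (rule that, auto)
  have "(\<integral>\<omega>. \<bar>a * f \<omega> - a * \<phi> (counts A m \<omega>)\<bar> \<partial>P) = \<bar>a\<bar> * (\<integral>\<omega>. \<bar>f \<omega> - \<phi> (counts A m \<omega>)\<bar> \<partial>P)"
    unfolding right_diff_distrib[symmetric] abs_mult by simp
  also have "\<dots> \<le> \<bar>a\<bar> * (\<epsilon> / (\<bar>a\<bar> + 1))" using A(3) by (intro mult_left_mono) auto
  also have "\<dots> < \<epsilon>" using \<open>0 < \<epsilon>\<close> by (simp add: field_simps)
  finally have "(\<integral>\<omega>. \<bar>a * f \<omega> - a * \<phi> (counts A m \<omega>)\<bar> \<partial>P) < \<epsilon>" .
  moreover have "\<bar>a * \<phi> k\<bar> \<le> \<bar>a\<bar> * C" for k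
    unfolding abs_mult by (intro mult_left_mono A) auto
  ultimately show "\<exists>A m \<phi> C. cells A m \<and> (\<forall>k. \<bar>\<phi> k\<bar> \<le> C) \<and>
      (\<integral>\<omega>. \<bar>a * f \<omega> - \<phi> (counts A m \<omega>)\<bar> \<partial>P) < \<epsilon>"
    using A(1) by (intro exI[of _ A] exI[of _ m] exI[of _ "\<lambda>k. a * \<phi> k"] exI[of _ "\<bar>a\<bar> * C"]) simp
qed

lemma integrable_indicator_event: "E \<in> sets P \<Longrightarrow> integrable P (indicator E :: _ \<Rightarrow> real)"
  by (rule integrable_const_bound[where B=1]) (auto split: split_indicator)

lemma count_approx_count_event:
  assumes "E \<in> count_events"
  shows "count_approx (indicator E)"
  unfolding count_approx_def
proof (intro conjI allI impI)
  have E: "E \<in> sets P" using assms by (simp add: count_events_def)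
  then show "integrable P (indicator E :: _ \<Rightarrow> real)" by (rule integrable_indicator_event)
  fix \<epsilon> :: real assume e: "0 < \<epsilon>"
  obtain A m S where A: "cells A m" "determined E A m S" using assms by (auto simp: count_events_def)
  have "(\<integral>\<omega>. \<bar>indicator E \<omega> - indicator S (counts A m \<omega>)\<bar> \<partial>P) = (\<integral>\<omega>. 0 \<partial>P :: real)"
  proof (rule integral_cong_AE)
    have "AE \<omega> in P. \<omega> \<in> E \<longleftrightarrow> counts A m \<omega> \<in> S" using A(2) by (auto simp: determined_def)
    then show "AE \<omega> in P. \<bar>indicator E \<omega> - indicator S (counts A m \<omega>)\<bar> = (0 :: real)"
      by eventually_elim (auto split: split_indicator)
    show "(\<lambda>\<omega>. \<bar>indicator E \<omega> - indicator S (counts A m \<omega>)\<bar> :: real) \<in> borel_measurable P"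
      using measurable_fun_counts[OF A(1), of "indicator S"] E by auto
  qed auto
  then show "\<exists>A m \<phi> C. cells A m \<and> (\<forall>k. \<bar>\<phi> k\<bar> \<le> C) \<and>
      (\<integral>\<omega>. \<bar>indicator E \<omega> - \<phi> (counts A m \<omega>)\<bar> \<partial>P) < \<epsilon>"
    using A(1) e by (intro exI[of _ A] exI[of _ m] exI[of _ "indicator S"] exI[of _ 1])
      (auto split: split_indicator)
qed

lemma count_approx_sum:
  fixes n :: nat
  assumes "\<And>i. i < n \<Longrightarrow> count_approx (f i)"
  shows "count_approx (\<lambda>\<omega>. \<Sum>i<n. f i \<omega>)"
  using assms
proof (induction n)
  case 0
  have "count_approx (\<lambda>\<omega>. 0 * indicator (space P) \<omega>)"
    by (intro count_approx_cmult count_approx_count_event space_count_event)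
  then show ?case by simp
next
  case (Suc n)
  then show ?case by (auto intro!: count_approx_add)
qed

text \<open>A second Dynkin argument over the count events. A countable disjoint union is
  approximated in L1 by its finite partial unions.\<close>

lemma count_approx_event:
  assumes E: "E \<in> sets P"
  shows "count_approx (indicator E)"
  using Int_stable_count_events count_events_closed E[unfolded sets_P_count_events]
proof (induct rule: sigma_sets_induct_disjoint)
  case (basic E)
  then show ?case by (rule count_approx_count_event)
next
  case empty
  show ?case using count_approx_sum[of 0 "\<lambda>_ _. 0"] by (simp add: indicator_def)
next
  case (compl E)
  have "count_approx (\<lambda>\<omega>. indicator (space P) \<omega> + (-1) * indicator E \<omega>)"
    by (intro count_approx_add count_approx_cmult compl count_approx_count_event space_count_event)
  moreover have "E \<subseteq> space P"
    using compl(1) unfolding sets_P_count_events[symmetric] by (rule sets.sets_into_space)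
  then have "(\<lambda>\<omega>. indicator (space P) \<omega> + (-1) * indicator E \<omega>) = (indicator (configurations T - E) :: _ \<Rightarrow> real)"
    by (auto simp: fun_eq_iff space_P split: split_indicator)
  ultimately show ?case by simp
next
  case (union E)
  have E: "E i \<in> sets P" for i using union(2) by (auto simp: sets_P_count_events)
  then have U: "(\<Union>i. E i) \<in> sets P" by auto
  show ?case
  proof (rule count_approx_lim[OF integrable_indicator_event[OF U]])
    fix \<epsilon> :: real assume e: "0 < \<epsilon>"
    have "(\<lambda>i. prob (E i)) sums prob (\<Union>i. E i)"
      using E union(1) by (intro finite_measure_UNION) auto
    then have "(\<lambda>n. prob (\<Union>i. E i) - (\<Sum>i<n. prob (E i))) \<longlonglongrightarrow> prob (\<Union>i. E i) - prob (\<Union>i. E i)"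
      unfolding sums_def by (intro tendsto_intros)
    then have "\<forall>\<^sub>F n in sequentially. prob (\<Union>i. E i) - (\<Sum>i<n. prob (E i)) < \<epsilon>"
      using e by (intro order_tendstoD) auto
    then obtain n where n: "prob (\<Union>i. E i) - (\<Sum>i<n. prob (E i)) < \<epsilon>"
      by (auto simp: eventually_sequentially)
    have abs: "\<bar>indicator (\<Union>i. E i) \<omega> - (\<Sum>i<n. indicator (E i) \<omega>)\<bar> =
        indicator (\<Union>i. E i) \<omega> - (\<Sum>i<n. indicator (E i) \<omega> :: real)" for \<omega>
    proof -
      have "disjoint_family_on E {..<n}" using union(1) by (auto simp: disjoint_family_on_def)
      then have "(\<Sum>i<n. indicator (E i) \<omega> :: real) = indicator (\<Union>i<n. E i) \<omega>"
        by (intro indicator_UN_disjoint[symmetric]) auto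
      then show ?thesis by (auto split: split_indicator)
    qed
    have "(\<integral>\<omega>. \<bar>indicator (\<Union>i. E i) \<omega> - (\<Sum>i<n. indicator (E i) \<omega>)\<bar> \<partial>P) =
        prob (\<Union>i. E i) - (\<Sum>i<n. prob (E i))"
      unfolding abs using E U integrable_indicator_event
      by (subst Bochner_Integration.integral_diff) (auto simp: Bochner_Integration.integral_sum)
    then show "\<exists>g. count_approx g \<and> (\<integral>\<omega>. \<bar>indicator (\<Union>i. E i) \<omega> - g \<omega>\<bar> \<partial>P) < \<epsilon>"
      using n by (intro exI[of _ "\<lambda>\<omega>. \<Sum>i<n. indicator (E i) \<omega>"] conjI count_approx_sum union) simp
  qed
qed

lemma count_approx_integrable:
  assumes "integrable P f"
  shows "count_approx f"
  using assms
proof (induct rule: integrable_induct)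
  case (base E a)
  then have "count_approx (\<lambda>\<omega>. a * indicator E \<omega>)" by (intro count_approx_cmult count_approx_event)
  then show ?case by (simp add: mult.commute)
next
  case (add f g)
  then show ?case by (intro count_approx_add)
next
  case (lim f s)
  show ?case
  proof (rule count_approx_lim[OF lim(5)])
    fix \<epsilon> :: real assume e: "0 < \<epsilon>"
    have "(\<lambda>i. \<integral>\<omega>. \<bar>f \<omega> - s i \<omega>\<bar> \<partial>P) \<longlonglongrightarrow> (\<integral>\<omega>. 0 \<partial>P)"
    proof (rule integral_dominated_convergence[where w="\<lambda>\<omega>. 3 * \<bar>f \<omega>\<bar>"])
      show "AE \<omega> in P. (\<lambda>i. \<bar>f \<omega> - s i \<omega>\<bar>) \<longlonglongrightarrow> 0"
      proof (rule AE_I2)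
        fix \<omega> assume "\<omega> \<in> space P"
        then have "(\<lambda>i. \<bar>f \<omega> - s i \<omega>\<bar>) \<longlonglongrightarrow> \<bar>f \<omega> - f \<omega>\<bar>" by (intro tendsto_intros lim(3))
        then show "(\<lambda>i. \<bar>f \<omega> - s i \<omega>\<bar>) \<longlonglongrightarrow> 0" by simp
      qed
      show "AE \<omega> in P. norm \<bar>f \<omega> - s i \<omega>\<bar> \<le> 3 * \<bar>f \<omega>\<bar>" for i
      proof (rule AE_I2)
        fix \<omega> assume "\<omega> \<in> space P"
        from lim(4)[OF this, of i] show "norm \<bar>f \<omega> - s i \<omega>\<bar> \<le> 3 * \<bar>f \<omega>\<bar>" by simp
      qed
    qed (use lim(1,5) in auto)
    then have "\<forall>\<^sub>F i in sequentially. (\<integral>\<omega>. \<bar>f \<omega> - s i \<omega>\<bar> \<partial>P) < \<epsilon>"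
      using e by (intro order_tendstoD) auto
    then obtain i where "(\<integral>\<omega>. \<bar>f \<omega> - s i \<omega>\<bar> \<partial>P) < \<epsilon>" by (auto simp: eventually_sequentially)
    then show "\<exists>g. count_approx g \<and> (\<integral>\<omega>. \<bar>f \<omega> - g \<omega>\<bar> \<partial>P) < \<epsilon>" using lim(2)[of i] by blast
  qed
qed

section \<open>Conditional expectations given counts as approximations in L1\<close>

lemma cond_exp_counts_bounded:
  assumes A: "cells A m" and F: "F \<in> borel_measurable P" and R: "\<And>\<omega>. \<bar>F \<omega>\<bar> \<le> R"
  shows "\<bar>cond_exp_counts A m F k\<bar> \<le> R"
proof -
  let ?E = "counts A m -` {k} \<inter> space P"
  have E: "?E \<in> sets P" by (rule sets_counts[OF A])
  have R0: "0 \<le> R" using R[of "{}"] by simp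
  have int: "integrable P (\<lambda>\<omega>. F \<omega> * indicator ?E \<omega>)"
    by (rule integrable_const_bound[where B=R]) (use F E R R0 in \<open>auto split: split_indicator\<close>)
  have "\<bar>\<integral>\<omega>. F \<omega> * indicator ?E \<omega> \<partial>P\<bar> \<le> (\<integral>\<omega>. \<bar>F \<omega> * indicator ?E \<omega>\<bar> \<partial>P)"
    by (rule integral_abs_bound)
  also have "\<dots> \<le> (\<integral>\<omega>. R * indicator ?E \<omega> \<partial>P)"
    using int integrable_indicator_event[OF E] R by (intro integral_mono) (auto split: split_indicator)
  also have "\<dots> = R * prob ?E" using E by simp
  finally show ?thesis
    unfolding cond_exp_counts_def using R0
    by (cases "prob ?E = 0") (auto simp: abs_divide divide_le_eq less_le)
qed

text \<open>The mass of the counts \<open>k\<close> cancels the denominator and leaves the absolute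
  value of the integral of \<open>f\<close> over the corresponding event. These events are disjoint,
  so the sum over \<open>k\<close> is at most the integral of \<open>|f|\<close>. Only the countable
  support of the law of the counts is summed over, which allows sum and integral to be
  exchanged.\<close>

lemma cond_exp_counts_contraction:
  assumes A: "cells A m" and f: "integrable P f"
  shows "(\<integral>\<^sup>+\<omega>. ennreal \<bar>cond_exp_counts A m f (counts A m \<omega>)\<bar> \<partial>P) \<le> (\<integral>\<^sup>+\<omega>. ennreal \<bar>f \<omega>\<bar> \<partial>P)"
proof -
  let ?Q = "Pi_pmf {..<m} 0 (\<lambda>j. pois (measure M (A j)))"
  let ?K = "set_pmf ?Q" and ?E = "\<lambda>k. counts A m -` {k} \<inter> space P"
  note [measurable] = measurable_counts_cells[OF A]
  have E[measurable]: "?E k \<in> sets P" for k by (rule sets_counts[OF A])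
  have fm[measurable]: "f \<in> borel_measurable P" using f by simp
  have "(\<integral>\<^sup>+\<omega>. ennreal \<bar>cond_exp_counts A m f (counts A m \<omega>)\<bar> \<partial>P) =
      (\<integral>\<^sup>+k. ennreal \<bar>cond_exp_counts A m f k\<bar> \<partial>?Q)"
    unfolding distr_counts_cells[OF A, symmetric] by (rule nn_integral_distr[symmetric]) auto
  also have "\<dots> = (\<integral>\<^sup>+k. ennreal (pmf ?Q k) * ennreal \<bar>cond_exp_counts A m f k\<bar> \<partial>count_space UNIV)"
    by (rule nn_integral_measure_pmf)
  also have "\<dots> = (\<integral>\<^sup>+k. ennreal (pmf ?Q k) * ennreal \<bar>cond_exp_counts A m f k\<bar> \<partial>count_space ?K)"
    by (rule nn_integral_count_space_eq) (auto simp: set_pmf_iff)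
  also have "\<dots> \<le> (\<integral>\<^sup>+k. (\<integral>\<^sup>+\<omega>. ennreal \<bar>f \<omega>\<bar> * indicator (?E k) \<omega> \<partial>P) \<partial>count_space ?K)"
  proof (rule nn_integral_mono)
    fix k assume "k \<in> space (count_space ?K)"
    then have p: "0 < prob (?E k)" unfolding prob_counts_pmf[OF A] by (simp add: pmf_positive)
    have int: "integrable P (\<lambda>\<omega>. f \<omega> * indicator (?E k) \<omega>)"
      using f E by (intro integrable_real_mult_indicator)
    have "ennreal (pmf ?Q k) * ennreal \<bar>cond_exp_counts A m f k\<bar> = ennreal \<bar>\<integral>\<omega>. f \<omega> * indicator (?E k) \<omega> \<partial>P\<bar>"
      unfolding prob_counts_pmf[OF A, symmetric] cond_exp_counts_def using p
      by (simp add: ennreal_mult[symmetric] abs_divide)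
    also have "\<dots> \<le> (\<integral>\<^sup>+\<omega>. ennreal (norm (f \<omega> * indicator (?E k) \<omega>)) \<partial>P)"
      using integral_norm_bound_ennreal[OF int] by simp
    also have "\<dots> = (\<integral>\<^sup>+\<omega>. ennreal \<bar>f \<omega>\<bar> * indicator (?E k) \<omega> \<partial>P)"
      by (rule nn_integral_cong) (auto split: split_indicator)
    finally show "ennreal (pmf ?Q k) * ennreal \<bar>cond_exp_counts A m f k\<bar> \<le>
        (\<integral>\<^sup>+\<omega>. ennreal \<bar>f \<omega>\<bar> * indicator (?E k) \<omega> \<partial>P)" .
  qed
  also have "\<dots> = (\<integral>\<^sup>+\<omega>. (\<integral>\<^sup>+k. ennreal \<bar>f \<omega>\<bar> * indicator (?E k) \<omega> \<partial>count_space ?K) \<partial>P)"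
    by (intro nn_integral_count_space_nn_integral[symmetric]) measurable
  also have "\<dots> \<le> (\<integral>\<^sup>+\<omega>. ennreal \<bar>f \<omega>\<bar> \<partial>P)"
  proof (rule nn_integral_mono)
    fix \<omega>
    let ?c = "counts A m \<omega>"
    show "(\<integral>\<^sup>+k. ennreal \<bar>f \<omega>\<bar> * indicator (?E k) \<omega> \<partial>count_space ?K) \<le> ennreal \<bar>f \<omega>\<bar>"
    proof (cases "?c \<in> ?K")
      case True
      have "(\<integral>\<^sup>+k. ennreal \<bar>f \<omega>\<bar> * indicator (?E k) \<omega> \<partial>count_space ?K) \<le>
          (\<integral>\<^sup>+k. ennreal \<bar>f \<omega>\<bar> * indicator {?c} k \<partial>count_space ?K)"
        by (rule nn_integral_mono) (auto split: split_indicator)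
      also have "\<dots> = ennreal \<bar>f \<omega>\<bar> * emeasure (count_space ?K) {?c}"
        using True by (intro nn_integral_cmult_indicator) auto
      also have "\<dots> = ennreal \<bar>f \<omega>\<bar>" using True by simp
      finally show ?thesis .
    next
      case False
      have "(\<integral>\<^sup>+k. ennreal \<bar>f \<omega>\<bar> * indicator (?E k) \<omega> \<partial>count_space ?K) = (\<integral>\<^sup>+k. 0 \<partial>count_space ?K)"
        using False by (intro nn_integral_cong) (auto split: split_indicator)
      then show ?thesis by simp
    qed
  qed
  finally show ?thesis .
qed

text \<open>Conditioning fixes any function of the counts and is a contraction in L1, so the
  conditional expectation is at most twice as far from \<open>F i\<close> as the best approximation
  on the same cells. One family of cells serves all \<open>i\<close>.\<close>

lemma cond_exp_counts_approx:
  fixes F :: "'b::finite \<Rightarrow> 'x set \<Rightarrow> real"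
  assumes F: "\<And>i. F i \<in> borel_measurable P" "\<And>i \<omega>. \<bar>F i \<omega>\<bar> \<le> R" and e: "0 < \<epsilon>"
  obtains A m where "cells A m"
    "\<And>i. (\<integral>\<omega>. \<bar>F i \<omega> - cond_exp_counts A m (F i) (counts A m \<omega>)\<bar> \<partial>P) < \<epsilon>"
proof -
  have iF: "integrable P (F i)" for i
    by (rule integrable_const_bound[where B=R]) (use F in auto)
  have "\<exists>A m \<phi> C. cells A m \<and> (\<forall>k. \<bar>\<phi> k\<bar> \<le> C) \<and> (\<integral>\<omega>. \<bar>F i \<omega> - \<phi> (counts A m \<omega>)\<bar> \<partial>P) < \<epsilon> / 2" for i
    using e by (intro count_approxD count_approx_integrable iF) simp
  then obtain A m \<phi> C where A: "\<And>i. cells (A i) (m i)" "\<And>i k. \<bar>\<phi> i k\<bar> \<le> C i"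
    "\<And>i. (\<integral>\<omega>. \<bar>F i \<omega> - \<phi> i (counts (A i) (m i) \<omega>)\<bar> \<partial>P) < \<epsilon> / 2" by metis
  obtain A' m' \<theta> where A': "cells A' m'"
    "\<And>i. i \<in> UNIV \<Longrightarrow> AE \<omega> in P. counts (A i) (m i) \<omega> = \<theta> i (counts A' m' \<omega>)"
    by (rule cells_joint[OF finite[of UNIV] A(1)]) (rule that)
  have "(\<integral>\<omega>. \<bar>F i \<omega> - cond_exp_counts A' m' (F i) (counts A' m' \<omega>)\<bar> \<partial>P) < \<epsilon>" for i
  proof -
    let ?\<psi> = "\<lambda>k. \<phi> i (\<theta> i k)"
    have i\<psi>: "integrable P (\<lambda>\<omega>. ?\<psi> (counts A' m' \<omega>))"
      by (rule integrable_fun_counts[OF A'(1), of ?\<psi> "C i"]) (rule A(2))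
    let ?g = "\<lambda>\<omega>. F i \<omega> - ?\<psi> (counts A' m' \<omega>)"
    have ig: "integrable P ?g" using iF i\<psi> by auto
    have icF: "integrable P (\<lambda>\<omega>. cond_exp_counts A' m' (F i) (counts A' m' \<omega>))"
      by (rule integrable_fun_counts[OF A'(1), where C=R]) (rule cond_exp_counts_bounded[OF A'(1) F])
    have "(\<integral>\<omega>. \<bar>?g \<omega>\<bar> \<partial>P) = (\<integral>\<omega>. \<bar>F i \<omega> - \<phi> i (counts (A i) (m i) \<omega>)\<bar> \<partial>P)"
    proof (rule integral_cong_AE)
      show "AE \<omega> in P. \<bar>?g \<omega>\<bar> = \<bar>F i \<omega> - \<phi> i (counts (A i) (m i) \<omega>)\<bar>"
        using A'(2)[of i, OF UNIV_I] by eventually_elim simp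
      show "(\<lambda>\<omega>. \<bar>F i \<omega> - \<phi> i (counts (A i) (m i) \<omega>)\<bar>) \<in> borel_measurable P"
        using measurable_fun_counts[OF A(1), of "\<phi> i" i] F(1)[of i] by measurable
    qed (use ig in auto)
    then have small: "(\<integral>\<omega>. \<bar>?g \<omega>\<bar> \<partial>P) < \<epsilon> / 2" using A(3) by simp
    \<comment> \<open>Functions of the counts are fixed only at counts of positive probability;
      elsewhere the default value 0 intervenes, but such counts almost surely do not occur.\<close>
    have cg: "cond_exp_counts A' m' ?g k = cond_exp_counts A' m' (F i) k - ?\<psi> k"
      if p: "prob (counts A' m' -` {k} \<inter> space P) \<noteq> 0" for k
    proof -
      let ?E = "counts A' m' -` {k} \<inter> space P"
      have E: "?E \<in> sets P" by (rule sets_counts[OF A'(1)])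
      have "(\<integral>\<omega>. ?g \<omega> * indicator ?E \<omega> \<partial>P) = (\<integral>\<omega>. F i \<omega> * indicator ?E \<omega> - ?\<psi> k * indicator ?E \<omega> \<partial>P)"
        by (rule Bochner_Integration.integral_cong) (auto split: split_indicator)
      also have "\<dots> = (\<integral>\<omega>. F i \<omega> * indicator ?E \<omega> \<partial>P) - ?\<psi> k * prob ?E"
        using E integrable_indicator_event[OF E] integrable_real_mult_indicator[OF E iF[of i]]
        by (subst Bochner_Integration.integral_diff) auto
      finally show ?thesis
        using p unfolding cond_exp_counts_def by (simp add: diff_divide_distrib)
    qed
    have pos: "AE \<omega> in P. prob (counts A' m' -` {counts A' m' \<omega>} \<inter> space P) \<noteq> 0"
    proof -
      let ?Q = "Pi_pmf {..<m'} 0 (\<lambda>j. pois (measure M (A' j)))"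
      have "AE k in distr P (count_space UNIV) (counts A' m'). pmf ?Q k \<noteq> 0"
        unfolding distr_counts_cells[OF A'(1)] by (simp add: AE_measure_pmf_iff set_pmf_iff)
      then show ?thesis
        using A'(1) by (subst (asm) AE_distr_iff) (auto simp: measurable_counts_cells prob_counts_pmf)
    qed
    have icg: "integrable P (\<lambda>\<omega>. ?\<psi> (counts A' m' \<omega>) - cond_exp_counts A' m' (F i) (counts A' m' \<omega>))"
      using i\<psi> icF by auto
    have "ennreal (\<integral>\<omega>. \<bar>?\<psi> (counts A' m' \<omega>) - cond_exp_counts A' m' (F i) (counts A' m' \<omega>)\<bar> \<partial>P) =
       (\<integral>\<^sup>+\<omega>. ennreal \<bar>?\<psi> (counts A' m' \<omega>) - cond_exp_counts A' m' (F i) (counts A' m' \<omega>)\<bar> \<partial>P)"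
      using icg by (intro nn_integral_eq_integral[symmetric]) auto
    also have "\<dots> = (\<integral>\<^sup>+\<omega>. ennreal \<bar>cond_exp_counts A' m' ?g (counts A' m' \<omega>)\<bar> \<partial>P)"
    proof (rule nn_integral_cong_AE)
      show "AE \<omega> in P. ennreal \<bar>?\<psi> (counts A' m' \<omega>) - cond_exp_counts A' m' (F i) (counts A' m' \<omega>)\<bar> =
          ennreal \<bar>cond_exp_counts A' m' ?g (counts A' m' \<omega>)\<bar>"
        using pos
      proof eventually_elim
        case (elim \<omega>)
        show ?case unfolding cg[OF elim] by (simp add: abs_minus_commute)
      qed
    qed
    also have "\<dots> \<le> (\<integral>\<^sup>+\<omega>. ennreal \<bar>?g \<omega>\<bar> \<partial>P)" by (rule cond_exp_counts_contraction[OF A'(1) ig])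
    also have "\<dots> = ennreal (\<integral>\<omega>. \<bar>?g \<omega>\<bar> \<partial>P)"
      using ig by (intro nn_integral_eq_integral) auto
    finally have 2: "(\<integral>\<omega>. \<bar>?\<psi> (counts A' m' \<omega>) - cond_exp_counts A' m' (F i) (counts A' m' \<omega>)\<bar> \<partial>P) \<le>
       (\<integral>\<omega>. \<bar>?g \<omega>\<bar> \<partial>P)"
      by (subst (asm) ennreal_le_iff) (auto intro: Bochner_Integration.integral_nonneg)
    have "(\<integral>\<omega>. \<bar>F i \<omega> - cond_exp_counts A' m' (F i) (counts A' m' \<omega>)\<bar> \<partial>P) \<le>
       (\<integral>\<omega>. \<bar>?g \<omega>\<bar> + \<bar>?\<psi> (counts A' m' \<omega>) - cond_exp_counts A' m' (F i) (counts A' m' \<omega>)\<bar> \<partial>P)"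
      using iF icF ig icg by (intro integral_mono) auto
    also have "\<dots> = (\<integral>\<omega>. \<bar>?g \<omega>\<bar> \<partial>P) +
       (\<integral>\<omega>. \<bar>?\<psi> (counts A' m' \<omega>) - cond_exp_counts A' m' (F i) (counts A' m' \<omega>)\<bar> \<partial>P)"
      using ig icg by (intro Bochner_Integration.integral_add) auto
    also have "\<dots> < \<epsilon>" using 2 small by simp
    finally show ?thesis .
  qed
  then show ?thesis by (rule that[OF A'(1)])
qed

end

section \<open>Scalar estimates\<close>

lemma exp_times_le:
  fixes s v :: real
  assumes "0 \<le> v" "v \<le> 1"
  shows "exp (v * s) - 1 \<le> v * (exp s - 1)"
proof -
  have "convex_on UNIV (exp :: real \<Rightarrow> real)"
    by (rule f''_ge0_imp_convex[where f'=exp and f''=exp]) (auto intro!: derivative_eq_intros)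
  from convex_onD[OF this assms, of 0 s] show ?thesis by (simp add: algebra_simps)
qed

text \<open>By convexity \<open>(exp (t v) - 1) / v\<close> increases for positive \<open>v\<close>;
  negative increments reduce to this case by \<open>1 - exp (- s) \<le> exp s - 1\<close>. The
  purpose is to isolate \<open>u^2\<close>, for which a finer bound than \<open>\<delta>^2\<close>
  is available.\<close>

lemma increment_exp_bound:
  fixes t u \<delta> :: real
  assumes "0 < t" "0 < \<delta>" "\<bar>u\<bar> \<le> \<delta>"
  shows "u * (exp (t * u) - 1) \<le> u\<^sup>2 / \<delta>\<^sup>2 * (\<delta> * (exp (t * \<delta>) - 1))"
proof -
  have pos: "v * (exp (t * v) - 1) \<le> v\<^sup>2 / \<delta>\<^sup>2 * (\<delta> * (exp (t * \<delta>) - 1))" if v: "0 \<le> v" "v \<le> \<delta>" for v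
  proof -
    have "exp ((v / \<delta>) * (t * \<delta>)) - 1 \<le> (v / \<delta>) * (exp (t * \<delta>) - 1)"
      using v assms by (intro exp_times_le) auto
    moreover have "(v / \<delta>) * (t * \<delta>) = t * v" using assms by simp
    ultimately have "exp (t * v) - 1 \<le> (v / \<delta>) * (exp (t * \<delta>) - 1)" by simp
    then have "v * (exp (t * v) - 1) \<le> v * ((v / \<delta>) * (exp (t * \<delta>) - 1))"
      using v by (intro mult_left_mono)
    also have "\<dots> = v\<^sup>2 / \<delta>\<^sup>2 * (\<delta> * (exp (t * \<delta>) - 1))"
      using assms by (simp add: power2_eq_square)
    finally show ?thesis .
  qed
  show ?thesis
  proof (cases "0 \<le> u")
    case True
    then show ?thesis using pos[of u] assms by simp
  next
    case False
    define s where "s = exp (t * \<bar>u\<bar>)"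
    have s: "0 < s" by (simp add: s_def)
    have "exp (t * u) = 1 / s" using False by (simp add: s_def exp_minus field_simps)
    moreover have "1 - 1 / s \<le> s - 1"
      using sum_squares_ge_zero[of "s - 1" 0] s by (simp add: field_simps power2_eq_square)
    ultimately have "\<bar>u\<bar> * (1 - exp (t * u)) \<le> \<bar>u\<bar> * (exp (t * \<bar>u\<bar>) - 1)"
      unfolding s_def[symmetric] by (intro mult_left_mono) auto
    also have "\<dots> \<le> \<bar>u\<bar>\<^sup>2 / \<delta>\<^sup>2 * (\<delta> * (exp (t * \<delta>) - 1))" using assms by (intro pos) auto
    finally show ?thesis using False by (simp add: algebra_simps)
  qed
qed

text \<open>The constants 2 and 1/2 are four times smaller than the 8 and 2 in \<open>h\<close>. Herbst's argument
  needs this room: it bounds the logarithmic moment by \<open>t \<integral> \<eta>(s) / (4 s) ds\<close> rather than by \<open>\<integral> \<eta>\<close>.\<close>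

lemma sqrt_increment_bound:
  fixes w d \<rho> V :: real
  assumes "0 < V" "V \<le> \<rho>"
  shows "(sqrt ((w + d)\<^sup>2 + \<rho>) - sqrt (w\<^sup>2 + \<rho>))\<^sup>2 \<le>
    d\<^sup>2 * (2 * w\<^sup>2 / (w\<^sup>2 + \<rho>) + d\<^sup>2 / (2 * V))"
proof -
  define w' where "w' = w + d"
  define g where "g = sqrt (w\<^sup>2 + \<rho>)"
  define g' where "g' = sqrt (w'\<^sup>2 + \<rho>)"
  have \<rho>: "0 < \<rho>" using assms by simp
  have g: "0 < g" "0 < g'" unfolding g_def g'_def using \<rho> by (auto intro!: add_nonneg_pos)
  have g2: "g\<^sup>2 = w\<^sup>2 + \<rho>" "g'\<^sup>2 = w'\<^sup>2 + \<rho>" unfolding g_def g'_def using \<rho> by auto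
  have Vg: "V \<le> g\<^sup>2" using assms unfolding g2 by (simp add: add_increasing)
  have "(g' - g) * (g + g') = d * (w + w')"
    using g2 by (simp add: w'_def algebra_simps power2_eq_square)
  then have "g' - g = d * (w + w') / (g + g')" using g by (simp add: field_simps)
  then have eq: "(g' - g)\<^sup>2 = d\<^sup>2 * ((w + w')\<^sup>2 / (g + g')\<^sup>2)"
    by (simp add: power_divide power_mult_distrib)
  have "(w + w')\<^sup>2 / (g + g')\<^sup>2 \<le> 2 * w\<^sup>2 / g\<^sup>2 + d\<^sup>2 / (2 * V)"
  proof (cases "w'\<^sup>2 \<le> w\<^sup>2")
    \<comment> \<open>The coordinate does not move away from the centre. Since
      \<open>|w| / sqrt (w^2 + \<rho>)\<close> increases with \<open>|w|\<close>, the quotient at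
      \<open>w'\<close> is at most the one at \<open>w\<close>, and so is the quotient of the
      sums.\<close>
    case True
    have "(\<bar>w'\<bar> * g)\<^sup>2 \<le> (\<bar>w\<bar> * g')\<^sup>2"
      unfolding power_mult_distrib g2 power2_abs using True \<rho> by (simp add: algebra_simps)
    then have "\<bar>w'\<bar> * g \<le> \<bar>w\<bar> * g'" using g by (auto intro: power2_le_imp_le)
    then have "(\<bar>w\<bar> + \<bar>w'\<bar>) * g \<le> \<bar>w\<bar> * (g + g')" by (simp add: algebra_simps)
    moreover have "\<bar>w + w'\<bar> * g \<le> (\<bar>w\<bar> + \<bar>w'\<bar>) * g" using g by (intro mult_right_mono) auto
    ultimately have "\<bar>w + w'\<bar> / (g + g') \<le> \<bar>w\<bar> / g" using g by (simp add: field_simps)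
    then have "(\<bar>w + w'\<bar> / (g + g'))\<^sup>2 \<le> (\<bar>w\<bar> / g)\<^sup>2" using g by (intro power_mono) auto
    then have "(w + w')\<^sup>2 / (g + g')\<^sup>2 \<le> w\<^sup>2 / g\<^sup>2" by (simp add: power_divide)
    also have "\<dots> \<le> 2 * w\<^sup>2 / g\<^sup>2" by (intro divide_right_mono) auto
    also have "\<dots> \<le> 2 * w\<^sup>2 / g\<^sup>2 + d\<^sup>2 / (2 * V)" using assms by simp
    finally show ?thesis .
  next
    \<comment> \<open>Here \<open>g \<le> g'\<close>, so the denominator is at least
      \<open>4 g^2\<close>, while the numerator \<open>(2 w + d)^2\<close> is at most
      \<open>8 w^2 + 2 d^2\<close>. The remainder is then controlled by
      \<open>g^2 \<ge> V\<close>.\<close>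
    case False
    then have "g\<^sup>2 \<le> g'\<^sup>2" unfolding g2 by simp
    then have "g \<le> g'" using g by (auto intro: power2_le_imp_le)
    then have "(2 * g)\<^sup>2 \<le> (g + g')\<^sup>2" using g by (intro power_mono) auto
    then have "(w + w')\<^sup>2 / (g + g')\<^sup>2 \<le> (w + w')\<^sup>2 / (2 * g)\<^sup>2"
      using g by (intro divide_left_mono) auto
    also have "\<dots> \<le> (8 * w\<^sup>2 + 2 * d\<^sup>2) / (2 * g)\<^sup>2"
    proof (rule divide_right_mono)
      have "8 * w\<^sup>2 + 2 * d\<^sup>2 - (w + w')\<^sup>2 = (2 * w - d)\<^sup>2"
        by (simp add: w'_def power2_eq_square algebra_simps)
      then show "(w + w')\<^sup>2 \<le> 8 * w\<^sup>2 + 2 * d\<^sup>2" using zero_le_power2[of "2 * w - d"] by linarith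
    qed simp
    also have "\<dots> = 2 * w\<^sup>2 / g\<^sup>2 + d\<^sup>2 / (2 * g\<^sup>2)"
      by (simp add: power_mult_distrib add_divide_distrib)
    also have "\<dots> \<le> 2 * w\<^sup>2 / g\<^sup>2 + d\<^sup>2 / (2 * V)"
      using Vg assms g by (intro add_left_mono divide_left_mono) auto
    finally show ?thesis .
  qed
  then have "d\<^sup>2 * ((w + w')\<^sup>2 / (g + g')\<^sup>2) \<le> d\<^sup>2 * (2 * w\<^sup>2 / g\<^sup>2 + d\<^sup>2 / (2 * V))"
    by (rule mult_left_mono) simp
  then show ?thesis unfolding eq[symmetric] g2 by (simp add: g_def g'_def w'_def)
qed

text \<open>A supporting line of a convex function at \<open>\<delta>\<close>. Its terms are
  arranged so that nothing is subtracted and its slope is nonnegative, because it will be integrated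
  in \<open>ennreal\<close>. At the end point 0 of the domain the slope 0 serves.\<close>

lemma tangent_power_exp:
  fixes t \<delta> :: real and p :: nat
  assumes t: "0 < t" and z: "0 \<le> \<delta>" and p: "p = 1 \<or> p = 3"
  shows "\<exists>s\<ge>0. \<forall>z\<ge>0. \<delta> ^ p * (exp (t * \<delta>) - 1) + s * z \<le> z ^ p * (exp (t * z) - 1) + s * \<delta>"
proof -
  have e: "0 \<le> exp (t * x) - 1" if "0 \<le> x" for x using that t by simp
  have "\<exists>f'. (\<forall>x\<ge>0. ((\<lambda>x. x ^ p * (exp (t * x) - 1)) has_real_derivative f' x) (at x)) \<and>
      (\<forall>x\<ge>0. 0 \<le> f' x) \<and> convex_on {0..} (\<lambda>x. x ^ p * (exp (t * x) - 1))"
    using p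
  proof
    assume p: "p = 1"
    let ?f' = "\<lambda>x. (exp (t * x) - 1) + x * (t * exp (t * x))"
    have d: "((\<lambda>x. x ^ p * (exp (t * x) - 1)) has_real_derivative ?f' x) (at x)" for x
      unfolding p by (auto intro!: derivative_eq_intros)
    have "convex_on {0..} (\<lambda>x. x ^ p * (exp (t * x) - 1))"
    proof (rule f''_ge0_imp_convex[OF _ d])
      show "(?f' has_real_derivative (2 * (t * exp (t * x)) + x * (t * (t * exp (t * x))))) (at x)" for x
        by (auto intro!: derivative_eq_intros simp: algebra_simps)
    qed (use t in auto)
    then show ?thesis using d e t by (intro exI[of _ ?f']) auto
  next
    assume p: "p = 3"
    let ?f' = "\<lambda>x. 3 * x ^ 2 * (exp (t * x) - 1) + x ^ 3 * (t * exp (t * x))"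
    have d: "((\<lambda>x. x ^ p * (exp (t * x) - 1)) has_real_derivative ?f' x) (at x)" for x
      unfolding p by (auto intro!: derivative_eq_intros)
    have "convex_on {0..} (\<lambda>x. x ^ p * (exp (t * x) - 1))"
    proof (rule f''_ge0_imp_convex[OF _ d])
      show "(?f' has_real_derivative (6 * x * (exp (t * x) - 1) + 6 * x ^ 2 * (t * exp (t * x)) +
          x ^ 3 * (t * (t * exp (t * x))))) (at x)" for x
        by (auto intro!: derivative_eq_intros simp: algebra_simps)
    qed (use t e in auto)
    then show ?thesis using d e t by (intro exI[of _ ?f']) auto
  qed
  then obtain f' where f': "\<And>x. 0 \<le> x \<Longrightarrow> ((\<lambda>x. x ^ p * (exp (t * x) - 1)) has_real_derivative f' x) (at x)"
    "\<And>x. 0 \<le> x \<Longrightarrow> 0 \<le> f' x" "convex_on {0..} (\<lambda>x. x ^ p * (exp (t * x) - 1))" by auto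
  show ?thesis
  proof (cases "\<delta> = 0")
    case True
    then show ?thesis using p e by (intro exI[of _ 0]) auto
  next
    case False
    then have \<delta>: "0 < \<delta>" using z by simp
    have "z ^ p * (exp (t * z) - 1) - \<delta> ^ p * (exp (t * \<delta>) - 1) \<ge> f' \<delta> * (z - \<delta>)" if "0 \<le> z" for z
    proof (rule convex_on_imp_above_tangent[OF f'(3)])
      show "connected {0::real..}" by (intro convex_connected) simp
      show "\<delta> \<in> interior {0..}" using \<delta> by (simp add: interior_real_atLeast)
      show "((\<lambda>x. x ^ p * (exp (t * x) - 1)) has_real_derivative f' \<delta>) (at \<delta> within {0..})"
        by (rule has_field_derivative_at_within[OF f'(1)[OF z]])
    qed (use that in auto)
    then show ?thesis using f'(2)[of \<delta>] \<delta> by (intro exI[of _ "f' \<delta>"]) (auto simp: algebra_simps)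
  qed
qed

text \<open>Jensen's inequality for the mean \<open>\<delta>\<close> of \<open>b\<close> over
  \<open>A\<close>, obtained by integrating the supporting line. The linear terms integrate to the
  same finite number \<open>s * (r * \<delta>)\<close> on both sides and cancel.\<close>

lemma jensen_power_exp:
  fixes b :: "'a \<Rightarrow> real" and p :: nat
  assumes A: "A \<in> sets M" "emeasure M A = ennreal r" and r: "0 < r"
    and b: "b \<in> borel_measurable M" "\<And>x. 0 \<le> b x"
    and \<delta>: "(\<integral>\<^sup>+x. ennreal (b x) * indicator A x \<partial>M) = ennreal (r * \<delta>)" "0 \<le> \<delta>"
    and t: "0 < t" and p: "p = 1 \<or> p = 3"
  shows "ennreal (r * (\<delta> ^ p * (exp (t * \<delta>) - 1))) \<le>
    (\<integral>\<^sup>+x. ennreal (b x ^ p * (exp (t * b x) - 1)) * indicator A x \<partial>M)" (is "_ \<le> ?I")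
proof -
  obtain s where s: "0 \<le> s"
    "\<And>z. 0 \<le> z \<Longrightarrow> \<delta> ^ p * (exp (t * \<delta>) - 1) + s * z \<le> z ^ p * (exp (t * z) - 1) + s * \<delta>"
    using tangent_power_exp[OF t \<delta>(2) p] by blast
  let ?\<phi> = "\<lambda>z. z ^ p * (exp (t * z) - 1)"
  have \<phi>0: "0 \<le> ?\<phi> z" if "0 \<le> z" for z using that t by simp
  note [measurable] = A(1) b(1)
  have "ennreal (r * ?\<phi> \<delta>) + ennreal (s * (r * \<delta>)) =
      (\<integral>\<^sup>+x. ennreal (?\<phi> \<delta>) * indicator A x \<partial>M) + (\<integral>\<^sup>+x. ennreal s * (ennreal (b x) * indicator A x) \<partial>M)"
  proof (rule arg_cong2[where f="(+)"])
    show "ennreal (r * ?\<phi> \<delta>) = (\<integral>\<^sup>+x. ennreal (?\<phi> \<delta>) * indicator A x \<partial>M)"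
      using r \<phi>0[OF \<delta>(2)] by (subst nn_integral_cmult_indicator[OF A(1)])
        (simp add: A(2) ennreal_mult[symmetric] mult.commute)
    show "ennreal (s * (r * \<delta>)) = (\<integral>\<^sup>+x. ennreal s * (ennreal (b x) * indicator A x) \<partial>M)"
      using s(1) r \<delta>(2) by (subst nn_integral_cmult) (auto simp: \<delta>(1) ennreal_mult)
  qed
  also have "\<dots> = (\<integral>\<^sup>+x. ennreal (?\<phi> \<delta>) * indicator A x + ennreal s * (ennreal (b x) * indicator A x) \<partial>M)"
    by (rule nn_integral_add[symmetric]) measurable
  also have "\<dots> \<le> (\<integral>\<^sup>+x. ennreal (?\<phi> (b x)) * indicator A x + ennreal (s * \<delta>) * indicator A x \<partial>M)"
  proof (rule nn_integral_mono)
    fix x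
    have "ennreal (?\<phi> \<delta>) + ennreal s * ennreal (b x) = ennreal (?\<phi> \<delta> + s * b x)"
      using \<phi>0[OF \<delta>(2)] s(1) b(2)[of x] by (simp add: ennreal_mult ennreal_plus)
    also have "\<dots> \<le> ennreal (?\<phi> (b x) + s * \<delta>)" by (intro ennreal_leI s(2) b(2))
    also have "\<dots> = ennreal (?\<phi> (b x)) + ennreal (s * \<delta>)"
      using \<phi>0[OF b(2)[of x]] s(1) \<delta>(2) by (intro ennreal_plus) auto
    finally show "ennreal (?\<phi> \<delta>) * indicator A x + ennreal s * (ennreal (b x) * indicator A x) \<le>
        ennreal (?\<phi> (b x)) * indicator A x + ennreal (s * \<delta>) * indicator A x"
      by (auto split: split_indicator)
  qed
  also have "\<dots> = ?I + ennreal (s * \<delta>) * ennreal r"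
    by (subst nn_integral_add) (auto simp: nn_integral_cmult_indicator A)
  also have "ennreal (s * \<delta>) * ennreal r = ennreal (s * (r * \<delta>))"
    using s(1) \<delta>(2) r by (simp add: ennreal_mult[symmetric] mult_ac)
  finally show ?thesis by (simp add: ennreal_add_left_cancel_le add.commute)
qed

section \<open>The exponential moment inequality\<close>

definition shifted_norm :: "real ^ 'n \<Rightarrow> real \<Rightarrow> real ^ 'n \<Rightarrow> real" where
  "shifted_norm a V z = sqrt ((norm (z - a))\<^sup>2 + V)"

text \<open>One extra coordinate with the constant entry \<open>sqrt V\<close> turns the root into a
  norm, and the triangle inequality then gives the Lipschitz constant 1.\<close>

lemma shifted_norm_eq_norm: "0 \<le> V \<Longrightarrow> shifted_norm a V z = norm (z - a, sqrt V)"
  by (simp add: shifted_norm_def norm_Pair)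

lemma shifted_norm_lipschitz:
  assumes "0 \<le> V"
  shows "\<bar>shifted_norm a V z - shifted_norm a V z'\<bar> \<le> norm (z - z')"
proof -
  have "\<bar>shifted_norm a V z - shifted_norm a V z'\<bar> \<le> norm ((z - a, sqrt V) - (z' - a, sqrt V))"
    unfolding shifted_norm_eq_norm[OF assms] by (rule norm_triangle_ineq3)
  then show ?thesis by (simp add: norm_Pair)
qed

lemma shifted_norm_nonneg: "0 \<le> V \<Longrightarrow> 0 \<le> shifted_norm a V z"
  by (simp add: shifted_norm_def)

lemma power2_norm_vec: "(norm z)\<^sup>2 = (\<Sum>i\<in>UNIV. (z $ i)\<^sup>2)" for z :: "real ^ 'n"
  unfolding power2_norm_eq_inner inner_vec_def by (simp add: power2_eq_square)

lemma borel_measurable_vec: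
  fixes f :: "'a \<Rightarrow> real ^ 'n::finite"
  assumes "\<And>i. (\<lambda>x. f x $ i) \<in> borel_measurable M"
  shows "f \<in> borel_measurable M"
proof (rule borel_measurable_euclidean_space[THEN iffD2], intro ballI)
  fix e :: "real ^ 'n" assume "e \<in> Basis"
  then obtain i where "e = axis i 1" by (auto simp: Basis_vec_def)
  then show "(\<lambda>x. f x \<bullet> e) \<in> borel_measurable M" using assms[of i] by (simp add: inner_axis)
qed

lemma borel_measurable_shifted_norm: "shifted_norm a V \<in> borel_measurable borel"
  unfolding shifted_norm_def by measurable

text \<open>With \<open>u\<close> the increment of the shifted norm, the left side is
  \<open>t exp (t g) u (exp (t u) - 1)\<close>. The Lipschitz property gives
  \<open>|u| \<le> \<delta>\<close>, so \<open>u^2 / \<delta>^2\<close> can be split off; it is then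
  estimated as a function of the coordinate \<open>i\<close> alone, with \<open>\<rho>\<close>
  collecting \<open>V\<close> and all other coordinates. The two summands lead to the two terms of
  \<open>h\<close>.\<close>

lemma shifted_norm_increment:
  fixes z z' a :: "real ^ 'n"
  assumes V: "0 < V" and z: "\<And>l. l \<noteq> i \<Longrightarrow> z' $ l = z $ l" and d: "\<bar>z' $ i - z $ i\<bar> \<le> \<delta>"
    and t: "0 < t"
  shows "psi (exp (t * shifted_norm a V z')) (exp (t * shifted_norm a V z)) \<le>
    t * exp (t * shifted_norm a V z) *
      (2 * ((z - a) $ i)\<^sup>2 / (shifted_norm a V z)\<^sup>2 * (\<delta> * (exp (t * \<delta>) - 1)) +
       1 / (2 * V) * (\<delta> ^ 3 * (exp (t * \<delta>) - 1)))"
proof -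
  define g where "g = shifted_norm a V z"
  define g' where "g' = shifted_norm a V z'"
  define u where "u = g' - g"
  define e where "e = z' $ i - z $ i"
  define w where "w = (z - a) $ i"
  define \<rho> where "\<rho> = (\<Sum>l\<in>UNIV - {i}. ((z - a) $ l)\<^sup>2) + V"
  have \<delta>: "0 \<le> \<delta>" using d by linarith
  have "norm (z' - z) \<le> (\<Sum>l\<in>UNIV. \<bar>(z' - z) $ l\<bar>)" by (rule norm_le_l1_cart)
  also have "\<dots> = (\<Sum>l\<in>UNIV. if l = i then \<bar>e\<bar> else 0)"
    by (intro sum.cong) (auto simp: e_def z)
  finally have "norm (z' - z) \<le> \<bar>e\<bar>" by simp
  then have u: "\<bar>u\<bar> \<le> \<delta>"
    unfolding u_def g_def g'_def using shifted_norm_lipschitz[of V a z' z] V d unfolding e_def by linarith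
  have psi_eq: "psi (exp (t * g')) (exp (t * g)) = t * exp (t * g) * (u * (exp (t * u) - 1))"
  proof -
    have 1: "t * g' - t * g = t * u" by (simp add: u_def algebra_simps)
    have 2: "exp (t * g') = exp (t * g) * exp (t * u)"
      unfolding exp_add[symmetric] 1[symmetric] by simp
    show ?thesis unfolding psi_def ln_exp 1 unfolding 2 by (simp add: algebra_simps)
  qed
  have n1: "(norm (z - a))\<^sup>2 + V = w\<^sup>2 + \<rho>"
    unfolding power2_norm_vec \<rho>_def w_def by (subst sum.remove[of _ i]) auto
  have n2: "(norm (z' - a))\<^sup>2 + V = (w + e)\<^sup>2 + \<rho>"
  proof -
    have "(\<Sum>l\<in>UNIV - {i}. ((z' - a) $ l)\<^sup>2) = (\<Sum>l\<in>UNIV - {i}. ((z - a) $ l)\<^sup>2)"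
      by (intro sum.cong) (auto simp: z)
    moreover have "(z' - a) $ i = w + e" by (simp add: w_def e_def)
    ultimately show ?thesis
      unfolding power2_norm_vec \<rho>_def by (subst sum.remove[of _ i]) auto
  qed
  have g_eq: "g = sqrt (w\<^sup>2 + \<rho>)" "g' = sqrt ((w + e)\<^sup>2 + \<rho>)"
    unfolding g_def g'_def shifted_norm_def n1 n2 by auto
  have V\<rho>: "V \<le> \<rho>" unfolding \<rho>_def by (simp add: sum_nonneg)
  have gg: "g\<^sup>2 = w\<^sup>2 + \<rho>" unfolding g_eq using V V\<rho> by simp
  show ?thesis
  proof (cases "\<delta> = 0")
    case True
    then have "u = 0" using u by simp
    then show ?thesis unfolding g_def[symmetric] g'_def[symmetric] psi_eq using True by simp
  next
    case False
    then have \<delta>: "0 < \<delta>" using \<delta> by simp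
    have E: "0 \<le> exp (t * \<delta>) - 1" using t \<delta> by simp
    have "u\<^sup>2 \<le> e\<^sup>2 * (2 * w\<^sup>2 / g\<^sup>2 + e\<^sup>2 / (2 * V))"
      unfolding u_def gg using sqrt_increment_bound[OF V V\<rho>, of w e] by (simp add: g_eq)
    also have "\<dots> \<le> \<delta>\<^sup>2 * (2 * w\<^sup>2 / g\<^sup>2 + \<delta>\<^sup>2 / (2 * V))"
    proof -
      have "e\<^sup>2 \<le> \<delta>\<^sup>2" using d \<delta> unfolding e_def by (metis abs_ge_zero power2_abs power_mono)
      then show ?thesis using V by (intro mult_mono add_left_mono divide_right_mono add_nonneg_nonneg) auto
    qed
    finally have "u\<^sup>2 / \<delta>\<^sup>2 \<le> 2 * w\<^sup>2 / g\<^sup>2 + \<delta>\<^sup>2 / (2 * V)"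
      using \<delta> by (simp add: divide_le_eq mult.commute)
    then have "u\<^sup>2 / \<delta>\<^sup>2 * (\<delta> * (exp (t * \<delta>) - 1)) \<le>
        (2 * w\<^sup>2 / g\<^sup>2 + \<delta>\<^sup>2 / (2 * V)) * (\<delta> * (exp (t * \<delta>) - 1))"
      using \<delta> E by (intro mult_right_mono) auto
    then have "u * (exp (t * u) - 1) \<le> (2 * w\<^sup>2 / g\<^sup>2 + \<delta>\<^sup>2 / (2 * V)) * (\<delta> * (exp (t * \<delta>) - 1))"
      using increment_exp_bound[OF t \<delta> u] by linarith
    also have "\<dots> = 2 * w\<^sup>2 / g\<^sup>2 * (\<delta> * (exp (t * \<delta>) - 1)) + 1 / (2 * V) * (\<delta> ^ 3 * (exp (t * \<delta>) - 1))"
      by (simp add: power3_eq_cube power2_eq_square distrib_right)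
    finally have "t * exp (t * g) * (u * (exp (t * u) - 1)) \<le>
        t * exp (t * g) * (2 * w\<^sup>2 / g\<^sup>2 * (\<delta> * (exp (t * \<delta>) - 1)) + 1 / (2 * V) * (\<delta> ^ 3 * (exp (t * \<delta>) - 1)))"
      using t by (intro mult_left_mono) auto
    then show ?thesis unfolding psi_eq[symmetric] by (simp add: g_def g'_def w_def)
  qed
qed

lemma sum_list_concat_replicate:
  fixes f :: "'a \<times> real \<Rightarrow> real" and r :: "'a \<Rightarrow> real"
  shows "sum_list (map f (concat (map (\<lambda>j. replicate n (j, r j / n)) js))) =
    (\<Sum>j\<leftarrow>js. n * f (j, r j / n))"
  by (induction js) (auto simp: sum_list_replicate)

section \<open>Energy bounds and exponential moments on the Poisson space\<close>

context poisson_space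
begin

text \<open>The exponents 1 and 3 are those of the two integrals in \<open>h\<close>, with
  \<open>\<beta>\<close> absorbed into \<open>b\<close>. The bounds \<open>K1\<close> and
  \<open>K3\<close> are uniform in the label, as the maxima in \<open>h\<close> are.\<close>

definition moments_le :: "('x \<Rightarrow> real) \<Rightarrow> real \<Rightarrow> real \<Rightarrow> real \<Rightarrow> bool" where
  "moments_le b t K1 K3 \<longleftrightarrow> (\<forall>i.
     (\<integral>\<^sup>+x. ennreal (b x ^ 1 * (exp (t * b x) - 1)) * indicator (c -` {i}) x \<partial>M) \<le> ennreal K1 \<and>
     (\<integral>\<^sup>+x. ennreal (b x ^ 3 * (exp (t * b x) - 1)) * indicator (c -` {i}) x \<partial>M) \<le> ennreal K3)"

text \<open>\<open>\<eta>\<close> stands for \<open>h\<close>, and \<open>V\<close> for any upper bound of \<open>(E[|F - E[F]|])\<^sup>2\<close>.\<close>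

definition exp_bound :: "('x \<Rightarrow> real) \<Rightarrow> real \<Rightarrow> real \<Rightarrow> (real \<Rightarrow> real) \<Rightarrow> bool" where
  "exp_bound b V \<tau> \<eta> \<longleftrightarrow> 0 < V \<and> 0 < \<tau> \<and> b \<in> borel_measurable M \<and> (\<forall>x. 0 \<le> b x) \<and>
     mono_on {0..\<tau>} \<eta> \<and> (\<forall>s. 0 \<le> s \<longrightarrow> s \<le> \<tau> \<longrightarrow> 0 \<le> \<eta> s) \<and>
     (\<forall>s t. 0 < s \<longrightarrow> s \<le> t \<longrightarrow> t \<le> \<tau> \<longrightarrow> \<eta> s / s \<le> \<eta> t / t) \<and>
     (\<forall>t. 0 < t \<longrightarrow> t \<le> \<tau> \<longrightarrow> (\<exists>K1 K3. 0 \<le> K1 \<and> 0 \<le> K3 \<and>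
        moments_le b t K1 K3 \<and>
        8 * K1 + 2 * real CARD('i) / V * K3 \<le> \<eta> t))"

text \<open>Where \<open>b\<close> exceeds 1, it is at most a constant times the first exponential
  moment density, because \<open>exp (\<tau> b) - 1 \<ge> exp \<tau> - 1\<close> there; where it
  does not, the finite measure of \<open>B\<close> suffices.\<close>

lemma exp_bound_integral_cell:
  assumes eb: "exp_bound b V \<tau> \<eta>" and B: "good B"
  shows "(\<integral>\<^sup>+x. ennreal (b x) * indicator B x \<partial>M) < \<infinity>"
proof -
  have \<tau>: "0 < \<tau>" and [measurable]: "b \<in> borel_measurable M" and b0: "\<And>x. 0 \<le> b x"
    using eb by (auto simp: exp_bound_def)
  obtain K1 K3 where "moments_le b \<tau> K1 K3" using eb \<tau> unfolding exp_bound_def by blast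
  then have K1: "(\<integral>\<^sup>+x. ennreal (b x ^ 1 * (exp (\<tau> * b x) - 1)) * indicator (c -` {i}) x \<partial>M) \<le> ennreal K1" for i
    unfolding moments_le_def by blast
  obtain i where i: "B \<subseteq> c -` {i}" using B by (auto simp: good_def)
  have [measurable]: "B \<in> sets M" "c -` {i} \<in> sets M" using goodD(1)[OF B] sets_label by auto
  define \<kappa> where "\<kappa> = 1 / (exp \<tau> - 1)"
  have \<kappa>: "0 \<le> \<kappa>" using \<tau> by (simp add: \<kappa>_def)
  have le: "b x \<le> 1 + \<kappa> * (b x * (exp (\<tau> * b x) - 1))" for x
  proof (cases "b x \<le> 1")
    case True
    have "0 \<le> \<kappa> * (b x * (exp (\<tau> * b x) - 1))"
      using \<kappa> b0[of x] \<tau> by (intro mult_nonneg_nonneg) auto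
    then show ?thesis using True by linarith
  next
    case False
    then have "exp \<tau> - 1 \<le> exp (\<tau> * b x) - 1" using \<tau> by simp
    then have "1 \<le> \<kappa> * (exp (\<tau> * b x) - 1)" unfolding \<kappa>_def using \<tau> by (simp add: field_simps)
    then have "b x * 1 \<le> b x * (\<kappa> * (exp (\<tau> * b x) - 1))" by (intro mult_left_mono b0)
    then show ?thesis by (simp add: mult_ac)
  qed
  have "(\<integral>\<^sup>+x. ennreal (b x) * indicator B x \<partial>M) \<le>
      (\<integral>\<^sup>+x. indicator B x + ennreal \<kappa> * (ennreal (b x ^ 1 * (exp (\<tau> * b x) - 1)) * indicator (c -` {i}) x) \<partial>M)"
  proof (rule nn_integral_mono)
    fix x
    have "ennreal (b x) \<le> ennreal (1 + \<kappa> * (b x * (exp (\<tau> * b x) - 1)))" by (rule ennreal_leI[OF le])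
    also have "\<dots> = 1 + ennreal \<kappa> * ennreal (b x ^ 1 * (exp (\<tau> * b x) - 1))"
      using \<kappa> b0[of x] \<tau> by (subst ennreal_plus) (auto simp: ennreal_mult)
    finally show "ennreal (b x) * indicator B x \<le> indicator B x +
        ennreal \<kappa> * (ennreal (b x ^ 1 * (exp (\<tau> * b x) - 1)) * indicator (c -` {i}) x)"
      using i by (auto split: split_indicator)
  qed
  also have "\<dots> = emeasure M B +
      ennreal \<kappa> * (\<integral>\<^sup>+x. ennreal (b x ^ 1 * (exp (\<tau> * b x) - 1)) * indicator (c -` {i}) x \<partial>M)"
    by (subst nn_integral_add) (auto simp: nn_integral_cmult)
  also have "\<dots> \<le> emeasure M B + ennreal \<kappa> * ennreal K1"
    by (intro add_left_mono mult_left_mono K1) auto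
  also have "\<dots> < \<infinity>" using goodD(2)[OF B] by (simp add: ennreal_mult_less_top)
  finally show ?thesis .
qed

lemma sum_cells_le:
  assumes A: "cells A m" and J: "J \<subseteq> {..<m}" "\<And>j. j \<in> J \<Longrightarrow> A j \<subseteq> C" and f: "f \<in> borel_measurable M"
  shows "(\<Sum>j\<in>J. \<integral>\<^sup>+x. f x * indicator (A j) x \<partial>M) \<le> (\<integral>\<^sup>+x. f x * indicator C x \<partial>M)"
proof -
  have "(\<Sum>j\<in>J. \<integral>\<^sup>+x. f x * indicator (A j) x \<partial>M) = (\<integral>\<^sup>+x. (\<Sum>j\<in>J. f x * indicator (A j) x) \<partial>M)"
    using cells_finite[OF A] J(1)
    by (intro nn_integral_sum[symmetric] borel_measurable_times_ennreal borel_measurable_indicator f) blast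
  also have "\<dots> \<le> (\<integral>\<^sup>+x. f x * indicator C x \<partial>M)"
  proof (rule nn_integral_mono)
    fix x
    have fin: "finite J" using J(1) by (rule finite_subset) simp
    show "(\<Sum>j\<in>J. f x * indicator (A j) x) \<le> f x * indicator C x"
    proof (cases "\<exists>j\<in>J. x \<in> A j")
      case True
      then obtain j where j: "j \<in> J" "x \<in> A j" by blast
      have "(\<Sum>i\<in>J. f x * indicator (A i) x) = (\<Sum>i\<in>J. if i = j then f x else 0)"
      proof (intro sum.cong refl)
        fix i assume "i \<in> J"
        then have "x \<notin> A i" if "i \<noteq> j" using that j J(1) cells_disjoint[OF A, of i j x] by blast
        then show "f x * indicator (A i) x = (if i = j then f x else 0)" using j by auto
      qed
      also have "\<dots> = f x" using j fin by simp
      also have "\<dots> = f x * indicator C x" using j J(2)[of j] by auto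
      finally show ?thesis by simp
    next
      case False
      then have "(\<Sum>j\<in>J. f x * indicator (A j) x) = 0" by (intro sum.neutral) auto
      then show ?thesis by simp
    qed
  qed
  finally show ?thesis .
qed

text \<open>Jensen's inequality bounds the contribution of a cell by an integral over it, and
  grouping the cells by label restores the integrals over the copies. In the term with
  \<open>p = 1\<close> the weights \<open>(w i)^2 / g^2\<close> have sum at most 1, so
  \<open>K1\<close> is paid once; the term with \<open>p = 3\<close> has no weights, and
  \<open>K3\<close> is paid for every label.\<close>

lemma energy_bound:
  fixes \<phi> :: "(nat \<Rightarrow> nat) \<Rightarrow> real ^ 'i"
  assumes eb: "exp_bound b V \<tau> \<eta>" and t: "0 < t" "t \<le> \<tau>"
    and A: "cells A m" and lab: "\<And>j. j < m \<Longrightarrow> A j \<subseteq> c -` {lab j}"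
    and B: "\<And>j. j < m \<Longrightarrow> (\<integral>\<^sup>+x. ennreal (b x) * indicator (A j) x \<partial>M) = ennreal (B j)" "\<And>j. 0 \<le> B j"
    and inc: "\<And>j i. j < m \<Longrightarrow> measure M (A j) * \<bar>\<phi> (bump j k) $ i - \<phi> k $ i\<bar> \<le> (if lab j = i then B j else 0)"
  shows "(\<Sum>j<m. measure M (A j) * psi (exp (t * shifted_norm a V (\<phi> (bump j k)))) (exp (t * shifted_norm a V (\<phi> k))))
    \<le> t * exp (t * shifted_norm a V (\<phi> k)) * (\<eta> t / 4)"
proof -
  have V: "0 < V" and bm: "b \<in> borel_measurable M" and b0: "\<And>x. 0 \<le> b x"
    using eb by (auto simp: exp_bound_def)
  obtain K1 K3 where K0: "0 \<le> K1" "0 \<le> K3"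
    and mom: "moments_le b t K1 K3"
    and K: "8 * K1 + 2 * real CARD('i) / V * K3 \<le> \<eta> t"
    using eb t unfolding exp_bound_def by blast
  have K1: "(\<integral>\<^sup>+x. ennreal (b x ^ 1 * (exp (t * b x) - 1)) * indicator (c -` {i}) x \<partial>M) \<le> ennreal K1"
    and K3: "(\<integral>\<^sup>+x. ennreal (b x ^ 3 * (exp (t * b x) - 1)) * indicator (c -` {i}) x \<partial>M) \<le> ennreal K3" for i
    using mom unfolding moments_le_def by blast+
  define g where "g = shifted_norm a V (\<phi> k)"
  define w where "w i = (\<phi> k - a) $ i" for i
  define r where "r j = measure M (A j)" for j
  \<comment> \<open>The mean of \<open>b\<close> over the cell, which bounds the jump of the
    coordinate \<open>lab j\<close>. On a cell of measure zero the quotient is 0 by default, and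
    \<open>X p j\<close> vanishes.\<close>
  define \<delta> where "\<delta> j = B j / r j" for j
  define X where "X p j = r j * (\<delta> j ^ p * (exp (t * \<delta> j) - 1))" for p j
  have r0: "0 \<le> r j" for j by (simp add: r_def)
  have \<delta>0: "0 \<le> \<delta> j" for j unfolding \<delta>_def using B(2) r0 by simp
  have X0: "0 \<le> X p j" for p j unfolding X_def using r0 \<delta>0[of j] t by (intro mult_nonneg_nonneg) auto
  have XL: "ennreal (X p j) \<le> (\<integral>\<^sup>+x. ennreal (b x ^ p * (exp (t * b x) - 1)) * indicator (A j) x \<partial>M)"
    if p: "p = 1 \<or> p = 3" and j: "j < m" for p j
  proof (cases "r j = 0")
    case False
    then have r: "0 < r j" using r0[of j] by simp
    have "emeasure M (A j) = ennreal (r j)"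
      unfolding r_def using cells_finite[OF A j] by (intro emeasure_eq_ennreal_measure) auto
    moreover have "(\<integral>\<^sup>+x. ennreal (b x) * indicator (A j) x \<partial>M) = ennreal (r j * \<delta> j)"
      using B(1)[OF j] r by (simp add: \<delta>_def)
    ultimately show ?thesis
      unfolding X_def using cells_finite[OF A j] r bm b0 \<delta>0 t(1) p
      by (intro jensen_power_exp) auto
  qed (simp add: X_def)
  have XK: "(\<Sum>j\<in>{j. j < m \<and> lab j = i}. X p j) \<le> K"
    if p: "p = 1 \<or> p = 3" and K: "0 \<le> K"
      "(\<integral>\<^sup>+x. ennreal (b x ^ p * (exp (t * b x) - 1)) * indicator (c -` {i}) x \<partial>M) \<le> ennreal K" for p i K
  proof -
    have "ennreal (\<Sum>j\<in>{j. j < m \<and> lab j = i}. X p j) = (\<Sum>j\<in>{j. j < m \<and> lab j = i}. ennreal (X p j))"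
      using X0 by (intro sum_ennreal[symmetric]) auto
    also have "\<dots> \<le> (\<Sum>j\<in>{j. j < m \<and> lab j = i}. \<integral>\<^sup>+x. ennreal (b x ^ p * (exp (t * b x) - 1)) * indicator (A j) x \<partial>M)"
      by (intro sum_mono XL p) auto
    also have "\<dots> \<le> (\<integral>\<^sup>+x. ennreal (b x ^ p * (exp (t * b x) - 1)) * indicator (c -` {i}) x \<partial>M)"
      using bm lab by (intro sum_cells_le[OF A]) auto
    also have "\<dots> \<le> ennreal K" by (rule K)
    finally show ?thesis using K(1) by simp
  qed
  have gpos: "0 < g\<^sup>2" and gg: "g\<^sup>2 = (norm (\<phi> k - a))\<^sup>2 + V"
    unfolding g_def shifted_norm_def using V by (auto intro: add_nonneg_pos)
  have step: "r j * psi (exp (t * shifted_norm a V (\<phi> (bump j k)))) (exp (t * g)) \<le>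
      t * exp (t * g) * (2 * (w (lab j))\<^sup>2 / g\<^sup>2 * X 1 j + 1 / (2 * V) * X 3 j)" if j: "j < m" for j
  proof (cases "r j = 0")
    case False
    then have r: "0 < r j" using r0[of j] by simp
    have eq: "\<phi> (bump j k) $ l = \<phi> k $ l" if "l \<noteq> lab j" for l
      using inc[OF j, of l] that r unfolding r_def[symmetric] by (simp add: mult_le_0_iff)
    have le: "\<bar>\<phi> (bump j k) $ lab j - \<phi> k $ lab j\<bar> \<le> \<delta> j"
      using inc[OF j, of "lab j"] r unfolding r_def[symmetric] \<delta>_def by (simp add: field_simps)
    have "r j * psi (exp (t * shifted_norm a V (\<phi> (bump j k)))) (exp (t * g)) \<le>
       r j * (t * exp (t * g) * (2 * (w (lab j))\<^sup>2 / g\<^sup>2 * (\<delta> j * (exp (t * \<delta> j) - 1)) +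
         1 / (2 * V) * (\<delta> j ^ 3 * (exp (t * \<delta> j) - 1))))"
      unfolding g_def w_def using r by (intro mult_left_mono shifted_norm_increment V eq le t) auto
    also have "\<dots> = t * exp (t * g) * (2 * (w (lab j))\<^sup>2 / g\<^sup>2 * X 1 j + 1 / (2 * V) * X 3 j)"
      by (simp add: X_def algebra_simps)
    finally show ?thesis .
  qed (simp add: X_def)
  have group: "(\<Sum>j<m. f (lab j) j) = (\<Sum>i\<in>UNIV. \<Sum>j\<in>{j. j < m \<and> lab j = i}. f i j)" for f :: "'i \<Rightarrow> nat \<Rightarrow> real"
  proof -
    have "(\<Sum>j<m. f (lab j) j) = (\<Sum>i\<in>UNIV. \<Sum>j\<in>{j \<in> {..<m}. lab j = i}. f (lab j) j)"
      by (rule sum.group[symmetric]) auto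
    also have "\<dots> = (\<Sum>i\<in>UNIV. \<Sum>j\<in>{j. j < m \<and> lab j = i}. f i j)"
      by (intro sum.cong) auto
    finally show ?thesis .
  qed
  have "(\<Sum>j<m. 2 * (w (lab j))\<^sup>2 / g\<^sup>2 * X 1 j) = (\<Sum>i\<in>UNIV. 2 * (w i)\<^sup>2 / g\<^sup>2 * (\<Sum>j\<in>{j. j < m \<and> lab j = i}. X 1 j))"
    by (subst group[of "\<lambda>i j. 2 * (w i)\<^sup>2 / g\<^sup>2 * X 1 j"]) (simp add: sum_distrib_left)
  also have "\<dots> \<le> (\<Sum>i\<in>UNIV. 2 * (w i)\<^sup>2 / g\<^sup>2 * K1)"
    using K0 K1 by (intro sum_mono mult_left_mono XK) auto
  also have "\<dots> = 2 * ((norm (\<phi> k - a))\<^sup>2 / g\<^sup>2) * K1"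
    unfolding power2_norm_vec w_def[symmetric]
    by (simp add: sum_distrib_left sum_distrib_right sum_divide_distrib mult_ac)
  also have "\<dots> \<le> 2 * 1 * K1"
    using gpos gg V K0 by (intro mult_right_mono mult_left_mono) auto
  finally have 1: "(\<Sum>j<m. 2 * (w (lab j))\<^sup>2 / g\<^sup>2 * X 1 j) \<le> 2 * K1" by simp
  have "(\<Sum>j<m. 1 / (2 * V) * X 3 j) = (\<Sum>i\<in>UNIV. 1 / (2 * V) * (\<Sum>j\<in>{j. j < m \<and> lab j = i}. X 3 j))"
    by (subst group[of "\<lambda>i j. 1 / (2 * V) * X 3 j"]) (simp add: sum_distrib_left)
  also have "\<dots> \<le> (\<Sum>i\<in>(UNIV :: 'i set). 1 / (2 * V) * K3)"
    using K0 K3 V by (intro sum_mono mult_left_mono XK) auto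
  finally have 2: "(\<Sum>j<m. 1 / (2 * V) * X 3 j) \<le> real CARD('i) / (2 * V) * K3" by simp
  have "(\<Sum>j<m. r j * psi (exp (t * shifted_norm a V (\<phi> (bump j k)))) (exp (t * g))) \<le>
      (\<Sum>j<m. t * exp (t * g) * (2 * (w (lab j))\<^sup>2 / g\<^sup>2 * X 1 j + 1 / (2 * V) * X 3 j))"
    by (intro sum_mono step) simp
  also have "\<dots> = t * exp (t * g) * ((\<Sum>j<m. 2 * (w (lab j))\<^sup>2 / g\<^sup>2 * X 1 j) + (\<Sum>j<m. 1 / (2 * V) * X 3 j))"
    unfolding sum.distrib[symmetric] by (rule sum_distrib_left[symmetric])
  also have "\<dots> \<le> t * exp (t * g) * (\<eta> t / 4)"
  proof (rule mult_left_mono)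
    have "(\<Sum>j<m. 2 * (w (lab j))\<^sup>2 / g\<^sup>2 * X 1 j) + (\<Sum>j<m. 1 / (2 * V) * X 3 j)
        \<le> 2 * K1 + real CARD('i) / (2 * V) * K3"
      by (rule add_mono[OF 1 2])
    also have "\<dots> = (8 * K1 + 2 * real CARD('i) / V * K3) / 4"
      using V by (simp add: field_simps)
    also have "\<dots> \<le> \<eta> t / 4" by (rule divide_right_mono[OF K]) simp
    finally show "(\<Sum>j<m. 2 * (w (lab j))\<^sup>2 / g\<^sup>2 * X 1 j) + (\<Sum>j<m. 1 / (2 * V) * X 3 j) \<le> \<eta> t / 4" .
  qed (use t in auto)
  finally show ?thesis by (simp add: r_def g_def)
qed

lemma expectation_counts:
  fixes f :: "(nat \<Rightarrow> nat) \<Rightarrow> real"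
  assumes A: "cells A m"
  shows "measure_pmf.expectation (Pi_pmf {..<m} 0 (\<lambda>j. pois (measure M (A j)))) f = expectation (\<lambda>\<omega>. f (counts A m \<omega>))"
  unfolding distr_counts_cells[OF A, symmetric]
  by (rule integral_distr[OF measurable_counts_cells[OF A]]) simp

text \<open>Each cell is represented by \<open>n\<close> bits of probability \<open>r j / n\<close>.
  The sum of \<open>psi\<close> weighted by these probabilities does not depend on \<open>n\<close>,
  so \<open>energy_bound\<close> serves every large \<open>n\<close> and the bound survives the
  Poisson limit. Boundedness of the function makes both sides converge.\<close>

lemma exp_moment_counts:
  fixes \<phi> :: "(nat \<Rightarrow> nat) \<Rightarrow> real ^ 'i"
  assumes eb: "exp_bound b V \<tau> \<eta>"
    and A: "cells A m" and lab: "\<And>j. j < m \<Longrightarrow> A j \<subseteq> c -` {lab j}"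
    and B: "\<And>j. j < m \<Longrightarrow> (\<integral>\<^sup>+x. ennreal (b x) * indicator (A j) x \<partial>M) = ennreal (B j)" "\<And>j. 0 \<le> B j"
    and inc: "\<And>j i k. j < m \<Longrightarrow> measure M (A j) * \<bar>\<phi> (bump j k) $ i - \<phi> k $ i\<bar> \<le> (if lab j = i then B j else 0)"
    and R: "\<And>k i. \<bar>\<phi> k $ i\<bar> \<le> R"
  shows "expectation (\<lambda>\<omega>. exp (\<tau> * shifted_norm a V (\<phi> (counts A m \<omega>)))) \<le>
    exp (\<tau> * expectation (\<lambda>\<omega>. shifted_norm a V (\<phi> (counts A m \<omega>))) + integral {0..\<tau>} \<eta>)"
proof -
  have V: "0 < V" and \<tau>: "0 < \<tau>" and mono: "mono_on {0..\<tau>} \<eta>" and pos: "\<And>s. 0 \<le> s \<Longrightarrow> s \<le> \<tau> \<Longrightarrow> 0 \<le> \<eta> s"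
    and cv: "\<And>s t. 0 < s \<Longrightarrow> s \<le> t \<Longrightarrow> t \<le> \<tau> \<Longrightarrow> \<eta> s / s \<le> \<eta> t / t"
    using eb by (auto simp: exp_bound_def)
  define g where "g k = shifted_norm a V (\<phi> k)" for k
  define C where "C = shifted_norm a V 0 + real CARD('i) * R"
  have gC: "\<bar>g k\<bar> \<le> C" for k
  proof -
    have "norm (\<phi> k) \<le> (\<Sum>i\<in>UNIV. \<bar>\<phi> k $ i\<bar>)" by (rule norm_le_l1_cart)
    also have "\<dots> \<le> (\<Sum>i\<in>(UNIV :: 'i set). R)" by (intro sum_mono R)
    finally have "norm (\<phi> k) \<le> real CARD('i) * R" by simp
    then show ?thesis
      using shifted_norm_lipschitz[of V a "\<phi> k" 0] shifted_norm_nonneg[of V a] V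
      unfolding g_def C_def by (smt (verit) diff_zero)
  qed
  define r where "r j = measure M (A j)" for j
  define xs where "xs n = concat (map (\<lambda>j. replicate n (j, r j / real n)) [0..<m])" for n
  have "\<forall>\<^sub>F n in sequentially. \<forall>j\<in>{..<m}. r j \<le> real n \<and> 0 < n"
    by (intro eventually_ball_finite ballI eventually_conj eventually_gt_at_top)
      (auto intro: filterlim_at_top[THEN iffD1, rule_format, OF filterlim_real_sequentially])
  then have ev: "\<forall>\<^sub>F n in sequentially. bern (xs n) (\<lambda>k. exp (\<tau> * g k)) (\<lambda>_. 0) \<le>
      exp (\<tau> * bern (xs n) g (\<lambda>_. 0) + integral {0..\<tau>} \<eta>)"
    using eventually_gt_at_top[of 0]
  proof eventually_elim
    case (elim n)
    have w: "weights (xs n)"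
      using elim by (auto simp: weights_def xs_def r_def divide_le_eq_1)
    show ?case
    proof (rule bern_herbst[OF w \<tau> mono pos cv])
      fix t k assume t: "0 < t" "t \<le> \<tau>"
      have "(\<Sum>a\<leftarrow>xs n. snd a * psi (exp (t * g (bump (fst a) k))) (exp (t * g k))) =
          (\<Sum>j\<leftarrow>[0..<m]. r j * psi (exp (t * g (bump j k))) (exp (t * g k)))"
        unfolding xs_def sum_list_concat_replicate using elim by simp
      also have "\<dots> = (\<Sum>j<m. r j * psi (exp (t * g (bump j k))) (exp (t * g k)))"
        by (simp add: interv_sum_list_conv_sum_set_nat atLeast0LessThan)
      also have "\<dots> \<le> t * exp (t * g k) * (\<eta> t / 4)"
        unfolding r_def g_def by (rule energy_bound[where \<phi>=\<phi> and lab=lab and B=B, OF eb t A lab B inc])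
      finally show "(\<Sum>a\<leftarrow>xs n. snd a * psi (exp (t * g (bump (fst a) k))) (exp (t * g k))) \<le> t * exp (t * g k) * (\<eta> t / 4)" .
    qed auto
  qed
  have lim: "(\<lambda>n. bern (xs n) f (\<lambda>_. 0)) \<longlonglongrightarrow> expectation (\<lambda>\<omega>. f (counts A m \<omega>))"
    if "\<And>k. \<bar>f k\<bar> \<le> D" for f D
    using bern_concat_tendsto[of "[0..<m]" r f D "\<lambda>_. 0"] that
    unfolding xs_def[symmetric] expectation_counts[OF A, symmetric]
    by (simp add: r_def atLeast0LessThan)
  have "expectation (\<lambda>\<omega>. exp (\<tau> * g (counts A m \<omega>))) \<le> exp (\<tau> * expectation (\<lambda>\<omega>. g (counts A m \<omega>)) + integral {0..\<tau>} \<eta>)"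
  proof (rule tendsto_le[OF _ _ _ ev])
    show "(\<lambda>n. bern (xs n) (\<lambda>k. exp (\<tau> * g k)) (\<lambda>_. 0)) \<longlonglongrightarrow> expectation (\<lambda>\<omega>. exp (\<tau> * g (counts A m \<omega>)))"
      using gC \<tau> by (intro lim[of _ "exp (\<tau> * C)"]) (auto simp: abs_le_iff)
    show "(\<lambda>n. exp (\<tau> * bern (xs n) g (\<lambda>_. 0) + integral {0..\<tau>} \<eta>)) \<longlonglongrightarrow>
        exp (\<tau> * expectation (\<lambda>\<omega>. g (counts A m \<omega>)) + integral {0..\<tau>} \<eta>)"
      by (intro tendsto_intros lim[OF gC])
  qed simp
  then show ?thesis by (simp add: g_def)
qed

text \<open>\<open>Y\<close> consists of the conditional expectations of all \<open>F i\<close>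
  given the same counts. A point in the cell \<open>A j\<close> changes only the functional with the
  label \<open>lab j\<close>, which is what the energy bound asks of the increments.\<close>

lemma exp_moment_bounded_approx:
  fixes F :: "'i \<Rightarrow> 'x set \<Rightarrow> real"
  assumes eb: "exp_bound b V \<tau> \<eta>"
    and F: "\<And>i. F i \<in> borel_measurable P" and R: "\<And>i \<omega>. \<bar>F i \<omega>\<bar> \<le> R"
    and inc: "\<And>i. AE x in M. AE \<omega> in P. \<bar>F i (insert x \<omega>) - F i \<omega>\<bar> \<le> (if c x = i then b x else 0)"
    and \<epsilon>: "0 < \<epsilon>"
  shows "\<exists>Y :: 'x set \<Rightarrow> real ^ 'i. (\<forall>i. (\<lambda>\<omega>. Y \<omega> $ i) \<in> borel_measurable P) \<and>
    (\<forall>i \<omega>. \<bar>Y \<omega> $ i\<bar> \<le> R) \<and> (\<forall>i. (\<integral>\<omega>. \<bar>F i \<omega> - Y \<omega> $ i\<bar> \<partial>P) < \<epsilon>) \<and>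
    expectation (\<lambda>\<omega>. exp (\<tau> * shifted_norm a V (Y \<omega>))) \<le>
      exp (\<tau> * expectation (\<lambda>\<omega>. shifted_norm a V (Y \<omega>)) + integral {0..\<tau>} \<eta>)"
proof -
  obtain A m where A: "cells A m"
    and err: "\<And>i. (\<integral>\<omega>. \<bar>F i \<omega> - cond_exp_counts A m (F i) (counts A m \<omega>)\<bar> \<partial>P) < \<epsilon>"
    by (rule cond_exp_counts_approx[OF F R \<epsilon>]) (rule that)
  define \<phi> where "\<phi> k = (\<chi> i. cond_exp_counts A m (F i) k)" for k
  have bm: "b \<in> borel_measurable M" and b0: "\<And>x. 0 \<le> b x"
    using eb by (auto simp: exp_bound_def)
  have gd: "good (A j)" if "j < m" for j using A that by (simp add: cells_def)
  have "\<forall>j. \<exists>i. j < m \<longrightarrow> A j \<subseteq> c -` {i}" using gd by (auto simp: good_def)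
  then obtain lab where lab: "\<And>j. j < m \<Longrightarrow> A j \<subseteq> c -` {lab j}" by metis
  define B where "B j = enn2real (\<integral>\<^sup>+x. ennreal (b x) * indicator (A j) x \<partial>M)" for j
  have B: "(\<integral>\<^sup>+x. ennreal (b x) * indicator (A j) x \<partial>M) = ennreal (B j)" if "j < m" for j
    unfolding B_def using exp_bound_integral_cell[OF eb gd[OF that]] by simp
  have B0: "0 \<le> B j" for j by (simp add: B_def)
  have R': "\<bar>\<phi> k $ i\<bar> \<le> R" for k i
    unfolding \<phi>_def using cond_exp_counts_bounded[OF A F R] by simp
  have inc': "measure M (A j) * \<bar>\<phi> (bump j k) $ i - \<phi> k $ i\<bar> \<le> (if lab j = i then B j else 0)"
    if j: "j < m" for j i k
  proof -
    let ?b = "\<lambda>x. if lab j = i then b x else 0"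
    have "measure M (A j) * \<bar>cond_exp_counts A m (F i) (bump j k) - cond_exp_counts A m (F i) k\<bar>
        \<le> (if lab j = i then B j else 0)"
    proof (rule cond_exp_counts_increment[OF A j F R, where b="?b"])
      show "AE x in M. x \<in> A j \<longrightarrow> (AE \<omega> in P. \<bar>F i (insert x \<omega>) - F i \<omega>\<bar> \<le> ?b x)"
        using inc[of i]
      proof eventually_elim
        case (elim x)
        show ?case
        proof
          assume "x \<in> A j"
          then have "c x = lab j" using lab[OF j] by auto
          then show "AE \<omega> in P. \<bar>F i (insert x \<omega>) - F i \<omega>\<bar> \<le> ?b x" using elim by simp
        qed
      qed
      show "(\<integral>\<^sup>+x. ennreal (?b x) * indicator (A j) x \<partial>M) \<le> ennreal (if lab j = i then B j else 0)"
        using B[OF j] by simp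
    qed (use bm b0 B0 in auto)
    then show ?thesis by (simp add: \<phi>_def)
  qed
  have "expectation (\<lambda>\<omega>. exp (\<tau> * shifted_norm a V (\<phi> (counts A m \<omega>)))) \<le>
    exp (\<tau> * expectation (\<lambda>\<omega>. shifted_norm a V (\<phi> (counts A m \<omega>))) + integral {0..\<tau>} \<eta>)"
    by (rule exp_moment_counts[OF eb A lab B B0 inc' R'])
  moreover have "(\<lambda>\<omega>. \<phi> (counts A m \<omega>) $ i) \<in> borel_measurable P" for i
    by (rule measurable_fun_counts[OF A])
  moreover have "(\<integral>\<omega>. \<bar>F i \<omega> - \<phi> (counts A m \<omega>) $ i\<bar> \<partial>P) < \<epsilon>" for i
    using err[of i] by (simp add: \<phi>_def)
  ultimately show ?thesis using R'
    by (intro exI[of _ "\<lambda>\<omega>. \<phi> (counts A m \<omega>)"] conjI allI)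
qed


text \<open>Integrability of the exponential is part of the conclusion, so the left side is a
  nonnegative integral and passes to the limit by Fatou. On the right only the mean of a Lipschitz
  function occurs, for which convergence in L1 is enough.\<close>

lemma exp_moment:
  fixes F :: "'i \<Rightarrow> 'x set \<Rightarrow> real"
  assumes eb: "exp_bound b V \<tau> \<eta>"
    and F: "\<And>i. integrable P (F i)"
    and inc: "\<And>i. AE x in M. AE \<omega> in P. \<bar>F i (insert x \<omega>) - F i \<omega>\<bar> \<le> (if c x = i then b x else 0)"
  shows "(\<integral>\<^sup>+\<omega>. ennreal (exp (\<tau> * shifted_norm a V (\<chi> i. F i \<omega>))) \<partial>P) \<le>
    ennreal (exp (\<tau> * expectation (\<lambda>\<omega>. shifted_norm a V (\<chi> i. F i \<omega>)) + integral {0..\<tau>} \<eta>))"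
proof -
  let ?s = "shifted_norm a V"
  have V: "0 < V" and \<tau>: "0 < \<tau>" using eb by (auto simp: exp_bound_def)
  define X where "X \<omega> = (\<chi> i. F i \<omega>)" for \<omega>
  have Fm[measurable]: "F i \<in> borel_measurable P" for i using F[of i] by simp
  \<comment> \<open>Truncation is 1-Lipschitz, so the bound on the increments is inherited.\<close>
  define G where "G n i \<omega> = max (- real n) (min (real n) (F i \<omega>))" for n i \<omega>
  have Gm[measurable]: "G n i \<in> borel_measurable P" for n i unfolding G_def by measurable
  have GR: "\<bar>G n i \<omega>\<bar> \<le> real n" for n i \<omega> by (auto simp: G_def)
  have GF: "\<bar>G n i \<omega> - G n i \<omega>'\<bar> \<le> \<bar>F i \<omega> - F i \<omega>'\<bar>" for n i \<omega> \<omega>'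
    by (auto simp: G_def)
  have Ginc: "AE x in M. AE \<omega> in P. \<bar>G n i (insert x \<omega>) - G n i \<omega>\<bar> \<le> (if c x = i then b x else 0)" for n i
    using inc[of i]
  proof eventually_elim
    case (elim x)
    then show ?case by eventually_elim (rule order_trans[OF GF])
  qed
  define Q where "Q n Y \<longleftrightarrow> (\<forall>i. (\<lambda>\<omega>. Y \<omega> $ i) \<in> borel_measurable P) \<and>
    (\<forall>i \<omega>. \<bar>Y \<omega> $ i\<bar> \<le> real n) \<and> (\<forall>i. (\<integral>\<omega>. \<bar>G n i \<omega> - Y \<omega> $ i\<bar> \<partial>P) < 1 / real (Suc n)) \<and>
    expectation (\<lambda>\<omega>. exp (\<tau> * ?s (Y \<omega>))) \<le>
      exp (\<tau> * expectation (\<lambda>\<omega>. ?s (Y \<omega>)) + integral {0..\<tau>} \<eta>)"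
    for n and Y :: "'x set \<Rightarrow> real ^ 'i"
  have "\<exists>Y. Q n Y" for n
    unfolding Q_def by (rule exp_moment_bounded_approx[OF eb Gm GR Ginc]) simp
  then obtain Y where Y: "\<And>n. Q n (Y n)" by metis
  have Ym: "(\<lambda>\<omega>. Y n \<omega> $ i) \<in> borel_measurable P" and YR: "\<bar>Y n \<omega> $ i\<bar> \<le> real n"
    and Yerr: "(\<integral>\<omega>. \<bar>G n i \<omega> - Y n \<omega> $ i\<bar> \<partial>P) < 1 / real (Suc n)"
    and Yexp: "expectation (\<lambda>\<omega>. exp (\<tau> * ?s (Y n \<omega>))) \<le>
      exp (\<tau> * expectation (\<lambda>\<omega>. ?s (Y n \<omega>)) + integral {0..\<tau>} \<eta>)" for n i \<omega>
    using Y[of n] unfolding Q_def by blast+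
  note [measurable] = Ym
  have Ymv: "Y n \<in> borel_measurable P" for n by (rule borel_measurable_vec) (rule Ym)
  have Xm: "X \<in> borel_measurable P" by (rule borel_measurable_vec) (simp add: X_def)
  have sY[measurable]: "(\<lambda>\<omega>. ?s (Y n \<omega>)) \<in> borel_measurable P" for n
    by (rule measurable_compose[OF Ymv borel_measurable_shifted_norm])
  have sX[measurable]: "(\<lambda>\<omega>. ?s (X \<omega>)) \<in> borel_measurable P"
    by (rule measurable_compose[OF Xm borel_measurable_shifted_norm])
  have iY: "integrable P (\<lambda>\<omega>. Y n \<omega> $ i)" for n i
    by (rule integrable_const_bound[where B="real n"]) (use YR in auto)
  have iG: "integrable P (G n i)" for n i
    by (rule integrable_const_bound[where B="real n"]) (use GR in auto)
  define D where "D n \<omega> = (\<Sum>i\<in>UNIV. \<bar>Y n \<omega> $ i - F i \<omega>\<bar>)" for n \<omega>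
  have iD: "integrable P (D n)" for n
    unfolding D_def by (intro Bochner_Integration.integrable_sum integrable_abs Bochner_Integration.integrable_diff iY F)
  have le_D: "\<bar>?s (Y n \<omega>) - ?s (X \<omega>)\<bar> \<le> D n \<omega>" for n \<omega>
  proof -
    have "\<bar>?s (Y n \<omega>) - ?s (X \<omega>)\<bar> \<le> norm (Y n \<omega> - X \<omega>)"
      by (rule shifted_norm_lipschitz) (use V in simp)
    also have "\<dots> \<le> (\<Sum>i\<in>UNIV. \<bar>(Y n \<omega> - X \<omega>) $ i\<bar>)" by (rule norm_le_l1_cart)
    finally show ?thesis by (simp add: D_def X_def)
  qed
  have D_lim: "(\<lambda>n. \<integral>\<omega>. D n \<omega> \<partial>P) \<longlonglongrightarrow> 0"
  proof -
    have "(\<lambda>n. \<integral>\<omega>. \<bar>Y n \<omega> $ i - F i \<omega>\<bar> \<partial>P) \<longlonglongrightarrow> 0" for i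
    proof (rule tendsto_sandwich[OF _ _ tendsto_const])
      show "\<forall>\<^sub>F n in sequentially. 0 \<le> (\<integral>\<omega>. \<bar>Y n \<omega> $ i - F i \<omega>\<bar> \<partial>P)" by simp
      have "(\<integral>\<omega>. \<bar>Y n \<omega> $ i - F i \<omega>\<bar> \<partial>P) \<le> 1 / real (Suc n) + (\<integral>\<omega>. \<bar>G n i \<omega> - F i \<omega>\<bar> \<partial>P)" for n
      proof -
        have "(\<integral>\<omega>. \<bar>Y n \<omega> $ i - F i \<omega>\<bar> \<partial>P) \<le> (\<integral>\<omega>. \<bar>G n i \<omega> - Y n \<omega> $ i\<bar> + \<bar>G n i \<omega> - F i \<omega>\<bar> \<partial>P)"
          using iY iG F by (intro integral_mono) auto
        also have "\<dots> = (\<integral>\<omega>. \<bar>G n i \<omega> - Y n \<omega> $ i\<bar> \<partial>P) + (\<integral>\<omega>. \<bar>G n i \<omega> - F i \<omega>\<bar> \<partial>P)"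
          using iY iG F by (intro Bochner_Integration.integral_add) auto
        finally show ?thesis using Yerr[of n i] by linarith
      qed
      then show "\<forall>\<^sub>F n in sequentially. (\<integral>\<omega>. \<bar>Y n \<omega> $ i - F i \<omega>\<bar> \<partial>P) \<le>
          1 / real (Suc n) + (\<integral>\<omega>. \<bar>G n i \<omega> - F i \<omega>\<bar> \<partial>P)" by simp
      have "(\<lambda>n. \<integral>\<omega>. \<bar>G n i \<omega> - F i \<omega>\<bar> \<partial>P) \<longlonglongrightarrow> (\<integral>\<omega>. 0 \<partial>P)"
      proof (rule integral_dominated_convergence[where w="\<lambda>\<omega>. 2 * \<bar>F i \<omega>\<bar>"])
        show "AE \<omega> in P. (\<lambda>n. \<bar>G n i \<omega> - F i \<omega>\<bar>) \<longlonglongrightarrow> 0"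
        proof (rule AE_I2, rule tendsto_eventually)
          fix \<omega>
          show "\<forall>\<^sub>F n in sequentially. \<bar>G n i \<omega> - F i \<omega>\<bar> = 0"
            using eventually_ge_at_top[of "nat \<lceil>\<bar>F i \<omega>\<bar>\<rceil>"]
          proof eventually_elim
            case (elim n)
            then have "\<bar>F i \<omega>\<bar> \<le> real n" by linarith
            then show ?case by (auto simp: G_def)
          qed
        qed
        show "AE \<omega> in P. norm \<bar>G n i \<omega> - F i \<omega>\<bar> \<le> 2 * \<bar>F i \<omega>\<bar>" for n
          by (rule AE_I2) (auto simp: G_def)
      qed (use F in auto)
      then show "(\<lambda>n. 1 / real (Suc n) + (\<integral>\<omega>. \<bar>G n i \<omega> - F i \<omega>\<bar> \<partial>P)) \<longlonglongrightarrow> 0"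
        using tendsto_add[OF lim_1_over_n[THEN LIMSEQ_Suc]] by fastforce
    qed
    then have "(\<lambda>n. \<Sum>i\<in>UNIV. \<integral>\<omega>. \<bar>Y n \<omega> $ i - F i \<omega>\<bar> \<partial>P) \<longlonglongrightarrow> 0"
      by (rule tendsto_null_sum)
    moreover have "(\<integral>\<omega>. D n \<omega> \<partial>P) = (\<Sum>i\<in>UNIV. \<integral>\<omega>. \<bar>Y n \<omega> $ i - F i \<omega>\<bar> \<partial>P)" for n
      unfolding D_def using iY F by (intro Bochner_Integration.integral_sum) auto
    ultimately show ?thesis by simp
  qed
  define u where "u n \<omega> = ?s (Y n \<omega>) - ?s (X \<omega>)" for n \<omega>
  have um[measurable]: "u n \<in> borel_measurable P" for n unfolding u_def by measurable
  have iu: "integrable P (u n)" for n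
    by (rule Bochner_Integration.integrable_bound[OF iD[of n]])
      (use le_D in \<open>auto simp: u_def intro: order_trans[OF _ abs_ge_self]\<close>)
  have u_lim: "(\<lambda>n. \<integral>\<omega>. norm (u n \<omega>) \<partial>P) \<longlonglongrightarrow> 0"
  proof (rule tendsto_sandwich[OF _ _ tendsto_const D_lim])
    have "norm (u n \<omega>) \<le> D n \<omega>" for n \<omega> using le_D by (simp add: u_def)
    then show "\<forall>\<^sub>F n in sequentially. (\<integral>\<omega>. norm (u n \<omega>) \<partial>P) \<le> (\<integral>\<omega>. D n \<omega> \<partial>P)"
      by (intro always_eventually allI integral_mono integrable_norm iu iD)
  qed simp
  have Yi: "integrable P (\<lambda>\<omega>. ?s (Y n \<omega>))" for n
  proof (rule Bochner_Integration.integrable_bound)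
    show "integrable P (\<lambda>\<omega>. ?s 0 + (\<Sum>i\<in>UNIV. \<bar>Y n \<omega> $ i\<bar>))"
      by (intro Bochner_Integration.integrable_add Bochner_Integration.integrable_sum integrable_abs iY) simp
    show "AE \<omega> in P. norm (?s (Y n \<omega>)) \<le> norm (?s 0 + (\<Sum>i\<in>UNIV. \<bar>Y n \<omega> $ i\<bar>))"
    proof (rule AE_I2)
      fix \<omega>
      have "\<bar>?s (Y n \<omega>) - ?s 0\<bar> \<le> norm (Y n \<omega> - 0)" using V by (intro shifted_norm_lipschitz) simp
      then have "?s (Y n \<omega>) \<le> ?s 0 + (\<Sum>i\<in>UNIV. \<bar>Y n \<omega> $ i\<bar>)"
        using norm_le_l1_cart[of "Y n \<omega>"] by simp
      then show "norm (?s (Y n \<omega>)) \<le> norm (?s 0 + (\<Sum>i\<in>UNIV. \<bar>Y n \<omega> $ i\<bar>))"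
        using shifted_norm_nonneg[of V a "Y n \<omega>"] V by simp
    qed
  qed measurable
  have Xi: "integrable P (\<lambda>\<omega>. ?s (X \<omega>))"
  proof -
    have "integrable P (\<lambda>\<omega>. ?s (Y 0 \<omega>) - u 0 \<omega>)" by (intro Bochner_Integration.integrable_diff Yi iu)
    then show ?thesis by (simp add: u_def)
  qed
  have E_lim: "(\<lambda>n. expectation (\<lambda>\<omega>. ?s (Y n \<omega>))) \<longlonglongrightarrow> expectation (\<lambda>\<omega>. ?s (X \<omega>))"
  proof -
    have "(\<lambda>n. expectation (u n)) \<longlonglongrightarrow> 0"
      by (rule tendsto_0_le[OF u_lim, where K=1]) (simp add: integral_norm_bound)
    moreover have "expectation (u n) = expectation (\<lambda>\<omega>. ?s (Y n \<omega>)) - expectation (\<lambda>\<omega>. ?s (X \<omega>))" for n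
      unfolding u_def using Yi Xi by (rule Bochner_Integration.integral_diff)
    ultimately show ?thesis using LIM_zero_iff[of "\<lambda>n. expectation (\<lambda>\<omega>. ?s (Y n \<omega>))"] by simp
  qed
  \<comment> \<open>Fatou's lemma is applied along a subsequence, since convergence in L1 yields
    convergence almost everywhere only for a subsequence.\<close>
  obtain r where r: "strict_mono r" and AEr: "AE \<omega> in P. (\<lambda>n. u (r n) \<omega>) \<longlonglongrightarrow> 0"
    using tendsto_L1_AE_subseq[OF iu u_lim] by blast
  define e where "e n \<omega> = ennreal (exp (\<tau> * ?s (Y (r n) \<omega>)))" for n \<omega>
  have "(\<integral>\<^sup>+\<omega>. ennreal (exp (\<tau> * ?s (X \<omega>))) \<partial>P) = (\<integral>\<^sup>+\<omega>. liminf (\<lambda>n. e n \<omega>) \<partial>P)"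
  proof (rule nn_integral_cong_AE)
    show "AE \<omega> in P. ennreal (exp (\<tau> * ?s (X \<omega>))) = liminf (\<lambda>n. e n \<omega>)"
      using AEr
    proof eventually_elim
      case (elim \<omega>)
      then have "(\<lambda>n. ?s (Y (r n) \<omega>)) \<longlonglongrightarrow> ?s (X \<omega>)" unfolding u_def by (simp add: LIM_zero_iff)
      then have "(\<lambda>n. e n \<omega>) \<longlonglongrightarrow> ennreal (exp (\<tau> * ?s (X \<omega>)))"
        unfolding e_def by (intro tendsto_intros)
      then show ?case by (intro lim_imp_Liminf[symmetric]) auto
    qed
  qed
  also have "\<dots> \<le> liminf (\<lambda>n. \<integral>\<^sup>+\<omega>. e n \<omega> \<partial>P)"
    by (rule nn_integral_liminf) (simp add: e_def)
  also have "\<dots> \<le> liminf (\<lambda>n. ennreal (exp (\<tau> * expectation (\<lambda>\<omega>. ?s (Y (r n) \<omega>)) + integral {0..\<tau>} \<eta>)))"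
  proof (intro Liminf_mono always_eventually allI)
    fix n
    define C where "C = ?s 0 + real CARD('i) * real (r n)"
    have bd: "?s (Y (r n) \<omega>) \<le> C" for \<omega>
    proof -
      have "\<bar>?s (Y (r n) \<omega>) - ?s 0\<bar> \<le> norm (Y (r n) \<omega> - 0)" using V by (intro shifted_norm_lipschitz) simp
      also have "\<dots> \<le> (\<Sum>i\<in>UNIV. \<bar>Y (r n) \<omega> $ i\<bar>)" using norm_le_l1_cart[of "Y (r n) \<omega>"] by simp
      also have "\<dots> \<le> (\<Sum>i\<in>(UNIV :: 'i set). real (r n))" by (intro sum_mono YR)
      finally show ?thesis by (simp add: C_def)
    qed
    have "integrable P (\<lambda>\<omega>. exp (\<tau> * ?s (Y (r n) \<omega>)))"
      by (rule integrable_const_bound[where B="exp (\<tau> * C)"]) (use bd \<tau> in auto)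
    then have "(\<integral>\<^sup>+\<omega>. e n \<omega> \<partial>P) = ennreal (expectation (\<lambda>\<omega>. exp (\<tau> * ?s (Y (r n) \<omega>))))"
      unfolding e_def by (intro nn_integral_eq_integral) auto
    also have "\<dots> \<le> ennreal (exp (\<tau> * expectation (\<lambda>\<omega>. ?s (Y (r n) \<omega>)) + integral {0..\<tau>} \<eta>))"
      by (intro ennreal_leI Yexp)
    finally show "(\<integral>\<^sup>+\<omega>. e n \<omega> \<partial>P) \<le> ennreal (exp (\<tau> * expectation (\<lambda>\<omega>. ?s (Y (r n) \<omega>)) + integral {0..\<tau>} \<eta>))" .
  qed
  also have "\<dots> = ennreal (exp (\<tau> * expectation (\<lambda>\<omega>. ?s (X \<omega>)) + integral {0..\<tau>} \<eta>))"
  proof (rule lim_imp_Liminf)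
    have "(\<lambda>n. expectation (\<lambda>\<omega>. ?s (Y (r n) \<omega>))) \<longlonglongrightarrow> expectation (\<lambda>\<omega>. ?s (X \<omega>))"
      using LIMSEQ_subseq_LIMSEQ[OF E_lim r] by (simp add: comp_def)
    then show "(\<lambda>n. ennreal (exp (\<tau> * expectation (\<lambda>\<omega>. ?s (Y (r n) \<omega>)) + integral {0..\<tau>} \<eta>)))
        \<longlonglongrightarrow> ennreal (exp (\<tau> * expectation (\<lambda>\<omega>. ?s (X \<omega>)) + integral {0..\<tau>} \<eta>))"
      by (intro tendsto_intros)
  qed simp
  finally show ?thesis by (simp add: X_def)
qed

end

section \<open>The generalized inverse\<close>

text \<open>The witness \<open>t\<close> keeps the sets under the infimum nonempty for all levels up
  to \<open>x\<close>; an infimum over the empty set would carry no information.\<close>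

lemma gen_inverse_set:
  assumes "0 < t" "ennreal x \<le> h t" "r \<le> x"
  shows "0 \<le> gen_inverse h r" "gen_inverse h r \<le> gen_inverse h x" "gen_inverse h x \<le> t"
    "\<And>s. 0 < s \<Longrightarrow> s < gen_inverse h r \<Longrightarrow> h s < ennreal r"
proof -
  let ?S = "\<lambda>r. {t. 0 < t \<and> ennreal r \<le> h t}"
  have bdd: "bdd_below (?S r)" for r by (rule bdd_belowI[of _ 0]) auto
  have t: "t \<in> ?S x" using assms by simp
  have sub: "?S x \<subseteq> ?S r" using assms(3) by (auto intro: order_trans[OF ennreal_leI])
  show "gen_inverse h x \<le> t" unfolding gen_inverse_def by (rule cInf_lower[OF t bdd])
  show "gen_inverse h r \<le> gen_inverse h x"
    unfolding gen_inverse_def using t by (intro cInf_superset_mono bdd sub) auto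
  show "0 \<le> gen_inverse h r"
    unfolding gen_inverse_def using t sub by (intro cInf_greatest) auto
  fix s :: real assume s: "0 < s" "s < gen_inverse h r"
  then have "s \<notin> ?S r" unfolding gen_inverse_def using cInf_lower[OF _ bdd] by (meson not_le)
  then show "h s < ennreal r" using s(1) by auto
qed

text \<open>If the function is not integrable, its integral is 0 by convention and the bound holds
  because \<open>0 \<le> I\<close>. Thus the integral of the generalized inverse can be estimated
  from its nonnegative integral alone.\<close>

lemma set_integral_le_nn_integral:
  fixes f :: "'a \<Rightarrow> real"
  assumes f: "\<And>x. x \<in> A \<Longrightarrow> 0 \<le> f x" and I: "(\<integral>\<^sup>+x. ennreal (f x) * indicator A x \<partial>M) \<le> ennreal I" "0 \<le> I"
  shows "(LINT x:A|M. f x) \<le> I"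
proof (cases "integrable M (\<lambda>x. indicator A x * f x)")
  case True
  have "ennreal (LINT x:A|M. f x) = (\<integral>\<^sup>+x. ennreal (indicator A x * f x) \<partial>M)"
    unfolding set_lebesgue_integral_def using True f
    by (subst nn_integral_eq_integral) (auto split: split_indicator)
  also have "\<dots> = (\<integral>\<^sup>+x. ennreal (f x) * indicator A x \<partial>M)"
    by (rule nn_integral_cong) (auto split: split_indicator)
  also have "\<dots> \<le> ennreal I" by (rule I)
  finally show ?thesis using I(2) by simp
next
  case False
  then show ?thesis unfolding set_lebesgue_integral_def using I(2) by (simp add: not_integrable_integral_eq)
qed

text \<open>Layer cake: \<open>h\<^sup>-\<^sup>1(r)\<close> is at most the length of \<open>{s. 0 < s < h\<^sup>-\<^sup>1(x), h(s) < r}\<close>.\<close>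

lemma gen_inverse_integral_le:
  assumes x: "0 < x" and t: "0 < t" "ennreal x \<le> h t"
    and \<tau>: "\<tau> = gen_inverse h x" "0 < \<tau>"
    and \<eta>: "mono_on {0..\<tau>} \<eta>" "\<And>s. 0 < s \<Longrightarrow> s < \<tau> \<Longrightarrow> h s = ennreal (\<eta> s)"
      "\<And>s. 0 < s \<Longrightarrow> s < \<tau> \<Longrightarrow> 0 \<le> \<eta> s"
  shows "(LINT r:{0..x}|lborel. gen_inverse h r) \<le> \<tau> * x - integral {0..\<tau>} \<eta>"
proof -
  note gi = gen_inverse_set[where h=h and t=t and x=x, OF t]
  have \<eta>_less: "\<eta> s < r" if "0 < s" "s < gen_inverse h r" "r \<le> x" for s r
  proof -
    have "s < \<tau>" using that gi(2)[OF that(3)] \<tau> by simp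
    then have "ennreal (\<eta> s) < ennreal r"
      using gi(4)[OF that(3) that(1,2)] \<eta>(2)[OF that(1)] by simp
    then show ?thesis using \<eta>(3)[OF that(1) \<open>s < \<tau>\<close>] by (simp add: ennreal_less_iff)
  qed
  \<comment> \<open>For fixed \<open>s\<close> the levels \<open>r\<close> with
    \<open>\<eta> s < r \<le> x\<close> fill an interval of length \<open>q s\<close>. At
    \<open>\<tau>\<close> itself \<open>h\<close> may exceed \<open>x\<close>, so the end points are
    given the value 0, which leaves the integral unchanged.\<close>
  define q where "q s = (if 0 < s \<and> s < \<tau> then x - \<eta> s else 0)" for s
  have q0: "0 \<le> q s" for s
    using \<eta>_less[of s x] \<tau> by (auto simp: q_def intro: less_imp_le)
  have \<eta>_int: "\<eta> integrable_on {0..\<tau>}" by (rule integrable_on_mono_on[OF \<eta>(1)])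
  have "((\<lambda>s. x - \<eta> s) has_integral (\<tau> * x - integral {0..\<tau>} \<eta>)) {0..\<tau>}"
    using has_integral_diff[OF has_integral_const_real[of x 0 \<tau>] integrable_integral[OF \<eta>_int]] \<tau>
    by simp
  then have q_int: "(q has_integral (\<tau> * x - integral {0..\<tau>} \<eta>)) {0..\<tau>}"
    by (rule has_integral_spike_finite[of "{0, \<tau>}", rotated 2]) (auto simp: q_def)
  \<comment> \<open>Extended by 0, the function is Borel on the whole line, as the exchange of the
    two integrals requires.\<close>
  define \<eta>' where "\<eta>' s = (if s \<in> {0..\<tau>} then \<eta> s else 0)" for s
  have [measurable]: "\<eta>' \<in> borel_measurable borel"
  proof -
    have "\<eta> \<in> borel_measurable (restrict_space borel {0..\<tau>})"
      by (rule borel_measurable_mono_on_fnc[OF \<eta>(1)])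
    then have "(\<lambda>s. indicator {0..\<tau>} s *\<^sub>R \<eta> s) \<in> borel_measurable borel"
      by (subst (asm) borel_measurable_restrict_space_iff) auto
    moreover have "\<eta>' = (\<lambda>s. indicator {0..\<tau>} s *\<^sub>R \<eta> s)" by (auto simp: fun_eq_iff \<eta>'_def)
    ultimately show ?thesis by simp
  qed
  have "(\<integral>\<^sup>+r. ennreal (gen_inverse h r) * indicator {0..x} r \<partial>lborel) \<le>
      (\<integral>\<^sup>+r. (\<integral>\<^sup>+s. indicator {s. 0 < s \<and> s < \<tau> \<and> \<eta>' s < r \<and> r \<le> x} s \<partial>lborel) \<partial>lborel)"
  proof (rule nn_integral_mono)
    fix r
    show "ennreal (gen_inverse h r) * indicator {0..x} r \<le>
        (\<integral>\<^sup>+s. indicator {s. 0 < s \<and> s < \<tau> \<and> \<eta>' s < r \<and> r \<le> x} s \<partial>lborel)"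
    proof (cases "r \<in> {0..x}")
      case True
      then have r: "r \<le> x" by simp
      have "ennreal (gen_inverse h r) = emeasure lborel {0<..<gen_inverse h r}"
        using gi(1)[OF r] by simp
      also have "\<dots> = (\<integral>\<^sup>+s. indicator {0<..<gen_inverse h r} s \<partial>lborel)" by simp
      also have "\<dots> \<le> (\<integral>\<^sup>+s. indicator {s. 0 < s \<and> s < \<tau> \<and> \<eta>' s < r \<and> r \<le> x} s \<partial>lborel)"
        using \<eta>_less[OF _ _ r] gi(2)[OF r] r \<tau>
        by (intro nn_integral_mono) (auto simp: \<eta>'_def split: split_indicator)
      finally show ?thesis using True by simp
    qed simp
  qed
  also have "\<dots> = (\<integral>\<^sup>+s. (\<integral>\<^sup>+r. indicator {s. 0 < s \<and> s < \<tau> \<and> \<eta>' s < r \<and> r \<le> x} s \<partial>lborel) \<partial>lborel)"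
    by (rule lborel_pair.Fubini') measurable
  also have "\<dots> \<le> (\<integral>\<^sup>+s. indicator {0..\<tau>} s * ennreal (q s) \<partial>lborel)"
  proof (rule nn_integral_mono)
    fix s
    show "(\<integral>\<^sup>+r. indicator {s. 0 < s \<and> s < \<tau> \<and> \<eta>' s < r \<and> r \<le> x} s \<partial>lborel) \<le> indicator {0..\<tau>} s * ennreal (q s)"
    proof (cases "0 < s \<and> s < \<tau>")
      case True
      then have "(\<integral>\<^sup>+r. indicator {s. 0 < s \<and> s < \<tau> \<and> \<eta>' s < r \<and> r \<le> x} s \<partial>lborel) =
          (\<integral>\<^sup>+r. indicator {\<eta> s<..x} r \<partial>lborel)"
        by (intro nn_integral_cong) (auto simp: \<eta>'_def split: split_indicator)
      also have "\<dots> = ennreal (x - \<eta> s)" using q0[of s] True by (simp add: q_def)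
      finally show ?thesis using True by (simp add: q_def)
    next
      case False
      then have "(\<integral>\<^sup>+r. indicator {s. 0 < s \<and> s < \<tau> \<and> \<eta>' s < r \<and> r \<le> x} s \<partial>lborel) = (\<integral>\<^sup>+r. 0 \<partial>(lborel :: real measure))"
        by (intro nn_integral_cong) (auto split: split_indicator)
      then show ?thesis by simp
    qed
  qed
  also have "\<dots> = ennreal (\<tau> * x - integral {0..\<tau>} \<eta>)"
    using nn_integral_has_integral_lebesgue[OF q0 q_int] by (simp add: nn_integral_completion ennreal_mult' ennreal_indicator)
  finally have le: "(\<integral>\<^sup>+r. ennreal (gen_inverse h r) * indicator {0..x} r \<partial>lborel) \<le> ennreal (\<tau> * x - integral {0..\<tau>} \<eta>)" .
  have "0 \<le> \<tau> * x - integral {0..\<tau>} \<eta>" using has_integral_nonneg[OF q_int] q0 by simp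
  with le show ?thesis
    by (intro set_integral_le_nn_integral) (use gi(1) in auto)
qed

section \<open>Poisson configurations on the disjoint union\<close>

lemma space_X_measure [simp]: "space (X_measure \<nu>) = UNIV"
  unfolding X_measure_def by (simp add: space_measure_of_conv)

lemma topspace_X_topology [simp]: "topspace X_topology = UNIV"
  by (simp add: X_topology_def)

lemma emeasure_compact_radon:
  assumes \<nu>: "radon_measure \<nu>" and K: "compact K"
  shows "emeasure \<nu> K < \<infinity>"
proof -
  have s: "sets \<nu> = sets borel" using \<nu> by (simp add: radon_measure_def)
  obtain U where U: "\<And>x. open (U x)" "\<And>x. x \<in> U x" "\<And>x. emeasure \<nu> (U x) < \<infinity>"
    using \<nu> unfolding radon_measure_def by metis
  have "K \<subseteq> (\<Union>x\<in>K. U x)" using U(2) by auto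
  then obtain C where C: "C \<subseteq> K" "finite C" "K \<subseteq> (\<Union>x\<in>C. U x)"
    using compactE_image[OF K, of K U] U(1) by blast
  have "emeasure \<nu> K \<le> emeasure \<nu> (\<Union>x\<in>C. U x)"
    using C U(1) by (intro emeasure_mono) (auto simp: s)
  also have "\<dots> \<le> (\<Sum>x\<in>C. emeasure \<nu> (U x))"
    using C U(1) by (intro emeasure_subadditive_finite) (auto simp: s)
  also have "\<dots> < \<infinity>" using C(2) U(3) by (simp add: less_top)
  finally show ?thesis .
qed

text \<open>For \<open>inner\<close>: a set of infinite measure has infinite measure in one of the
  finitely many copies. There inner regularity provides compact subsets of large measure, and local
  finiteness makes the measure of a compact set finite.\<close>

lemma poisson_space_X:
  fixes \<nu> :: "'n::finite \<Rightarrow> 'y::real_normed_vector measure"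
  assumes radon: "\<And>i. radon_measure (\<nu> i)" and diffuse: "\<And>i. diffuse (\<nu> i)"
    and P: "poisson_measure X_topology (X_measure \<nu>) P"
  shows "poisson_space X_topology (X_measure \<nu>) P fst"
proof
  have s: "sets (\<nu> i) = sets borel" for i using radon[of i] by (simp add: radon_measure_def)
  have rect: "{i} \<times> B \<in> sets (X_measure \<nu>)" if "B \<in> sets borel" for i and B :: "'y set"
    using that by (auto intro!: pair_measureI)
  have em: "emeasure (X_measure \<nu>) A = (\<Sum>i\<in>UNIV. emeasure (\<nu> i) (Pair i -` A))"
    if "A \<in> sets (X_measure \<nu>)" for A
    using that s by (intro emeasure_X_measure) auto
  have em_rect: "emeasure (X_measure \<nu>) ({i} \<times> B) = emeasure (\<nu> i) B" if "B \<in> sets borel" for i and B :: "'y set"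
  proof -
    have "emeasure (X_measure \<nu>) ({i} \<times> B) = (\<Sum>j\<in>UNIV. if j = i then emeasure (\<nu> i) B else 0)"
      unfolding em[OF rect[OF that]] by (intro sum.cong) (auto simp: vimage_def)
    then show ?thesis by simp
  qed
  show "poisson_measure X_topology (X_measure \<nu>) P" by (rule P)
  show "space (X_measure \<nu>) = UNIV" "topspace X_topology = (UNIV :: ('n \<times> 'y) set)" by auto
  show "{x} \<in> sets (X_measure \<nu>)" for x :: "'n \<times> 'y"
    using rect[of "{snd x}" "fst x"] by simp
  show "emeasure (X_measure \<nu>) {x} = 0" for x :: "'n \<times> 'y"
    using em_rect[of "{snd x}" "fst x"] diffuse[of "fst x"] by (simp add: diffuse_def)
  show "fst -` {i} \<in> sets (X_measure \<nu>)" for i :: 'n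
  proof -
    have "fst -` {i} = {i} \<times> (UNIV :: 'y set)" by auto
    then show ?thesis using rect[of UNIV i] by simp
  qed
  fix A :: "('n \<times> 'y) set" and n :: nat
  assume A: "A \<in> sets (X_measure \<nu>)" "emeasure (X_measure \<nu>) A = \<infinity>"
  have "\<exists>i. emeasure (\<nu> i) (Pair i -` A) = \<infinity>"
    using A(2) unfolding em[OF A(1)] by (auto simp: ennreal_sum_eq_top)
  then obtain i where i: "emeasure (\<nu> i) (Pair i -` A) = \<infinity>" by blast
  have Ai: "Pair i -` A \<in> sets borel" using A(1) by (auto intro!: sets_Pair1)
  have top: "(SUP K\<in>{K. compact K \<and> K \<subseteq> Pair i -` A}. emeasure (\<nu> i) K) = \<infinity>"
    using radon[of i] Ai i unfolding radon_measure_def by metis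
  have "of_nat n < (SUP K\<in>{K. compact K \<and> K \<subseteq> Pair i -` A}. emeasure (\<nu> i) K)"
    unfolding top by (simp add: of_nat_less_top)
  then obtain K where K: "compact K" "K \<subseteq> Pair i -` A" "of_nat n < emeasure (\<nu> i) K"
    by (auto simp: less_SUP_iff)
  have Kb: "K \<in> sets borel" using K(1) by (simp add: borel_compact)
  show "\<exists>B\<in>sets (X_measure \<nu>). B \<subseteq> A \<and> of_nat n \<le> emeasure (X_measure \<nu>) B \<and> emeasure (X_measure \<nu>) B < \<infinity>"
  proof (rule bexI[of _ "{i} \<times> K"])
    show "{i} \<times> K \<in> sets (X_measure \<nu>)" by (rule rect[OF Kb])
    show "{i} \<times> K \<subseteq> A \<and> of_nat n \<le> emeasure (X_measure \<nu>) ({i} \<times> K) \<and> emeasure (X_measure \<nu>) ({i} \<times> K) < \<infinity>"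
      unfolding em_rect[OF Kb] using K emeasure_compact_radon[OF radon K(1)] by auto
  qed
qed

text \<open>Restricted to the copy \<open>i\<close>, the measure on the disjoint union is the image
  of \<open>\<nu> i\<close> under \<open>y \<mapsto> (i, y)\<close>.\<close>

lemma nn_integral_X_measure:
  fixes \<nu> :: "'n::finite \<Rightarrow> 'y::real_normed_vector measure"
  assumes s: "\<And>i. sets (\<nu> i) = sets borel" and f: "f \<in> borel_measurable (X_measure \<nu>)"
  shows "(\<integral>\<^sup>+x. f x * indicator (fst -` {i}) x \<partial>X_measure \<nu>) = (\<integral>\<^sup>+y. f (i, y) \<partial>\<nu> i)"
proof -
  let ?X = "count_space (UNIV :: 'n set) \<Otimes>\<^sub>M (borel :: 'y measure)"
  have si: "fst -` {i} \<in> sets ?X"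
  proof -
    have "fst -` {i} = {i} \<times> (UNIV :: 'y set)" by auto
    then show ?thesis by (auto intro!: pair_measureI)
  qed
  have Pi: "Pair i \<in> measurable (\<nu> i) ?X"
  proof -
    have "Pair i \<in> measurable borel ?X" by (rule measurable_Pair1') simp
    then show ?thesis by (simp cong: measurable_cong_sets add: s)
  qed
  have eq: "density (X_measure \<nu>) (indicator (fst -` {i})) = distr (\<nu> i) ?X (Pair i)"
  proof (rule measure_eqI)
    fix A assume "A \<in> sets (density (X_measure \<nu>) (indicator (fst -` {i})))"
    then have A: "A \<in> sets ?X" by simp
    have Ai: "A \<inter> fst -` {i} \<in> sets ?X" using A si by auto
    have "emeasure (density (X_measure \<nu>) (indicator (fst -` {i}))) A = emeasure (X_measure \<nu>) (fst -` {i} \<inter> A)"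
      using A si by (intro emeasure_restricted) auto
    also have "\<dots> = (\<Sum>j\<in>UNIV. emeasure (\<nu> j) (Pair j -` (fst -` {i} \<inter> A)))"
      using Ai by (intro emeasure_X_measure s) (simp add: Int_commute)
    also have "\<dots> = (\<Sum>j\<in>UNIV. if j = i then emeasure (\<nu> i) (Pair i -` A) else 0)"
      by (intro sum.cong) (auto simp: vimage_def)
    also have "\<dots> = emeasure (\<nu> i) (Pair i -` A \<inter> space (\<nu> i))"
      using sets_eq_imp_space_eq[OF s[of i]] by simp
    also have "\<dots> = emeasure (distr (\<nu> i) ?X (Pair i)) A"
      by (rule emeasure_distr[symmetric]) (use Pi A in auto)
    finally show "emeasure (density (X_measure \<nu>) (indicator (fst -` {i}))) A = emeasure (distr (\<nu> i) ?X (Pair i)) A" .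
  qed simp
  have f': "f \<in> borel_measurable ?X" using f by (simp cong: measurable_cong_sets)
  have "(\<integral>\<^sup>+x. f x * indicator (fst -` {i}) x \<partial>X_measure \<nu>) = (\<integral>\<^sup>+x. indicator (fst -` {i}) x * f x \<partial>X_measure \<nu>)"
    by (simp add: mult.commute)
  also have "\<dots> = (\<integral>\<^sup>+x. f x \<partial>density (X_measure \<nu>) (indicator (fst -` {i})))"
    using f si by (intro nn_integral_density[symmetric] borel_measurable_indicator) simp_all
  also have "\<dots> = (\<integral>\<^sup>+y. f (i, y) \<partial>\<nu> i)"
    unfolding eq by (rule nn_integral_distr[OF Pi]) (use f' in simp)
  finally show ?thesis .
qed

lemma AE_X_measureI:
  fixes \<nu> :: "'n::finite \<Rightarrow> 'y::real_normed_vector measure"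
  assumes s: "\<And>i. sets (\<nu> i) = sets borel" and ae: "\<And>i. AE y in \<nu> i. Q (i, y)"
  shows "AE x in X_measure \<nu>. Q x"
proof -
  have "\<exists>N. N \<in> null_sets (\<nu> i) \<and> {y \<in> space (\<nu> i). \<not> Q (i, y)} \<subseteq> N" for i
    using ae[of i] by (auto simp: eventually_ae_filter)
  then obtain N where N: "\<And>i. N i \<in> null_sets (\<nu> i)" "\<And>i. {y \<in> space (\<nu> i). \<not> Q (i, y)} \<subseteq> N i" by metis
  let ?N = "\<Union>i. {i} \<times> N i"
  have Nb: "N i \<in> sets borel" for i using N(1)[of i] s by auto
  have Ns: "?N \<in> sets (count_space UNIV \<Otimes>\<^sub>M borel)"
    using Nb by (intro sets.finite_UN) (auto intro!: pair_measureI)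
  have "emeasure (X_measure \<nu>) ?N = (\<Sum>i\<in>UNIV. emeasure (\<nu> i) (Pair i -` ?N))"
    by (rule emeasure_X_measure[OF s Ns])
  also have "\<dots> = (\<Sum>i\<in>UNIV. emeasure (\<nu> i) (N i))"
    by (intro sum.cong arg_cong2[where f=emeasure]) auto
  also have "\<dots> = 0" using N(1) by auto
  finally have "?N \<in> null_sets (X_measure \<nu>)" using Ns by auto
  moreover have "{x \<in> space (X_measure \<nu>). \<not> Q x} \<subseteq> ?N"
    using N(2) sets_eq_imp_space_eq[OF s] by fastforce
  ultimately show ?thesis by (rule AE_I')
qed

lemma component_insert:
  "component i (insert x \<omega>) = (if fst x = i then insert (snd x) (component i \<omega>) else component i \<omega>)"
  by (cases x) (auto simp: component_def)

lemma component_configuration: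
  assumes "\<omega> \<in> configurations (X_topology :: ('n \<times> 'y::topological_space) topology)"
  shows "component i \<omega> \<in> configurations euclidean"
  unfolding configurations_def
proof (intro CollectI conjI ballI)
  fix y :: 'y
  obtain U where U: "openin X_topology U" "(i, y) \<in> U" "finite (\<omega> \<inter> U)"
    using assms unfolding configurations_def by auto
  then obtain V W where VW: "openin (discrete_topology UNIV) V" "openin euclidean W" "i \<in> V" "y \<in> W" "V \<times> W \<subseteq> U"
    using U(1)[unfolded X_topology_def openin_prod_topology_alt, rule_format, OF U(2)] by auto
  have "Pair i ` (component i \<omega> \<inter> W) \<subseteq> \<omega> \<inter> U" using VW by (auto simp: component_def)
  then have "finite (Pair i ` (component i \<omega> \<inter> W))" using U(3) by (rule finite_subset)
  then have "finite (component i \<omega> \<inter> W)" by (rule finite_imageD) (simp add: inj_on_def)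
  then show "\<exists>U. openin euclidean U \<and> y \<in> U \<and> finite (component i \<omega> \<inter> U)" using VW by blast
qed simp

lemma num_points_component:
  "num_points (component i \<omega>) A = of_nat k \<longleftrightarrow> num_points \<omega> ({i} \<times> A) = of_nat k"
proof -
  have eq: "\<omega> \<inter> {i} \<times> A = Pair i ` (component i \<omega> \<inter> A)" by (auto simp: component_def)
  have inj: "inj_on (Pair i) (component i \<omega> \<inter> A)" by (simp add: inj_on_def)
  show ?thesis
    unfolding num_points_eq_iff eq using inj by (simp add: card_image finite_image_iff)
qed

lemma measurable_component:
  fixes \<nu> :: "'n::finite \<Rightarrow> 'y::real_normed_vector measure"
  assumes "poisson_space X_topology (X_measure \<nu>) P fst"
  shows "component i \<in> measurable P (config_algebra euclidean borel)"
  unfolding config_algebra_def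
proof (rule measurable_measure_of)
  interpret poisson_space X_topology "X_measure \<nu>" P fst by (rule assms)
  show "component i \<in> space P \<rightarrow> configurations euclidean"
    unfolding space_P by (auto intro: component_configuration)
  fix E assume "E \<in> {{\<omega> \<in> configurations euclidean. num_points \<omega> A = of_nat k} |A k. A \<in> sets (borel :: 'y measure)}"
  then obtain A k where E: "E = {\<omega> \<in> configurations euclidean. num_points \<omega> A = of_nat k}" and A: "A \<in> sets borel" by blast
  have "component i -` E \<inter> space P = {\<omega> \<in> space P. num_points \<omega> ({i} \<times> A) = of_nat k}"
  proof -
    have "component i -` E \<inter> space P = {\<omega> \<in> space P. num_points (component i \<omega>) A = of_nat k}"
      unfolding E space_P by (auto intro: component_configuration)
    then show ?thesis unfolding num_points_component .
  qed
  moreover have "{i} \<times> A \<in> sets (X_measure \<nu>)" using A by (auto intro!: pair_measureI)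
  ultimately show "component i -` E \<inter> space P \<in> sets P" using sets_num_points by simp
qed auto

section \<open>The function \<open>h\<close>\<close>

lemma ennreal_expm1_mono: "z \<le> w \<Longrightarrow> ennreal_expm1 z \<le> ennreal_expm1 w"
  unfolding ennreal_expm1_def
  by (auto simp: top_unique less_top intro!: ennreal_leI enn2real_mono)

lemma ennreal_expm1_ennreal: "0 \<le> r \<Longrightarrow> ennreal_expm1 (ennreal r) = ennreal (exp r - 1)"
  by (simp add: ennreal_expm1_def)

lemma ennreal_expm1_eq_0_iff: "ennreal_expm1 z = 0 \<longleftrightarrow> z = 0"
  by (cases z) (auto simp: ennreal_expm1_def ennreal_eq_0_iff)

lemma borel_measurable_ennreal_expm1 [measurable]: "ennreal_expm1 \<in> borel_measurable borel"
  unfolding ennreal_expm1_def by measurable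

text \<open>By convexity \<open>(exp (t z) - 1) / t\<close> increases with \<open>t\<close>.
  Integrated, this is the monotonicity of \<open>\<eta> t / t\<close> on which Herbst's argument
  relies; written with products it also makes sense for infinite values.\<close>

lemma ennreal_expm1_scale:
  assumes "0 < s" "s \<le> t"
  shows "ennreal t * ennreal_expm1 (ennreal s * z) \<le> ennreal s * ennreal_expm1 (ennreal t * z)"
proof (cases z)
  case (real r)
  have "exp ((s / t) * (t * r)) - 1 \<le> (s / t) * (exp (t * r) - 1)"
    using assms by (intro exp_times_le) auto
  then have le: "t * (exp (s * r) - 1) \<le> s * (exp (t * r) - 1)"
    using assms by (simp add: field_simps)
  have "ennreal t * ennreal_expm1 (ennreal s * z) = ennreal (t * (exp (s * r) - 1))"
    using assms real by (simp add: ennreal_mult[symmetric] ennreal_expm1_ennreal)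
  also have "\<dots> \<le> ennreal (s * (exp (t * r) - 1))" by (rule ennreal_leI[OF le])
  also have "\<dots> = ennreal s * ennreal_expm1 (ennreal t * z)"
    using assms real by (simp add: ennreal_mult[symmetric] ennreal_expm1_ennreal)
  finally show ?thesis .
next
  case top
  then show ?thesis using assms by (simp add: ennreal_mult_top ennreal_expm1_def)
qed

definition h_term :: "'y::real_normed_vector measure \<Rightarrow> ennreal \<Rightarrow> nat \<Rightarrow> real \<Rightarrow> ennreal" where
  "h_term \<nu> \<beta> p t = \<beta> ^ p * (\<integral>\<^sup>+y. ennreal (norm y) ^ p *
     ennreal_expm1 (ennreal t * \<beta> * ennreal (norm y)) \<partial>\<nu>)"

lemma MAX_eq_SUP: "(MAX i. f i) = (SUP i. f i)" for f :: "'n::finite \<Rightarrow> ennreal"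
  by (rule cSup_eq_Max[symmetric]) auto

lemma h_fun_eq:
  "h_fun \<nu> \<beta> m t = 8 * (SUP i. h_term (\<nu> i) (\<beta> i) 1 t) +
     2 * of_nat CARD('n) / ennreal m ^ 2 * (SUP i. h_term (\<nu> i) (\<beta> i) 3 t)"
  for \<nu> :: "'n::finite \<Rightarrow> _"
  unfolding h_fun_def h_term_def MAX_eq_SUP by simp

lemma h_term_mono: "s \<le> t \<Longrightarrow> h_term \<nu> \<beta> p s \<le> h_term \<nu> \<beta> p t"
  unfolding h_term_def
  by (intro mult_left_mono nn_integral_mono ennreal_expm1_mono mult_right_mono ennreal_leI) auto

lemma h_term_scale:
  assumes s: "sets \<nu> = sets borel" and st: "0 < s" "s \<le> t"
  shows "ennreal t * h_term \<nu> \<beta> p s \<le> ennreal s * h_term \<nu> \<beta> p t"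
proof -
  have m: "(\<lambda>y. ennreal (norm y) ^ p * ennreal_expm1 (ennreal r * \<beta> * ennreal (norm y))) \<in> borel_measurable \<nu>" for r
    unfolding measurable_cong_sets[OF s refl] by measurable
  have "ennreal t * h_term \<nu> \<beta> p s = \<beta> ^ p * (\<integral>\<^sup>+y. ennreal t * (ennreal (norm y) ^ p *
      ennreal_expm1 (ennreal s * \<beta> * ennreal (norm y))) \<partial>\<nu>)"
    unfolding h_term_def nn_integral_cmult[OF m] by (simp only: mult_ac)
  also have "\<dots> \<le> \<beta> ^ p * (\<integral>\<^sup>+y. ennreal s * (ennreal (norm y) ^ p *
      ennreal_expm1 (ennreal t * \<beta> * ennreal (norm y))) \<partial>\<nu>)"
  proof (intro mult_left_mono nn_integral_mono)
    fix y
    have "ennreal (norm y) ^ p * (ennreal t * ennreal_expm1 (ennreal s * (\<beta> * ennreal (norm y)))) \<le>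
        ennreal (norm y) ^ p * (ennreal s * ennreal_expm1 (ennreal t * (\<beta> * ennreal (norm y))))"
      by (intro mult_left_mono ennreal_expm1_scale st) auto
    then show "ennreal t * (ennreal (norm y) ^ p * ennreal_expm1 (ennreal s * \<beta> * ennreal (norm y))) \<le>
        ennreal s * (ennreal (norm y) ^ p * ennreal_expm1 (ennreal t * \<beta> * ennreal (norm y)))"
      by (simp add: mult_ac)
  qed auto
  also have "\<dots> = ennreal s * h_term \<nu> \<beta> p t"
    unfolding h_term_def nn_integral_cmult[OF m] by (simp only: mult_ac)
  finally show ?thesis .
qed

lemma h_fun_mono: "s \<le> t \<Longrightarrow> h_fun \<nu> \<beta> m s \<le> h_fun \<nu> \<beta> m t"
  unfolding h_fun_eq by (intro add_mono mult_left_mono SUP_mono') (auto intro: h_term_mono)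

lemma h_fun_scale:
  assumes s: "\<And>i. sets (\<nu> i) = sets borel" and st: "0 < s" "s \<le> t"
  shows "ennreal t * h_fun \<nu> \<beta> m s \<le> ennreal s * h_fun \<nu> \<beta> m t"
proof -
  have 1: "ennreal t * (SUP i. h_term (\<nu> i) (\<beta> i) p s) \<le> ennreal s * (SUP i. h_term (\<nu> i) (\<beta> i) p t)" for p
    unfolding SUP_mult_left_ennreal by (intro SUP_mono' h_term_scale s st)
  have "ennreal t * (a * (SUP i. h_term (\<nu> i) (\<beta> i) p s)) \<le> ennreal s * (a * (SUP i. h_term (\<nu> i) (\<beta> i) p t))" for p a
    using mult_left_mono[OF 1[of p], of a] by (simp add: mult_ac)
  then show ?thesis unfolding h_fun_eq distrib_left by (intro add_mono)
qed

text \<open>The criterion is the same for every positive exponent: if the term with exponent 3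
  vanishes, so does the one with exponent 1. This excludes \<open>E|F - E F| = 0\<close> in the main
  proof.\<close>

lemma h_term_eq_0_AE:
  assumes s: "sets \<nu> = sets borel" and t: "0 < t" and p: "0 < p"
  shows "h_term \<nu> \<beta> p t = 0 \<longleftrightarrow> \<beta> = 0 \<or> (AE y in \<nu>. y = 0)"
proof -
  have m: "(\<lambda>y. ennreal (norm y) ^ p * ennreal_expm1 (ennreal t * \<beta> * ennreal (norm y))) \<in> borel_measurable \<nu>"
    unfolding measurable_cong_sets[OF s refl] by measurable
  have "ennreal (norm y) ^ p * ennreal_expm1 (ennreal t * \<beta> * ennreal (norm y)) = 0 \<longleftrightarrow> \<beta> = 0 \<or> y = 0" for y :: 'a
    using t p by (auto simp: ennreal_expm1_eq_0_iff ennreal_eq_0_iff)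
  then have "h_term \<nu> \<beta> p t = 0 \<longleftrightarrow> \<beta> = 0 \<or> (AE y in \<nu>. \<beta> = 0 \<or> y = 0)"
    unfolding h_term_def using p by (simp add: nn_integral_0_iff_AE[OF m])
  then show ?thesis by auto
qed

text \<open>An infinite factor leaves a finite product only if the other factor is 0. For a diffuse
  measure the conclusion means that the measure is zero, so an infinite \<open>\<beta> i\<close>
  does no harm.\<close>

lemma h_term_finite_AE:
  assumes s: "sets \<nu> = sets borel" and t: "0 < t" and fin: "h_term \<nu> \<infinity> 1 t < \<infinity>"
  shows "AE y in \<nu>. y = 0"
proof -
  have "h_term \<nu> \<infinity> 1 t = 0"
    using fin unfolding h_term_def by (auto simp: ennreal_top_mult split: if_splits)
  then show ?thesis using h_term_eq_0_AE[OF s t, of 1] by simp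
qed

text \<open>\<open>Lim\<close> has a meaning only if the limit exists; by monotonicity it does and
  equals the supremum over \<open>0 < t < t\<^sub>0\<close>. A number below the supremum is exceeded
  at some such \<open>t\<close>.\<close>

lemma left_limit_less:
  assumes mono: "\<And>s t. s \<le> t \<Longrightarrow> h s \<le> h t" and t0: "0 < t\<^sub>0" and a: "a < left_limit h t\<^sub>0"
  obtains t where "0 < t" "ereal t < t\<^sub>0" "a < h t"
proof (rule ccontr)
  assume "\<not> thesis"
  then have le: "h t \<le> a" if "0 < t" "ereal t < t\<^sub>0" for t
    using that \<open>\<And>t. 0 < t \<Longrightarrow> ereal t < t\<^sub>0 \<Longrightarrow> a < h t \<Longrightarrow> thesis\<close> not_le by blast
  let ?L = "SUP t\<in>{t. 0 < t \<and> ereal t < t\<^sub>0}. h t"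
  have real: "\<exists>r. u = ereal r \<and> 0 < r" if "0 < u" "u < t\<^sub>0" for u
    using that by (cases u) auto
  have "((\<lambda>u. h (real_of_ereal u)) \<longlongrightarrow> ?L) (at_left t\<^sub>0)"
  proof (rule order_tendstoI)
    fix l assume "l < ?L"
    then obtain t where t: "0 < t" "ereal t < t\<^sub>0" "l < h t" by (auto simp: less_SUP_iff)
    show "\<forall>\<^sub>F u in at_left t\<^sub>0. l < h (real_of_ereal u)"
      unfolding eventually_at_left[OF t(2)]
    proof (intro exI[of _ "ereal t"] conjI allI impI t(2))
      fix u assume u: "ereal t < u" "u < t\<^sub>0"
      then obtain r where r: "u = ereal r" using real[of u] t(1) by (metis ereal_less(2) order.strict_trans)
      then have "h t \<le> h (real_of_ereal u)" using u by (intro mono) auto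
      then show "l < h (real_of_ereal u)" using t(3) by simp
    qed
  next
    fix l assume l: "?L < l"
    show "\<forall>\<^sub>F u in at_left t\<^sub>0. h (real_of_ereal u) < l"
      unfolding eventually_at_left[OF t0]
    proof (intro exI[of _ 0] conjI allI impI t0)
      fix u assume u: "0 < u" "u < t\<^sub>0"
      then obtain r where r: "u = ereal r" "0 < r" using real by blast
      then have "h r \<le> ?L" using u by (intro SUP_upper) auto
      then show "h (real_of_ereal u) < l" using l r by simp
    qed
  qed
  moreover have "at_left t\<^sub>0 \<noteq> bot"
    using t0 by (auto simp: trivial_limit_def eventually_at_left[OF t0] dest: dense)
  ultimately have "left_limit h t\<^sub>0 = ?L" unfolding left_limit_def by (intro tendsto_Lim)
  also have "?L \<le> a" by (rule SUP_least) (use le in auto)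
  finally show False using a by simp
qed

section \<open>The deviation inequality\<close>

text \<open>For a fixed nonzero \<open>y\<close> the bound holds almost surely under either reading
  of the supremum. The exceptional event may depend on \<open>y\<close>, which suffices as the
  increments are needed for almost every point, almost surely.\<close>

lemma beta_AE:
  assumes P: "space P = configurations X_topology"
    and \<beta>: "\<beta> = beta_sup F \<or> \<beta> = beta_esssup P F" and y: "y \<noteq> 0"
  shows "AE \<omega> in P. ennreal (\<bar>diff_op y (F i) (component i \<omega>)\<bar> / norm y) \<le> \<beta> i"
  using \<beta>
proof
  assume b: "\<beta> = beta_sup F"
  show ?thesis
  proof (rule AE_I2)
    fix \<omega> assume "\<omega> \<in> space P"
    then have \<omega>: "\<omega> \<in> configurations X_topology" using P by simp
    show "ennreal (\<bar>diff_op y (F i) (component i \<omega>)\<bar> / norm y) \<le> \<beta> i"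
      unfolding b beta_sup_def using y by (intro SUP_upper2[of y] SUP_upper[OF \<omega>]) auto
  qed
next
  assume b: "\<beta> = beta_esssup P F"
  have le: "esssup P (\<lambda>\<omega>. ennreal (\<bar>diff_op y (F i) (component i \<omega>)\<bar> / norm y)) \<le> \<beta> i"
    unfolding b beta_esssup_def using y by (intro SUP_upper) auto
  show ?thesis
    using esssup_AE[of "\<lambda>\<omega>. ennreal (\<bar>diff_op y (F i) (component i \<omega>)\<bar> / norm y)" P]
    by eventually_elim (rule order_trans[OF _ le])
qed

lemma (in prob_space) expectation_power2_le:
  fixes X :: "'a \<Rightarrow> real"
  assumes "integrable M X" "integrable M (\<lambda>\<omega>. (X \<omega>)\<^sup>2)"
  shows "(expectation X)\<^sup>2 \<le> expectation (\<lambda>\<omega>. (X \<omega>)\<^sup>2)"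
proof -
  have "variance X = expectation (\<lambda>\<omega>. (X \<omega>)\<^sup>2) - (expectation X)\<^sup>2"
    by (rule variance_eq) (use assms in auto)
  then show ?thesis using variance_positive[of X] by linarith
qed

theorem proposition3p1:
  fixes \<nu> :: "'n::finite \<Rightarrow> 'y::real_normed_vector measure"
    and P :: "('n \<times> 'y) set measure"
    and F :: "'n \<Rightarrow> 'y set \<Rightarrow> real"
    and f :: "real ^ 'n \<Rightarrow> real"
    and c x :: real
    and \<beta> :: "'n \<Rightarrow> ennreal"
    and h :: "real \<Rightarrow> ennreal"
    and t\<^sub>0 :: ereal
  assumes radon: "\<And>i. radon_measure (\<nu> i)"
    and diffuse: "\<And>i. diffuse (\<nu> i)"
    and P: "poisson_measure X_topology (X_measure \<nu>) P"
    and f: "c-lipschitz_on UNIV f" and c: "0 < c"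
    and F: "\<And>i. F i \<in> borel_measurable (config_algebra euclidean borel)"
    and \<beta>: "\<beta> = beta_sup F \<or> \<beta> = beta_esssup P F"
    and h: "h = h_fun \<nu> \<beta>
      (prob_space.expectation P (\<lambda>\<omega>. norm (functional_vector F \<omega> -
          (\<integral>\<omega>'. functional_vector F \<omega>' \<partial>P))))"
    and t0: "0 < t\<^sub>0"
    and h_finite: "\<And>t. 0 \<le> t \<Longrightarrow> ereal t < t\<^sub>0 \<Longrightarrow> h t < \<infinity>"
    and x: "0 < x" "ennreal x < left_limit h t\<^sub>0"
  shows "measure P {\<omega> \<in> space P. f (functional_vector F \<omega>) \<ge>
            prob_space.expectation P (\<lambda>\<omega>'. f (functional_vector F \<omega>'))
            + c * sqrt (2 * (\<Sum>i\<in>UNIV. prob_space.variance P (\<lambda>\<omega>'. F i (component i \<omega>'))))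
            + c * x}
         \<le> exp (- (LINT s:{0..x}|lborel. gen_inverse h s))"
proof -
  have ps: "poisson_space X_topology (X_measure \<nu>) P fst" by (rule poisson_space_X[OF radon diffuse P])
  interpret poisson_space X_topology "X_measure \<nu>" P fst by (rule ps)
  have s: "sets (\<nu> i) = sets borel" for i using radon[of i] by (simp add: radon_measure_def)
  define G where "G i \<omega> = F i (component i \<omega>)" for i \<omega>
  define X where "X \<omega> = (\<chi> i. G i \<omega>)" for \<omega>
  have fvX: "functional_vector F = X" by (simp add: fun_eq_iff functional_vector_def X_def G_def)
  have Gm[measurable]: "G i \<in> borel_measurable P" for i
    unfolding G_def by (rule measurable_compose[OF measurable_component[OF ps] F])
  have Xm[measurable]: "X \<in> borel_measurable P" by (rule borel_measurable_vec) (simp add: X_def)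
  define a where "a = (\<integral>\<omega>. X \<omega> \<partial>P)"
  define m where "m = expectation (\<lambda>\<omega>. norm (X \<omega> - a))"
  have h_eq: "h = h_fun \<nu> \<beta> m" unfolding h m_def a_def fvX ..
  have h_mono: "h s \<le> h t" if "s \<le> t" for s t unfolding h_eq by (rule h_fun_mono[OF that])
  \<comment> \<open>\<open>t1\<close> is both the witness that keeps the generalized inverse
    meaningful up to the level \<open>x\<close> and the exponent for which the first exponential
    moment is shown to be finite.\<close>
  obtain t1 where t1: "0 < t1" "ereal t1 < t\<^sub>0" "ennreal x < h t1"
    by (rule left_limit_less[OF h_mono t0 x(2)])
  have h_fin: "h t < \<infinity>" if "0 \<le> t" "ereal t < t\<^sub>0" for t by (rule h_finite[OF that])
  have h1: "h t1 \<noteq> 0" "h t1 < \<infinity>" using t1 h_fin[of t1] by auto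
  have m0: "0 \<le> m" unfolding m_def by (rule Bochner_Integration.integral_nonneg) simp
  \<comment> \<open>If \<open>m = 0\<close>, the coefficient of the second term of \<open>h\<close>
    is infinite. As \<open>h t1\<close> is finite, the integrals with exponent 3 vanish, hence also
    those with exponent 1, and \<open>h t1 = 0\<close> contradicts \<open>h t1 > x\<close>.\<close>
  have m_pos: "0 < m"
  proof (rule ccontr)
    assume "\<not> 0 < m"
    then have "m = 0" using m0 by simp
    then have "2 * of_nat CARD('n) / ennreal m ^ 2 = \<infinity>"
      by (simp add: ennreal_divide_zero)
    moreover have "2 * of_nat CARD('n) / ennreal m ^ 2 * (SUP i. h_term (\<nu> i) (\<beta> i) 3 t1) < \<infinity>"
      using h1(2) unfolding h_eq h_fun_eq by (simp add: less_top)
    ultimately have "(SUP i. h_term (\<nu> i) (\<beta> i) 3 t1) = 0"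
      by (auto simp: ennreal_top_mult split: if_splits)
    then have "h_term (\<nu> i) (\<beta> i) 3 t1 = 0" for i
      using SUP_upper[of i UNIV "\<lambda>i. h_term (\<nu> i) (\<beta> i) 3 t1"] by simp
    then have 1: "h_term (\<nu> i) (\<beta> i) 1 t1 = 0" and 3: "h_term (\<nu> i) (\<beta> i) 3 t1 = 0" for i
      using h_term_eq_0_AE[OF s t1(1), of 3] h_term_eq_0_AE[OF s t1(1), of 1] by auto
    have "h t1 = 0" unfolding h_eq h_fun_eq 1 3 by simp
    then show False using h1(1) by simp
  qed
  have \<beta>_inf: "AE y in \<nu> i. False" if "\<beta> i = \<infinity>" for i
  proof -
    have "8 * (SUP i. h_term (\<nu> i) (\<beta> i) 1 t1) < \<infinity>"
      using h1(2) unfolding h_eq h_fun_eq by (simp add: less_top)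
    then have "(SUP i. h_term (\<nu> i) (\<beta> i) 1 t1) < \<infinity>"
      by (auto simp: ennreal_mult_less_top less_top)
    then have "h_term (\<nu> i) (\<beta> i) 1 t1 < \<infinity>"
      using SUP_upper[of i UNIV "\<lambda>i. h_term (\<nu> i) (\<beta> i) 1 t1"] by (auto intro: order.strict_trans1)
    then have "AE y in \<nu> i. y = 0" using h_term_finite_AE[OF s t1(1), of i] that by simp
    moreover have "AE y in \<nu> i. y \<noteq> 0"
      using diffuse[of i] s[of i] by (intro AE_I[of _ _ "{0}"]) (auto simp: diffuse_def)
    ultimately show ?thesis by eventually_elim simp
  qed
  \<comment> \<open>An infinite \<open>\<beta> i\<close> is turned into 0 by
    \<open>enn2real\<close>; this is admissible because \<open>\<nu> i\<close> is then the zero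
    measure.\<close>
  define b where "b x = enn2real (\<beta> (fst x)) * norm (snd x)" for x :: "'n \<times> 'y"
  have b0: "0 \<le> b x" for x by (simp add: b_def)
  have bm: "b \<in> borel_measurable (X_measure \<nu>)"
  proof -
    have "b \<in> borel_measurable (count_space UNIV \<Otimes>\<^sub>M borel)" unfolding b_def by measurable
    then show ?thesis by (simp cong: measurable_cong_sets)
  qed
  have inc: "AE x in X_measure \<nu>. AE \<omega> in P. \<bar>G i (insert x \<omega>) - G i \<omega>\<bar> \<le> (if fst x = i then b x else 0)" for i
  proof (rule AE_X_measureI[OF s])
    fix j
    show "AE y in \<nu> j. AE \<omega> in P. \<bar>G i (insert (j, y) \<omega>) - G i \<omega>\<bar> \<le> (if fst (j, y) = i then b (j, y) else 0)"
    proof (cases "\<beta> j = \<infinity>")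
      case True
      show ?thesis using \<beta>_inf[OF True] by eventually_elim simp
    next
      case False
      have "AE y in \<nu> j. y \<noteq> 0"
        using diffuse[of j] s[of j] by (intro AE_I[of _ _ "{0}"]) (auto simp: diffuse_def)
      then show ?thesis
      proof eventually_elim
        case (elim y)
        show ?case
        proof (cases "j = i")
          case True
          show ?thesis using beta_AE[OF space_P \<beta> elim, of i]
          proof eventually_elim
            case (elim \<omega>)
            have "\<bar>diff_op y (F i) (component i \<omega>)\<bar> / norm y \<le> enn2real (\<beta> i)"
              using elim False True by (cases "\<beta> i") auto
            then have "\<bar>diff_op y (F i) (component i \<omega>)\<bar> \<le> enn2real (\<beta> i) * norm y"
              using \<open>y \<noteq> 0\<close> by (simp add: divide_le_eq)
            then show ?case using True by (simp add: G_def component_insert diff_op_def b_def)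
          qed
        next
          case False
          then show ?thesis by (simp add: G_def component_insert)
        qed
      qed
    qed
  qed
  define \<eta> where "\<eta> t = enn2real (h t)" for t
  have h\<eta>: "h t = ennreal (\<eta> t)" if "0 \<le> t" "ereal t < t\<^sub>0" for t
    unfolding \<eta>_def using h_fin[OF that] by simp
  have \<eta>0: "0 \<le> \<eta> t" for t by (simp add: \<eta>_def)
  have moment: "(\<integral>\<^sup>+x. ennreal (b x ^ p * (exp (t * b x) - 1)) * indicator (fst -` {i}) x \<partial>X_measure \<nu>) \<le>
      h_term (\<nu> i) (\<beta> i) p t" if t: "0 < t" and p: "0 < p" for t p i
  proof -
    have fm: "(\<lambda>x. ennreal (b x ^ p * (exp (t * b x) - 1))) \<in> borel_measurable (X_measure \<nu>)"
      using bm by measurable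
    have "(\<integral>\<^sup>+x. ennreal (b x ^ p * (exp (t * b x) - 1)) * indicator (fst -` {i}) x \<partial>X_measure \<nu>) =
        (\<integral>\<^sup>+y. ennreal (b (i, y) ^ p * (exp (t * b (i, y)) - 1)) \<partial>\<nu> i)"
      by (rule nn_integral_X_measure[OF s fm])
    also have "\<dots> \<le> h_term (\<nu> i) (\<beta> i) p t"
    proof (cases "\<beta> i")
      case (real r)
      have m: "(\<lambda>y. ennreal (norm y) ^ p * ennreal_expm1 (ennreal t * \<beta> i * ennreal (norm y))) \<in> borel_measurable (\<nu> i)"
        unfolding measurable_cong_sets[OF s refl] by measurable
      have "ennreal (b (i, y) ^ p * (exp (t * b (i, y)) - 1)) =
          \<beta> i ^ p * (ennreal (norm y) ^ p * ennreal_expm1 (ennreal t * \<beta> i * ennreal (norm y)))" for y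
      proof -
        have "ennreal t * \<beta> i * ennreal (norm y) = ennreal (t * (r * norm y))"
          using real t by (simp add: ennreal_mult[symmetric] mult.assoc)
        then have "ennreal_expm1 (ennreal t * \<beta> i * ennreal (norm y)) = ennreal (exp (t * (r * norm y)) - 1)"
          using real t by (simp add: ennreal_expm1_ennreal)
        then show ?thesis
          using real t by (simp add: b_def ennreal_power ennreal_mult[symmetric] power_mult_distrib mult.assoc)
      qed
      then show ?thesis unfolding h_term_def by (simp add: nn_integral_cmult[OF m])
    next
      case top
      then show ?thesis using p by (simp add: b_def)
    qed
    finally show ?thesis .
  qed
  \<comment> \<open>\<open>V\<close> enters the condition only as a denominator, so a bound with
    \<open>m^2\<close> in its place holds for every larger \<open>V\<close> as well. The instances
    used are \<open>m^2\<close> and the sum of the variances.\<close>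
  have eb: "exp_bound b V \<tau> \<eta>" if V: "m\<^sup>2 \<le> V" and \<tau>: "0 < \<tau>" "ereal \<tau> < t\<^sub>0" for V \<tau>
    unfolding exp_bound_def
  proof (intro conjI allI impI)
    have V0: "0 < V" using V m_pos by (meson less_le_trans zero_less_power)
    then show "0 < V" .
    show "0 < \<tau>" by (rule \<tau>)
    show "b \<in> borel_measurable (X_measure \<nu>)" by (rule bm)
    show "0 \<le> b x" for x by (rule b0)
    have lt: "ereal t < t\<^sub>0" if "t \<le> \<tau>" for t
      using that \<tau>(2) by (meson ereal_less_eq(3) order.strict_trans1)
    show "mono_on {0..\<tau>} \<eta>"
    proof (rule mono_onI)
      fix r t assume rt: "r \<in> {0..\<tau>}" "t \<in> {0..\<tau>}" "r \<le> t"
      then show "\<eta> r \<le> \<eta> t"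
        unfolding \<eta>_def using h_mono[OF rt(3)] h_fin[of t] lt[of t] by (intro enn2real_mono) auto
    qed
    show "0 \<le> \<eta> t" for t by (rule \<eta>0)
    show "\<eta> r / r \<le> \<eta> t / t" if rt: "0 < r" "r \<le> t" "t \<le> \<tau>" for r t
    proof -
      have "ennreal t * h r \<le> ennreal r * h t" unfolding h_eq by (rule h_fun_scale[OF s rt(1,2)])
      then have "ennreal (t * \<eta> r) \<le> ennreal (r * \<eta> t)"
        using rt lt[of t] lt[of r] \<eta>0 by (simp add: h\<eta> ennreal_mult)
      then have "t * \<eta> r \<le> r * \<eta> t" using rt \<eta>0 by (subst (asm) ennreal_le_iff) auto
      then show ?thesis using rt by (simp add: field_simps)
    qed
    fix t assume t: "0 < t" "t \<le> \<tau>"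
    define S where "S p = (SUP i. h_term (\<nu> i) (\<beta> i) p t)" for p
    have ht: "h t = 8 * S 1 + 2 * of_nat CARD('n) / ennreal m ^ 2 * S 3"
      unfolding h_eq h_fun_eq S_def ..
    have C: "2 * of_nat CARD('n) / ennreal m ^ 2 = ennreal (2 * real CARD('n) / m\<^sup>2)"
      using m_pos by (simp add: ennreal_power divide_ennreal[symmetric] ennreal_of_nat_eq_real_of_nat ennreal_mult)
    have fin: "h t < \<infinity>" using h_fin[of t] lt[of t] t by simp
    have S1: "S 1 < \<infinity>" using fin unfolding ht by (auto simp: ennreal_mult_less_top less_top[symmetric] ennreal_mult_eq_top_iff)
    have "ennreal (2 * real CARD('n) / m\<^sup>2) * S 3 < \<infinity>" using fin unfolding ht C by (simp add: less_top)
    moreover have "ennreal (2 * real CARD('n) / m\<^sup>2) \<noteq> 0" using m_pos by simp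
    ultimately have S3: "S 3 < \<infinity>" by (auto simp: ennreal_mult_less_top)
    define K1 where "K1 = enn2real (S 1)"
    define K3 where "K3 = enn2real (S 3)"
    have SK: "S 1 = ennreal K1" "S 3 = ennreal K3" using S1 S3 by (auto simp: K1_def K3_def)
    have K0: "0 \<le> K1" "0 \<le> K3" by (auto simp: K1_def K3_def)
    have hK: "h t = ennreal (8 * K1 + 2 * real CARD('n) / m\<^sup>2 * K3)"
    proof -
      have 1: "8 * ennreal K1 = ennreal (8 * K1)" using K0 by (simp add: ennreal_mult)
      have 3: "ennreal (2 * real CARD('n) / m\<^sup>2) * ennreal K3 = ennreal (2 * real CARD('n) / m\<^sup>2 * K3)"
        using K0 m_pos by (intro ennreal_mult[symmetric]) auto
      show ?thesis
        unfolding ht C SK 1 3 using K0 m_pos by (intro ennreal_plus[symmetric]) auto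
    qed
    have "\<eta> t = 8 * K1 + 2 * real CARD('n) / m\<^sup>2 * K3"
      unfolding \<eta>_def hK using K0 by (intro enn2real_ennreal) auto
    moreover have "2 * real CARD('n) / V * K3 \<le> 2 * real CARD('n) / m\<^sup>2 * K3"
      using V V0 m_pos K0 by (intro mult_right_mono divide_left_mono) auto
    moreover have "moments_le b t K1 K3"
      unfolding moments_le_def SK[symmetric]
    proof (intro allI conjI)
      fix i
      show "(\<integral>\<^sup>+x. ennreal (b x ^ 1 * (exp (t * b x) - 1)) * indicator (fst -` {i}) x \<partial>X_measure \<nu>) \<le> S 1"
        unfolding S_def using t(1) by (intro SUP_upper2[of i] moment) auto
      show "(\<integral>\<^sup>+x. ennreal (b x ^ 3 * (exp (t * b x) - 1)) * indicator (fst -` {i}) x \<partial>X_measure \<nu>) \<le> S 3"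
        unfolding S_def using t(1) by (intro SUP_upper2[of i] moment) auto
    qed
    ultimately show "\<exists>K1 K3. 0 \<le> K1 \<and> 0 \<le> K3 \<and> moments_le b t K1 K3 \<and> 8 * K1 + 2 * real CARD('n) / V * K3 \<le> \<eta> t"
      using K0 by (intro exI[of _ K1] exI[of _ K3]) auto
  qed
  \<comment> \<open>A function that is not integrable has integral 0 by convention, so
    \<open>m > 0\<close> entails integrability. This works even though \<open>a\<close> might itself
    still be such a default value.\<close>
  have int_norm: "integrable P (\<lambda>\<omega>. norm (X \<omega> - a))"
    using m_pos unfolding m_def by (metis less_irrefl not_integrable_integral_eq)
  have iG: "integrable P (G i)" for i
  proof -
    have "integrable P (\<lambda>\<omega>. G i \<omega> - a $ i)"
    proof (rule Bochner_Integration.integrable_bound[OF int_norm])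
      show "AE \<omega> in P. norm (G i \<omega> - a $ i) \<le> norm (norm (X \<omega> - a))"
      proof (rule AE_I2)
        fix \<omega>
        show "norm (G i \<omega> - a $ i) \<le> norm (norm (X \<omega> - a))"
          using component_le_norm_cart[of "X \<omega> - a" i] by (simp add: X_def)
      qed
    qed measurable
    then have "integrable P (\<lambda>\<omega>. (G i \<omega> - a $ i) + a $ i)" by (intro Bochner_Integration.integrable_add) auto
    then show ?thesis by simp
  qed
  have iX: "integrable P X"
  proof (rule Bochner_Integration.integrable_bound)
    show "integrable P (\<lambda>\<omega>. \<Sum>i\<in>UNIV. \<bar>G i \<omega>\<bar>)"
      by (intro Bochner_Integration.integrable_sum integrable_abs iG)
    show "AE \<omega> in P. norm (X \<omega>) \<le> norm (\<Sum>i\<in>UNIV. \<bar>G i \<omega>\<bar>)"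
    proof (rule AE_I2)
      fix \<omega>
      have "norm (X \<omega>) \<le> (\<Sum>i\<in>UNIV. \<bar>X \<omega> $ i\<bar>)" by (rule norm_le_l1_cart)
      then show "norm (X \<omega>) \<le> norm (\<Sum>i\<in>UNIV. \<bar>G i \<omega>\<bar>)" by (simp add: X_def)
    qed
  qed measurable
  have a_eq: "a $ i = expectation (G i)" for i
  proof -
    have "X \<omega> $ i = G i \<omega>" for \<omega> by (simp add: X_def)
    then show ?thesis using integral_bounded_linear[OF bounded_linear_vec_nth iX, of i] by (simp add: a_def)
  qed
  have norm_a: "(norm (X \<omega> - a))\<^sup>2 = (\<Sum>i\<in>UNIV. (G i \<omega> - expectation (G i))\<^sup>2)" for \<omega>
    unfolding power2_norm_vec by (simp add: X_def a_eq)
  have exp_mom: "(\<integral>\<^sup>+\<omega>. ennreal (exp (\<tau> * shifted_norm a V (X \<omega>))) \<partial>P) \<le>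
      ennreal (exp (\<tau> * expectation (\<lambda>\<omega>. shifted_norm a V (X \<omega>)) + integral {0..\<tau>} \<eta>))"
    if "m\<^sup>2 \<le> V" "0 < \<tau>" "ereal \<tau> < t\<^sub>0" for V \<tau>
    unfolding X_def by (rule exp_moment[OF eb[OF that] iG inc])
  have int_sq: "integrable P (\<lambda>\<omega>. (norm (X \<omega> - a))\<^sup>2)"
  proof -
    \<comment> \<open>The square is dominated by the exponential through
      \<open>y^2 / 2 \<le> exp y\<close> for nonnegative \<open>y\<close>, with \<open>y\<close>
      equal to \<open>t1\<close> times the shifted norm.\<close>
    let ?e = "\<lambda>\<omega>. exp (t1 * shifted_norm a (m\<^sup>2) (X \<omega>))"
    have [measurable]: "(\<lambda>\<omega>. shifted_norm a (m\<^sup>2) (X \<omega>)) \<in> borel_measurable P"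
      by (rule measurable_compose[OF Xm borel_measurable_shifted_norm])
    have "integrable P ?e"
    proof (rule integrableI_bounded)
      have "(\<integral>\<^sup>+\<omega>. ennreal (?e \<omega>) \<partial>P) < \<infinity>"
        using exp_mom[OF order_refl t1(1,2)] by (rule order.strict_trans1) simp
      then show "(\<integral>\<^sup>+\<omega>. ennreal (norm (?e \<omega>)) \<partial>P) < \<infinity>" by simp
    qed measurable
    then have "integrable P (\<lambda>\<omega>. 2 / t1\<^sup>2 * ?e \<omega>)" by simp
    then show ?thesis
    proof (rule Bochner_Integration.integrable_bound)
      show "AE \<omega> in P. norm ((norm (X \<omega> - a))\<^sup>2) \<le> norm (2 / t1\<^sup>2 * ?e \<omega>)"
      proof (rule AE_I2)
        fix \<omega>
        let ?g = "shifted_norm a (m\<^sup>2) (X \<omega>)"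
        have g0: "0 \<le> t1 * ?g" using t1(1) by (intro mult_nonneg_nonneg shifted_norm_nonneg) auto
        have "(norm (X \<omega> - a))\<^sup>2 \<le> ?g\<^sup>2" unfolding shifted_norm_def by simp
        also have "?g\<^sup>2 = 2 / t1\<^sup>2 * ((t1 * ?g)\<^sup>2 / 2)" using t1(1) by (simp add: power_mult_distrib)
        also have "\<dots> \<le> 2 / t1\<^sup>2 * ?e \<omega>"
        proof (rule mult_left_mono)
          show "(t1 * ?g)\<^sup>2 / 2 \<le> ?e \<omega>" using exp_lower_Taylor_quadratic[OF g0] g0 by linarith
        qed simp
        finally show "norm ((norm (X \<omega> - a))\<^sup>2) \<le> norm (2 / t1\<^sup>2 * ?e \<omega>)" by simp
      qed
    qed measurable
  qed
  have iG2: "integrable P (\<lambda>\<omega>. (G i \<omega> - expectation (G i))\<^sup>2)" for i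
  proof (rule Bochner_Integration.integrable_bound[OF int_sq])
    show "AE \<omega> in P. norm ((G i \<omega> - expectation (G i))\<^sup>2) \<le> norm ((norm (X \<omega> - a))\<^sup>2)"
    proof (rule AE_I2)
      fix \<omega>
      have "(G i \<omega> - expectation (G i))\<^sup>2 \<le> (\<Sum>i\<in>UNIV. (G i \<omega> - expectation (G i))\<^sup>2)"
        by (rule member_le_sum) auto
      then show "norm ((G i \<omega> - expectation (G i))\<^sup>2) \<le> norm ((norm (X \<omega> - a))\<^sup>2)"
        by (simp add: norm_a)
    qed
  qed measurable
  define V where "V = (\<Sum>i\<in>UNIV. variance (G i))"
  have V_eq: "V = expectation (\<lambda>\<omega>. (norm (X \<omega> - a))\<^sup>2)"
    unfolding V_def norm_a by (subst Bochner_Integration.integral_sum) (auto intro: iG2)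
  have mV: "m\<^sup>2 \<le> V"
    unfolding V_eq m_def by (rule expectation_power2_le[OF int_norm int_sq])
  have V0: "0 < V" using mV m_pos by (meson less_le_trans zero_less_power)
  define g where "g \<omega> = shifted_norm a V (X \<omega>)" for \<omega>
  have gm[measurable]: "g \<in> borel_measurable P"
    unfolding g_def by (rule measurable_compose[OF Xm borel_measurable_shifted_norm])
  have g0: "0 \<le> g \<omega>" for \<omega> unfolding g_def using V0 by (intro shifted_norm_nonneg) simp
  have g2: "(g \<omega>)\<^sup>2 = (norm (X \<omega> - a))\<^sup>2 + V" for \<omega> unfolding g_def shifted_norm_def using V0 by simp
  have ig2: "integrable P (\<lambda>\<omega>. (g \<omega>)\<^sup>2)" unfolding g2 using int_sq by simp
  have ig: "integrable P g" by (rule square_integrable_imp_integrable[OF gm ig2])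
  have Eg: "expectation g \<le> sqrt (2 * V)"
  proof (rule real_le_rsqrt)
    have "(expectation g)\<^sup>2 \<le> expectation (\<lambda>\<omega>. (g \<omega>)\<^sup>2)" by (rule expectation_power2_le[OF ig ig2])
    also have "\<dots> = 2 * V"
      unfolding g2 using int_sq by (subst Bochner_Integration.integral_add) (auto simp: V_eq prob_space)
    finally show "(expectation g)\<^sup>2 \<le> 2 * V" .
  qed
  have f_cont: "continuous_on UNIV f" by (rule lipschitz_on_continuous_on[OF f])
  have fm[measurable]: "(\<lambda>\<omega>. f (X \<omega>)) \<in> borel_measurable P"
    by (rule measurable_compose[OF Xm borel_measurable_continuous_onI[OF f_cont]])
  have f_lip: "\<bar>f z - f z'\<bar> \<le> c * norm (z - z')" for z z'
    using lipschitz_onD[OF f, of z z'] by (simp add: dist_norm dist_real_def)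
  have f_le: "f (X \<omega>) - expectation (\<lambda>\<omega>'. f (X \<omega>')) \<le> c * g \<omega>" for \<omega>
  proof -
    let ?N = "\<lambda>\<omega>'. norm (X \<omega> - X \<omega>')"
    have N2: "(?N \<omega>')\<^sup>2 = (\<Sum>i\<in>UNIV. (X \<omega> $ i - a $ i)\<^sup>2 - 2 * (X \<omega> $ i - a $ i) * (G i \<omega>' - expectation (G i))
        + (G i \<omega>' - expectation (G i))\<^sup>2)" for \<omega>'
      unfolding power2_norm_vec by (intro sum.cong) (auto simp: X_def a_eq power2_eq_square algebra_simps)
    have iN2: "integrable P (\<lambda>\<omega>'. (?N \<omega>')\<^sup>2)"
      unfolding N2 using iG iG2 by (intro Bochner_Integration.integrable_sum) auto
    have iN: "integrable P ?N" by (rule square_integrable_imp_integrable[OF _ iN2]) measurable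
    \<comment> \<open>In the expansion around \<open>a\<close> the cross terms have mean zero and
      the squared deviations of \<open>G i\<close> contribute the variances, whose sum is
      \<open>V\<close>.\<close>
    have "expectation (\<lambda>\<omega>'. (?N \<omega>')\<^sup>2) = (\<Sum>i\<in>UNIV. (X \<omega> $ i - a $ i)\<^sup>2 + variance (G i))"
      unfolding N2 using iG iG2
      by (subst Bochner_Integration.integral_sum) (auto simp: prob_space intro!: sum.cong)
    also have "\<dots> = (g \<omega>)\<^sup>2"
      unfolding g2 power2_norm_vec V_def by (simp add: sum.distrib)
    finally have EN2: "expectation (\<lambda>\<omega>'. (?N \<omega>')\<^sup>2) = (g \<omega>)\<^sup>2" .
    have "(expectation ?N)\<^sup>2 \<le> (g \<omega>)\<^sup>2"
      using expectation_power2_le[OF iN iN2] unfolding EN2 .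
    then have EN: "expectation ?N \<le> g \<omega>" by (rule power2_le_imp_le[OF _ g0])
    \<comment> \<open>With \<open>\<omega>\<close> fixed, the Lipschitz bound dominates the
      difference by an integrable function; subtracting it from a constant gives integrability of
      \<open>f (X \<omega>')\<close>.\<close>
    have int_diff: "integrable P (\<lambda>\<omega>'. f (X \<omega>) - f (X \<omega>'))"
      by (rule Bochner_Integration.integrable_bound[of _ "\<lambda>\<omega>'. c * ?N \<omega>'"])
        (use iN f_lip in \<open>auto intro: order_trans[OF _ abs_ge_self]\<close>)
    have "integrable P (\<lambda>\<omega>'. f (X \<omega>) - (f (X \<omega>) - f (X \<omega>')))"
      by (rule Bochner_Integration.integrable_diff[OF _ int_diff]) simp
    then have "integrable P (\<lambda>\<omega>'. f (X \<omega>'))" by simp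
    then have "f (X \<omega>) - expectation (\<lambda>\<omega>'. f (X \<omega>')) = expectation (\<lambda>\<omega>'. f (X \<omega>) - f (X \<omega>'))"
      by (subst Bochner_Integration.integral_diff) (auto simp: prob_space)
    also have "\<dots> \<le> expectation (\<lambda>\<omega>'. c * ?N \<omega>')"
    proof (rule integral_mono[OF int_diff])
      show "f (X \<omega>) - f (X \<omega>') \<le> c * ?N \<omega>'" for \<omega>' using f_lip[of "X \<omega>" "X \<omega>'"] by linarith
    qed (use iN in simp)
    also have "\<dots> = c * expectation ?N" by simp
    also have "\<dots> \<le> c * g \<omega>" using c EN by (intro mult_left_mono) auto
    finally show ?thesis .
  qed
  let ?L = "LINT s:{0..x}|lborel. gen_inverse h s"
  define \<tau> where "\<tau> = gen_inverse h x"
  have xh: "ennreal x \<le> h t1" using t1(3) by (rule less_imp_le)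
  have inv: "0 \<le> gen_inverse h r" "gen_inverse h r \<le> \<tau>" "\<tau> \<le> t1" if "r \<le> x" for r
    using gen_inverse_set(1-3)[where h=h and t=t1 and x=x and r=r, OF t1(1) xh that] by (auto simp: \<tau>_def)
  define E where "E = {\<omega> \<in> space P. expectation g + x \<le> g \<omega>}"
  have E[measurable]: "E \<in> sets P" unfolding E_def by measurable
  have main: "prob E \<le> exp (- ?L)"
  proof (cases "\<tau> = 0")
    \<comment> \<open>The exponential moment inequality requires a positive exponent. For
      \<open>\<tau> = 0\<close> monotonicity makes the inverse vanish on all of
      \<open>[0, x]\<close>, and the claimed bound is 1.\<close>
    case True
    have "gen_inverse h r = 0" if "r \<in> {0..x}" for r using inv[of r] that True by auto
    then have "(\<integral>\<^sup>+r. ennreal (gen_inverse h r) * indicator {0..x} r \<partial>lborel) = (\<integral>\<^sup>+r. 0 \<partial>(lborel :: real measure))"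
      by (intro nn_integral_cong) (auto split: split_indicator)
    then have "?L \<le> 0" by (intro set_integral_le_nn_integral) (use inv in auto)
    then have "1 \<le> exp (- ?L)" by simp
    then show ?thesis using prob_le_1[of E] by linarith
  next
    case False
    then have \<tau>: "0 < \<tau>" using inv[of x] by simp
    have \<tau>t0: "ereal \<tau> < t\<^sub>0"
      using inv(3)[of x] by (intro order.strict_trans1[OF _ t1(2)]) simp
    have lt: "ereal r < t\<^sub>0" if "r < \<tau>" for r
      using that by (intro order.strict_trans[OF _ \<tau>t0]) simp
    have mono: "mono_on {0..\<tau>} \<eta>" using eb[OF mV \<tau> \<tau>t0] by (simp add: exp_bound_def)
    have L: "?L \<le> \<tau> * x - integral {0..\<tau>} \<eta>"
      by (rule gen_inverse_integral_le[where h=h and t=t1, OF x(1) t1(1) xh \<tau>_def \<tau> mono])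
        (use lt \<eta>0 in \<open>auto intro: h\<eta>\<close>)
    define \<kappa> where "\<kappa> = exp (- (\<tau> * (expectation g + x)))"
    have "E = {\<omega> \<in> space P. 1 \<le> ennreal \<kappa> * ennreal (exp (\<tau> * g \<omega>))}"
    proof -
      have "1 \<le> ennreal \<kappa> * ennreal (exp (\<tau> * g \<omega>)) \<longleftrightarrow> expectation g + x \<le> g \<omega>" for \<omega>
      proof -
        have "ennreal \<kappa> * ennreal (exp (\<tau> * g \<omega>)) = ennreal (exp (\<tau> * (g \<omega> - (expectation g + x))))"
          by (simp add: \<kappa>_def ennreal_mult[symmetric] exp_add[symmetric] algebra_simps)
        also have "1 \<le> \<dots> \<longleftrightarrow> 0 \<le> \<tau> * (g \<omega> - (expectation g + x))"
          by (simp flip: ennreal_1)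
        also have "\<dots> \<longleftrightarrow> expectation g + x \<le> g \<omega>" using \<tau> by (simp add: zero_le_mult_iff)
        finally show ?thesis .
      qed
      then show ?thesis by (simp add: E_def)
    qed
    then have "emeasure P E \<le> ennreal \<kappa> * (\<integral>\<^sup>+\<omega>. ennreal (exp (\<tau> * g \<omega>)) * indicator (space P) \<omega> \<partial>P)"
      by (simp only:) (rule nn_integral_Markov_inequality; measurable)
    also have "(\<integral>\<^sup>+\<omega>. ennreal (exp (\<tau> * g \<omega>)) * indicator (space P) \<omega> \<partial>P) = (\<integral>\<^sup>+\<omega>. ennreal (exp (\<tau> * g \<omega>)) \<partial>P)"
      by (rule nn_integral_cong) simp
    also have "ennreal \<kappa> * \<dots> \<le> ennreal \<kappa> * ennreal (exp (\<tau> * expectation g + integral {0..\<tau>} \<eta>))"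
      using exp_mom[OF mV \<tau> \<tau>t0] unfolding g_def by (intro mult_left_mono) auto
    also have "\<dots> = ennreal (exp (- (\<tau> * x - integral {0..\<tau>} \<eta>)))"
      by (simp add: \<kappa>_def ennreal_mult[symmetric] exp_add[symmetric] algebra_simps)
    also have "\<dots> \<le> ennreal (exp (- ?L))" using L by (intro ennreal_leI) simp
    finally show ?thesis by (simp add: emeasure_eq_measure)
  qed
  have "{\<omega> \<in> space P. f (X \<omega>) \<ge> expectation (\<lambda>\<omega>'. f (X \<omega>')) + c * sqrt (2 * V) + c * x} \<subseteq> E"
  proof
    fix \<omega> assume \<omega>: "\<omega> \<in> {\<omega> \<in> space P. f (X \<omega>) \<ge> expectation (\<lambda>\<omega>'. f (X \<omega>')) + c * sqrt (2 * V) + c * x}"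
    then have "c * (sqrt (2 * V) + x) \<le> c * g \<omega>" using f_le[of \<omega>] by (simp add: distrib_left)
    then have "sqrt (2 * V) + x \<le> g \<omega>" using c by simp
    then show "\<omega> \<in> E" using Eg \<omega> by (simp add: E_def)
  qed
  then have "prob {\<omega> \<in> space P. f (X \<omega>) \<ge> expectation (\<lambda>\<omega>'. f (X \<omega>')) + c * sqrt (2 * V) + c * x} \<le> prob E"
    by (intro finite_measure_mono E)
  then show ?thesis using main unfolding fvX V_def G_def by linarith
qed

end
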